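(* Let $N\ge 1$, $s\in(0,1)$, $a>0$, let $B_\rho(x_0)\subset\mathbb{R}^N$ be a ball, let $f$ be a locally Lipschitz function such that $f(t)$ is non-increasing for nonnegative and small values of $t$, and let $u\in\mathcal{C}^s(\mathbb{R}^N)$ be a weak solution of \[ \begin{cases} (-\Delta)^s u= f(u) & \text{in } \mathbb{R}^N\setminus\overline{B_\rho(x_0)},\\ u=a & \text{in } \overline{B_\rho(x_0)}, \end{cases} \] such that \[ (\partial_\nu)_s u<0\quad\text{on }\partial B_\rho(x_0). \] If $u$ satisfies \[ 0\le u<a \ \text{ in } \mathbb{R}^N\setminus\overline{B_\rho(x_0)},\qquad u(x)\to0\ \text{ as } |x|\to+\infty, \] then $u$ is radially symmetric and radially decreasing with respect to $x_0$.
   Context: The fractional Laplacian is $(-\Delta)^s u(x)=c_{N,s}\,\mathrm{P.V.}\int_{\mathbb{R}^N}\frac{u(x)-u(y)}{|x-y|^{N+2s}}\,dy$, with $c_{N,s}>0$ a normalization constant. Set $\mathcal{E}(u,v)=\frac{c_{N,s}}{2}\int_{\mathbb{R}^{2N}}\frac{(u(x)-u(y))(v(x)-v(y))}{|x-y|^{N+2s}}\,dx\,dy$, and let $\mathcal{D}^s(\mathbb{R}^N)$ be the completion of $\mathcal{C}^\infty_c(\mathbb{R}^N)$ with respect to the norm induced by $\mathcal{E}$. A weak solution of $(-\Delta)^s w=g$ in an open set $U$ is a function $w\in\mathcal{D}^s(\mathbb{R}^N)$ with $\mathcal{E}(w,\varphi)=\int_U g\varphi\,dx$ for every $\varphi\in\mathcal{C}_c^\infty(U)$;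 here $g=f(u)$. $\mathcal{C}^s(\mathbb{R}^N)$ is the space of $s$-Hölder continuous functions. On $\partial B_\rho(x_0)$, $\nu$ is the unit normal pointing into $\mathbb{R}^N\setminus\overline{B_\rho(x_0)}$, and $(\partial_\nu)_s u(y):=\lim_{t\to0^+}\frac{u(y+t\nu(y))-u(y)}{t^s}$; writing a condition on $(\partial_\nu)_s u$ includes the assumption that this limit exists. "$f(t)$ is non-increasing for nonnegative and small values of $t$" means that there is $t_0>0$ such that $f$ is non-increasing on $[0,t_0]$. "Radially decreasing with respect to $x_0$" means that $u$, as a function of $|x-x_0|$, is strictly decreasing in $\mathbb{R}^N\setminus\overline{B_\rho(x_0)}$ (it is constant on $\overline{B_\rho(x_0)}$). *)

theory Defs
  imports "HOL-Analysis.Analysis"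
begin

primrec C_k :: "nat \<Rightarrow> ('a::euclidean_space \<Rightarrow> real) \<Rightarrow> bool" where
  "C_k 0 f \<longleftrightarrow> continuous_on UNIV f"
| "C_k (Suc k) f \<longleftrightarrow> (\<forall>x. f differentiable (at x)) \<and>
     (\<forall>b\<in>Basis. C_k k (\<lambda>x. frechet_derivative f (at x) b))"

definition test_functions :: "'a::euclidean_space set \<Rightarrow> ('a \<Rightarrow> real) set" where
  "test_functions U = {\<phi>. (\<forall>k. C_k k \<phi>) \<and>
     compact (closure {x. \<phi> x \<noteq> 0}) \<and> closure {x. \<phi> x \<noteq> 0} \<subseteq> U}"

text \<open>
  The parameter \<open>c\<close> is the normalization constant of the fractional Laplacian of order \<open>2 s\<close>.
  On the diagonal the integrand is \<open>0 / 0 = 0\<close>; the diagonal is a null set.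
\<close>

definition energy :: "real \<Rightarrow> real \<Rightarrow> ('a::euclidean_space \<Rightarrow> real) \<Rightarrow> ('a \<Rightarrow> real) \<Rightarrow> real" where
  "energy c s u v = c / 2 * integral\<^sup>L (lborel :: ('a \<times> 'a) measure)
     (\<lambda>(x, y). (u x - u y) * (v x - v y) / norm (x - y) powr (real DIM('a) + 2 * s))"

definition energy_norm :: "real \<Rightarrow> real \<Rightarrow> ('a::euclidean_space \<Rightarrow> real) \<Rightarrow> real" where
  "energy_norm c s u = sqrt (energy c s u u)"

text \<open>
  The completion of the smooth compactly supported functions with respect to the energy norm,
  realized as a space of functions: the almost everywhere limits of energy-Cauchy sequences of such
  functions. If \<open>N > 2 s\<close>, the Sobolev inequality makes the limit function of a Cauchy sequence
  unique up to null sets, and this is the completion. If \<open>N \<le> 2 s\<close>, elements of the abstract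
  completion are functions modulo additive constants, and all representatives are included here.
  The Cauchy condition only involves energies of test functions, which are finite, so it is not
  affected by the convention that the integral of a non-integrable function is \<open>0\<close>; by Fatou's
  lemma, every element of the space has finite energy and is the limit of the sequence in energy.
\<close>

definition D_space :: "real \<Rightarrow> real \<Rightarrow> ('a::euclidean_space \<Rightarrow> real) set" where
  "D_space c s = {w. w \<in> borel_measurable lborel \<and>
     (\<exists>\<phi>. (\<forall>n. \<phi> n \<in> test_functions UNIV) \<and>
        (\<forall>e>0. \<exists>M. \<forall>m\<ge>M. \<forall>n\<ge>M. energy_norm c s (\<lambda>x. \<phi> m x - \<phi> n x) < e) \<and>
        (AE x in lborel. (\<lambda>n. \<phi> n x) \<longlonglongrightarrow> w x))}"

text \<open>
  The energy term is an absolutely convergent integral for \<open>w\<close> in \<open>D_space c s\<close>, by the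
  Cauchy-Schwarz inequality; convergence of the right-hand side is required explicitly.
\<close>

definition weak_solution ::
  "real \<Rightarrow> real \<Rightarrow> 'a::euclidean_space set \<Rightarrow> ('a \<Rightarrow> real) \<Rightarrow> ('a \<Rightarrow> real) \<Rightarrow> bool" where
  "weak_solution c s U g w \<longleftrightarrow> w \<in> D_space c s \<and>
     (\<forall>\<phi>\<in>test_functions U. set_integrable lborel U (\<lambda>x. g x * \<phi> x) \<and>
        energy c s w \<phi> = set_lebesgue_integral lborel U (\<lambda>x. g x * \<phi> x))"

definition holder_continuous :: "real \<Rightarrow> ('a::euclidean_space \<Rightarrow> real) \<Rightarrow> bool" where
  "holder_continuous s u \<longleftrightarrow> (\<exists>C. \<forall>x y. \<bar>u x - u y\<bar> \<le> C * dist x y powr s)"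

definition locally_lipschitz :: "(real \<Rightarrow> real) \<Rightarrow> bool" where
  "locally_lipschitz f \<longleftrightarrow> (\<forall>t. \<exists>r>0. \<exists>L. L-lipschitz_on (cball t r) f)"

definition outer_normal :: "'a::euclidean_space \<Rightarrow> real \<Rightarrow> 'a \<Rightarrow> 'a" where
  "outer_normal x0 \<rho> y = (y - x0) /\<^sub>R \<rho>"

definition has_fractional_derivative ::
  "real \<Rightarrow> ('a::euclidean_space \<Rightarrow> real) \<Rightarrow> 'a \<Rightarrow> 'a \<Rightarrow> real \<Rightarrow> bool" where
  "has_fractional_derivative s u y \<nu> l \<longleftrightarrow>
     ((\<lambda>t. (u (y + t *\<^sub>R \<nu>) - u y) / t powr s) \<longlongrightarrow> l) (at_right 0)"

definition radially_symmetric_decreasing ::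
  "'a::euclidean_space \<Rightarrow> real \<Rightarrow> ('a \<Rightarrow> real) \<Rightarrow> bool" where
  "radially_symmetric_decreasing x0 \<rho> u \<longleftrightarrow>
     (\<exists>h. (\<forall>x. u x = h (dist x x0)) \<and> strict_antimono_on {\<rho><..} h)"

end

theory Submission
  imports Defs "HOL-Computational_Algebra.Polynomial"
begin

text \<open>
  The proof is the method of moving planes, run on the weak formulation. Fix a unit vector \<open>e\<close> and
  \<open>l > 0\<close>, let \<open>R\<close> be the reflection across the hyperplane \<open>(x - x0) \<bullet> e = l\<close>, let \<open>H\<close> be the open
  half-space beyond it (the one without \<open>x0\<close>), and put \<open>w = u \<circ> R - u\<close>. Everything follows from
  \<open>w \<ge> 0\<close> in \<open>H\<close> for all \<open>e\<close> and all \<open>l > 0\<close>: for \<open>l \<rightarrow> 0\<close> it shows that \<open>u\<close> does not decrease under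
  any reflection through \<open>x0\<close> that starts on the side of \<open>e\<close>; two points at equal distance from \<open>x0\<close>
  are exchanged by such a reflection, so \<open>u\<close> is radial; and for \<open>l > 0\<close> it is the monotonicity of the
  radial profile.

  The reflection moves points of \<open>H\<close> closer to \<open>x0\<close>. Hence it maps \<open>H \<inter> B\<close> into the ball \<open>B\<close>, so that
  \<open>w = 0\<close> there, while \<open>w = a - u \<ge> 0\<close> at the points that are reflected into \<open>B\<close>. In the remaining
  open set \<open>\<Omega>\<close> both \<open>u\<close> and \<open>u \<circ> R\<close> solve the equation, and \<open>w\<close> is an odd solution of
  \<open>(-\<Delta>)^s w = f (u \<circ> R) - f u\<close>. Two principles are obtained by testing with odd functions
  that are supported in \<open>\<Omega>\<close> and its mirror image; folding the energy onto \<open>H \<times> H\<close> makes the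
  signs visible (\<open>sym_density\<close>).

  \<^item> Weak maximum principle (\<open>weak_maximum_small_measure\<close>): \<open>w \<ge> 0\<close> in \<open>H\<close> as soon as the set
    \<open>{w < 0}\<close> has small measure in a fixed large ball. The test function is the negative part of \<open>w\<close>.
    Where \<open>u \<le> t0\<close>, monotonicity of \<open>f\<close> gives the reaction term the good sign. The rest of
    \<open>{w < 0}\<close> is a bounded set, and there the Lipschitz bound \<open>L \<bar>w\<bar>\<close> is absorbed: within distance \<open>r\<close> of
    each of its points, at least half of a ball of radius \<open>r / 2\<close> in \<open>H\<close> belongs to \<open>{w \<ge> 0}\<close>, and the
    kernel mass of that half is of order \<open>r^(-2s)\<close>, which exceeds any multiple of \<open>L\<close> for small \<open>r\<close>. This simple bound plays the role of a Faber-Krahn inequality and holds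
    in every dimension, whether or not \<open>N > 2s\<close>.

  \<^item> Strong maximum principle (\<open>strong_maximum_principle\<close>): if \<open>w \<ge> 0\<close> in \<open>H\<close>, then \<open>w > 0\<close> almost
    everywhere in \<open>\<Omega>\<close>. Every point feels the open set of points reflected into \<open>B\<close>, on which \<open>w\<close> is
    bounded below; a zero set of positive measure in \<open>\<Omega>\<close> would contradict the equation.

  The planes now move by connectedness of \<open>{0<..}\<close> (\<open>ordered_across_all\<close>). The set of good \<open>l\<close>
  contains all large \<open>l\<close>, since \<open>u \<rightarrow> 0\<close> at infinity; it is closed, since \<open>u\<close> is continuous; and it is
  open, since by the strong principle the measure of \<open>{w < 0}\<close> tends to \<open>0\<close> as the plane approaches a
  good one. The strong principle also gives strict decrease: if the profile were constant on an
  interval, \<open>w\<close> would vanish on an open subset of \<open>\<Omega>\<close> for the plane through its middle.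

  The functions used for testing are neither smooth nor, at the start, known to have finite energy.
  Both points are settled first: elements of the energy space have finite energy by Fatou's lemma
  (\<open>D_space_finite_energy\<close>), and mollification extends the weak formulation to continuous test
  functions with compact support and finite energy (\<open>weak_solution_continuous_test\<close>).
\<close>

section \<open>Smooth functions, mollifiers and convolution\<close>

lemma C_k_Suc_imp: "C_k (Suc k) f \<Longrightarrow> C_k k f"
proof (induction k arbitrary: f)
  case 0
  then show ?case
    by (auto intro!: differentiable_imp_continuous_on simp: differentiable_on_def differentiable_at_withinI)
next
  case (Suc k)
  then show ?case by auto
qed

lemma C_k_continuous: "C_k k f \<Longrightarrow> continuous_on UNIV f"
  by (induction k) (use C_k_Suc_imp in auto)

lemma C_k_SucI:
  assumes "\<And>x. (f has_derivative f' x) (at x)"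
    and "\<And>b. b \<in> Basis \<Longrightarrow> C_k k (\<lambda>x. f' x b)"
  shows "C_k (Suc k) f"
proof -
  have "frechet_derivative f (at x) = f' x" for x
    using frechet_derivative_at[OF assms(1)] by simp
  then show ?thesis using assms by (auto simp: differentiable_def)
qed

lemma C_k_SucE:
  assumes "C_k (Suc k) f"
  obtains f' where "\<And>x. (f has_derivative f' x) (at x)"
    and "\<And>b. b \<in> Basis \<Longrightarrow> C_k k (\<lambda>x. f' x b)"
  using assms frechet_derivative_works by (metis C_k.simps(2))

lemma C_k_const: "C_k k (\<lambda>x. c)"
  by (induction k arbitrary: c) (auto simp: frechet_derivative_const)

lemma C_k_add: "C_k k f \<Longrightarrow> C_k k g \<Longrightarrow> C_k k (\<lambda>x. f x + g x)"
proof (induction k arbitrary: f g)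
  case 0
  then show ?case by (auto intro: continuous_on_add)
next
  case (Suc k)
  obtain f' where f': "\<And>x. (f has_derivative f' x) (at x)" "\<And>b. b \<in> Basis \<Longrightarrow> C_k k (\<lambda>x. f' x b)"
    using Suc.prems(1) by (rule C_k_SucE) blast
  obtain g' where g': "\<And>x. (g has_derivative g' x) (at x)" "\<And>b. b \<in> Basis \<Longrightarrow> C_k k (\<lambda>x. g' x b)"
    using Suc.prems(2) by (rule C_k_SucE) blast
  show ?case
    by (rule C_k_SucI[where f'="\<lambda>x h. f' x h + g' x h"])
      (use f' g' Suc.IH in \<open>auto intro!: derivative_intros\<close>)
qed

lemma C_k_mult: "C_k k f \<Longrightarrow> C_k k g \<Longrightarrow> C_k k (\<lambda>x. f x * g x)"
proof (induction k arbitrary: f g)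
  case 0
  then show ?case by (auto intro: continuous_on_mult)
next
  case (Suc k)
  obtain f' where f': "\<And>x. (f has_derivative f' x) (at x)" "\<And>b. b \<in> Basis \<Longrightarrow> C_k k (\<lambda>x. f' x b)"
    using Suc.prems(1) by (rule C_k_SucE) blast
  obtain g' where g': "\<And>x. (g has_derivative g' x) (at x)" "\<And>b. b \<in> Basis \<Longrightarrow> C_k k (\<lambda>x. g' x b)"
    using Suc.prems(2) by (rule C_k_SucE) blast
  have "C_k k f" "C_k k g" using Suc.prems C_k_Suc_imp by auto
  then show ?case
    by (intro C_k_SucI[where f'="\<lambda>x h. f x * g' x h + f' x h * g x"])
      (use f' g' Suc.IH in \<open>auto intro!: derivative_intros C_k_add\<close>)
qed

lemma C_k_sum: "(\<And>i. i \<in> I \<Longrightarrow> C_k k (f i)) \<Longrightarrow> C_k k (\<lambda>x. \<Sum>i\<in>I. f i x)"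
  by (induction I rule: infinite_finite_induct) (auto intro: C_k_const C_k_add)

lemma C_k_inner: "C_k k (\<lambda>x. x \<bullet> b)"
proof (cases k)
  case (Suc j)
  have "C_k (Suc j) (\<lambda>x. x \<bullet> b)"
    by (rule C_k_SucI[where f'="\<lambda>x h. h \<bullet> b"]) (auto intro!: derivative_eq_intros C_k_const)
  then show ?thesis using Suc by simp
qed (auto intro!: continuous_intros)

lemma C_k_diff: "C_k k f \<Longrightarrow> C_k k g \<Longrightarrow> C_k k (\<lambda>x. f x - g x)"
  using C_k_add[OF _ C_k_mult[OF C_k_const[of k "-1"]], of f g] by simp

text \<open>
  The outer function is given with the whole sequence \<open>G j\<close> of its derivatives, because the induction
  on \<open>k\<close> passes from \<open>G j\<close> to \<open>G (Suc j)\<close>.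
\<close>

lemma C_k_compose_real:
  fixes G :: "nat \<Rightarrow> real \<Rightarrow> real"
  assumes G: "\<And>j t. (G j has_real_derivative G (Suc j) t) (at t)"
  shows "C_k k f \<Longrightarrow> C_k k (\<lambda>x. G j (f x))"
proof (induction k arbitrary: j)
  case 0
  have "continuous_on UNIV (G j)"
    using G by (meson DERIV_isCont continuous_at_imp_continuous_on)
  then show ?case using 0 by (auto intro: continuous_on_compose2)
next
  case (Suc k)
  obtain f' where f': "\<And>x. (f has_derivative f' x) (at x)" "\<And>b. b \<in> Basis \<Longrightarrow> C_k k (\<lambda>x. f' x b)"
    using Suc.prems(1) by (rule C_k_SucE) blast
  have "C_k k f" using Suc.prems C_k_Suc_imp by auto
  moreover have "((\<lambda>x. G j (f x)) has_derivative (\<lambda>h. G (Suc j) (f x) * f' x h)) (at x)" for x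
    using has_derivative_compose[OF f'(1), of "G j" "(*) (G (Suc j) (f x))" x] G[of j "f x"]
    by (simp add: has_field_derivative_def)
  ultimately show ?case
    by (intro C_k_SucI[where f'="\<lambda>x h. G (Suc j) (f x) * f' x h"] C_k_mult f' Suc.IH)
qed

text \<open>
  The flat function \<open>exp (- 1 / t)\<close> for \<open>t > 0\<close>, extended by \<open>0\<close>, together with all its derivatives:
  \<open>flat j\<close> is the \<open>j\<close>-th derivative, a polynomial in \<open>1 / t\<close> times the exponential.
\<close>

primrec flat_poly :: "nat \<Rightarrow> real poly" where
  "flat_poly 0 = 1"
| "flat_poly (Suc j) = [:0, 0, 1:] * (flat_poly j - pderiv (flat_poly j))"

definition flat :: "nat \<Rightarrow> real \<Rightarrow> real" where
  "flat j t = (if t > 0 then poly (flat_poly j) (1 / t) * exp (- (1 / t)) else 0)"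

lemma tendsto_poly_div_exp: "((\<lambda>y. poly p y / exp y) \<longlongrightarrow> (0::real)) at_top"
proof -
  have "((\<lambda>y. \<Sum>i\<le>degree p. coeff p i * (y ^ i / exp y)) \<longlongrightarrow> (\<Sum>i\<le>degree p. coeff p i * 0)) at_top"
    by (intro tendsto_intros tendsto_power_div_exp_0)
  then show ?thesis by (simp add: poly_altdef sum_divide_distrib)
qed

text \<open>
  At \<open>t = 0\<close> the difference quotient is a polynomial in \<open>1 / t\<close> times \<open>exp (- 1 / t)\<close>, which tends to \<open>0\<close>.
\<close>

lemma flat_has_derivative: "(flat j has_real_derivative flat (Suc j) t) (at t)"
proof -
  consider "t > 0" | "t < 0" | "t = 0" by linarith
  then show ?thesis
  proof cases
    case 1
    have "((\<lambda>t. poly (flat_poly j) (1 / t) * exp (- (1 / t))) has_real_derivative flat (Suc j) t) (at t)"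
      unfolding flat_def
      by (rule derivative_eq_intros DERIV_chain2[OF poly_DERIV] | use 1 in force)+
        (use 1 in \<open>simp add: algebra_simps power2_eq_square divide_simps\<close>)
    then show ?thesis
      by (rule has_field_derivative_transform_within_open[where S="{0<..}"])
        (use 1 in \<open>auto simp: flat_def\<close>)
  next
    case 2
    have "((\<lambda>t. 0) has_real_derivative flat (Suc j) t) (at t)"
      using 2 by (auto simp: flat_def)
    then show ?thesis
      by (rule has_field_derivative_transform_within_open[where S="{..<0}"])
        (use 2 in \<open>auto simp: flat_def\<close>)
  next
    case 3
    let ?q = "[:0, 1:] * flat_poly j"
    have "((\<lambda>h. poly ?q (inverse h) / exp (inverse h)) \<longlongrightarrow> 0) (at_right (0::real))"
      by (rule filterlim_compose[OF tendsto_poly_div_exp filterlim_inverse_at_top_right])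
    then have "((\<lambda>h. flat j h / h) \<longlongrightarrow> 0) (at_right 0)"
      by (rule Lim_transform_eventually)
        (auto intro!: eventually_at_rightI[of 0 1] simp: flat_def exp_minus field_simps)
    moreover have "((\<lambda>h. flat j h / h) \<longlongrightarrow> 0) (at_left 0)"
      by (rule Lim_transform_eventually[OF tendsto_const])
        (auto intro!: eventually_at_leftI[of "-1" 0] simp: flat_def)
    ultimately have "((\<lambda>h. flat j h / h) \<longlongrightarrow> 0) (at 0)"
      by (simp add: filterlim_at_split)
    then show ?thesis using 3 by (simp add: DERIV_def flat_def)
  qed
qed

lemma lborel_integrable_continuous_compact_support:
  fixes v :: "'a::euclidean_space \<Rightarrow> real"
  assumes "continuous_on UNIV v" and "\<And>x. x \<notin> S \<Longrightarrow> v x = 0" and "compact S"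
  shows "integrable lborel v"
proof -
  obtain l r where "S \<subseteq> cbox l r"
    using bounded_subset_cbox_symmetric[OF compact_imp_bounded[OF assms(3)]] by metis
  then have "v = (\<lambda>x. indicator (cbox l r) x * v x)"
    using assms(2) by (intro ext) (metis indicator_simps mult_1 mult_zero_left subsetD)
  moreover have "set_integrable lborel (cbox l r) v"
    unfolding set_integrable_def
    by (intro borel_integrable_compact continuous_on_subset[OF assms(1)]) auto
  ultimately show ?thesis unfolding set_integrable_def by simp
qed

text \<open>
  A nonempty open set has positive measure, so an almost everywhere statement whose exceptional set
  is open has no exceptions.
\<close>

lemma AE_lborel_imp_everywhere:
  fixes P :: "'a::euclidean_space \<Rightarrow> bool"
  assumes "AE x in lborel. P x" and "open {x. \<not> P x}"
  shows "P x"
proof (rule ccontr)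
  assume "\<not> P x"
  have "{x. \<not> P x} \<in> sets lborel" using assms(2) by simp
  then have "{x. \<not> P x} \<in> null_sets lborel"
    using assms(1) AE_iff_null_sets[of "{x. \<not> P x}" lborel] by simp
  then have "negligible {x. \<not> P x}"
    by (simp add: negligible_iff_null_sets null_sets_completionI)
  then show False using open_not_negligible[OF assms(2)] \<open>\<not> P x\<close> by blast
qed

lemma mollifier_exists:
  assumes "\<delta> > 0"
  obtains \<eta> :: "'a::euclidean_space \<Rightarrow> real"
  where "\<And>k. C_k k \<eta>" "\<And>x. \<eta> x \<ge> 0" "\<And>x. norm x \<ge> \<delta> \<Longrightarrow> \<eta> x = 0"
    "integrable lborel \<eta>" "integral\<^sup>L lborel \<eta> = 1"
proof -
  define \<beta> :: "'a \<Rightarrow> real" where "\<beta> = (\<lambda>x. flat 0 (\<delta>\<^sup>2 - (\<Sum>b\<in>Basis. (x \<bullet> b) * (x \<bullet> b))))"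
  have \<beta>_eq: "\<beta> x = flat 0 (\<delta>\<^sup>2 - (norm x)\<^sup>2)" for x
    unfolding \<beta>_def power2_norm_eq_inner by (subst (2) euclidean_inner) simp
  have smooth: "C_k k \<beta>" for k
    unfolding \<beta>_def
    by (intro C_k_compose_real[of flat] flat_has_derivative C_k_diff C_k_const C_k_sum C_k_mult C_k_inner)
  have nonneg: "\<beta> x \<ge> 0" for x by (simp add: \<beta>_eq flat_def)
  have zero: "\<beta> x = 0" if "norm x \<ge> \<delta>" for x
    using power_mono[OF that, of 2] assms unfolding \<beta>_eq flat_def by (simp add: not_less)
  have "\<beta> 0 > 0" using assms by (simp add: \<beta>_eq flat_def)
  have cont: "continuous_on UNIV \<beta>" using smooth[of 0] by simp
  have int: "integrable lborel \<beta>"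
    by (rule lborel_integrable_continuous_compact_support[OF cont, of "cball 0 \<delta>"]) (auto simp: zero)
  have "integral\<^sup>L lborel \<beta> \<noteq> 0"
  proof
    assume "integral\<^sup>L lborel \<beta> = 0"
    then have "AE x in lborel. \<beta> x = 0"
      using integral_nonneg_eq_0_iff_AE[OF int] nonneg by auto
    moreover have "open {x. \<not> \<beta> x = 0}"
      using cont by (intro open_Collect_neq) auto
    ultimately have "\<beta> 0 = 0" by (rule AE_lborel_imp_everywhere)
    then show False using \<open>\<beta> 0 > 0\<close> by simp
  qed
  then have pos: "integral\<^sup>L lborel \<beta> > 0"
    using nonneg by (simp add: order_less_le)
  define C where "C = inverse (integral\<^sup>L lborel \<beta>)"
  have "C > 0" "C * integral\<^sup>L lborel \<beta> = 1" using pos by (auto simp: C_def)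
  then show ?thesis
    by (intro that[of "\<lambda>x. C * \<beta> x"])
      (use nonneg zero int in \<open>auto intro!: C_k_mult C_k_const smooth\<close>)
qed

text \<open>
  Each derivative falls on the smooth factor, by differentiation under the integral sign; the box
  stands for any box that contains the support of \<open>v\<close>.
\<close>

lemma C_k_convolution:
  fixes v \<eta> :: "'a::euclidean_space \<Rightarrow> real"
  assumes v: "continuous_on UNIV v"
  shows "C_k k \<eta> \<Longrightarrow> C_k k (\<lambda>x. integral (cbox l r) (\<lambda>y. v y * \<eta> (x - y)))"
proof (induction k arbitrary: \<eta>)
  case 0
  then have "continuous_on UNIV \<eta>" by simp
  then have "continuous_on (UNIV \<times> cbox l r) (\<lambda>z. \<eta> (fst z - snd z))"
    by (rule continuous_on_compose2) (auto intro!: continuous_intros)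
  moreover have "continuous_on (UNIV \<times> cbox l r) (\<lambda>z. v (snd z))"
    by (rule continuous_on_compose2[OF v]) (auto intro!: continuous_intros)
  ultimately have "continuous_on (UNIV \<times> cbox l r) (\<lambda>(x, y). v y * \<eta> (x - y))"
    unfolding split_beta by (intro continuous_on_mult)
  then show ?case unfolding C_k.simps by (rule integral_continuous_on_param)
next
  case (Suc k)
  obtain \<eta>' where \<eta>': "\<And>x. (\<eta> has_derivative \<eta>' x) (at x)" "\<And>b. b \<in> Basis \<Longrightarrow> C_k k (\<lambda>x. \<eta>' x b)"
    using Suc.prems(1) by (rule C_k_SucE) blast
  have \<eta>_cont: "continuous_on UNIV \<eta>" using Suc.prems by (rule C_k_continuous)
  define D where "D x y = (\<Sum>b\<in>Basis. (v y * \<eta>' (x - y) b) *\<^sub>R blinfun_inner_right b)" for x y :: 'a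
  have lin: "linear (\<eta>' x)" for x using \<eta>'(1) has_derivative_linear by blast
  have D_apply: "blinfun_apply (D x y) h = v y * \<eta>' (x - y) h" for x y h
  proof -
    have "\<eta>' (x - y) (\<Sum>b\<in>Basis. (h \<bullet> b) *\<^sub>R b) = (\<Sum>b\<in>Basis. (h \<bullet> b) * \<eta>' (x - y) b)"
      unfolding linear_sum[OF lin] linear_cmul[OF lin] by simp
    then have "v y * \<eta>' (x - y) h = (\<Sum>b\<in>Basis. v y * ((h \<bullet> b) * \<eta>' (x - y) b))"
      by (simp add: euclidean_representation sum_distrib_left)
    then show ?thesis
      unfolding D_def blinfun.sum_left blinfun.scaleR_left blinfun_inner_right.rep_eq
      by (simp add: ac_simps inner_commute)
  qed
  have D_cont: "continuous_on (UNIV \<times> cbox l r) (\<lambda>(x, y). D x y)"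
  proof -
    have "continuous_on (UNIV \<times> cbox l r) (\<lambda>z. \<eta>' (fst z - snd z) b)" if "b \<in> Basis" for b
      by (rule continuous_on_compose2[OF C_k_continuous[OF \<eta>'(2)[OF that]]]) (auto intro!: continuous_intros)
    moreover have "continuous_on (UNIV \<times> cbox l r) (\<lambda>z. v (snd z))"
      by (rule continuous_on_compose2[OF v]) (auto intro!: continuous_intros)
    ultimately show ?thesis
      unfolding D_def split_beta
      by (intro continuous_on_sum continuous_on_scaleR continuous_on_mult continuous_on_const)
  qed
  have D_int: "D x integrable_on cbox l r" for x
  proof (rule integrable_continuous)
    have "continuous_on (cbox l r) (\<lambda>y. (x, y))" by (intro continuous_intros)
    from continuous_on_compose2[OF D_cont this] show "continuous_on (cbox l r) (D x)" by auto
  qed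
  show ?case
  proof (rule C_k_SucI)
    show "((\<lambda>x. integral (cbox l r) (\<lambda>y. v y * \<eta> (x - y))) has_derivative
      blinfun_apply (integral (cbox l r) (D x))) (at x)" for x
    proof (rule leibniz_rule[of UNIV, simplified])
      fix x t
      have "((\<lambda>x. v t * \<eta> (x - t)) has_derivative (\<lambda>h. v t * \<eta>' (x - t) h)) (at x)"
        by (intro has_derivative_mult_right has_derivative_compose[OF _ \<eta>'(1)])
          (auto intro!: derivative_eq_intros)
      then show "((\<lambda>x. v t * \<eta> (x - t)) has_derivative blinfun_apply (D x t)) (at x)"
        by (simp add: D_apply[abs_def])
    next
      show "(\<lambda>y. v y * \<eta> (x - y)) integrable_on cbox l r" for x
        by (intro integrable_continuous continuous_on_mult continuous_on_subset[OF v]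
            continuous_on_compose2[OF \<eta>_cont] continuous_intros) auto
    qed (simp_all add: D_cont)
    fix b :: 'a assume b: "b \<in> Basis"
    have "blinfun_apply (integral (cbox l r) (D x)) b = integral (cbox l r) (\<lambda>y. v y * \<eta>' (x - y) b)" for x
      using integral_linear[OF D_int[of x] blinfun.bounded_linear_left[of b]]
      by (simp add: o_def D_apply)
    then show "C_k k (\<lambda>x. blinfun_apply (integral (cbox l r) (D x)) b)"
      using Suc.IH[OF \<eta>'(2)[OF b]] by simp
  qed
qed

section \<open>Isometries preserve Lebesgue measure\<close>

lemma nn_integral_lborel_translate:
  fixes f :: "'a::euclidean_space \<Rightarrow> ennreal"
  assumes [measurable]: "f \<in> borel_measurable borel"
  shows "(\<integral>\<^sup>+x. f (t + x) \<partial>lborel) = (\<integral>\<^sup>+x. f x \<partial>lborel)"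
proof -
  have "(\<integral>\<^sup>+x. f x \<partial>lborel) = (\<integral>\<^sup>+x. f x \<partial>(distr lborel borel ((+) t)))"
    by (simp add: lborel_distr_plus)
  also have "\<dots> = (\<integral>\<^sup>+x. f (t + x) \<partial>lborel)" by (subst nn_integral_distr) auto
  finally show ?thesis by simp
qed

text \<open>
  Uniqueness of translation invariant measures in the style of Haar: for a unit ball \<open>B\<close> of
  measure \<open>b\<close>, both measures of \<open>A\<close> times \<open>b\<close> are computed as one double integral over
  \<open>A\<close> and \<open>B\<close>. Translating in one variable at a time and exchanging the order of integration turns one
  into the other, because an isometry pulls a ball back to a ball of equal radius. The result is
  applied on \<open>'a\<close> and on \<open>'a \<times> 'a\<close>, where reflecting only one of the two variables is an isometry too.
\<close>

lemma lborel_distr_isometry: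
  fixes L :: "'a::euclidean_space \<Rightarrow> 'a"
  assumes L: "linear L" and norm_L: "\<And>x. norm (L x) = norm x"
  shows "distr lborel borel (\<lambda>x. c + L x) = lborel"
proof (rule measure_eqI)
  fix A :: "'a set" assume "A \<in> sets (distr lborel borel (\<lambda>x. c + L x))"
  then have A[measurable]: "A \<in> sets borel" by simp
  have L_diff: "L (x - y) = L x - L y" for x y using L by (rule linear_diff)
  have "inj L" using L norm_L by (metis injI norm_eq_zero eq_iff_diff_eq_0 L_diff)
  then have "surj L" using L by (simp add: linear_injective_imp_surjective)
  then obtain L' where L': "\<And>y. L (L' y) = y" by (metis surjD)
  have [measurable]: "L \<in> borel_measurable borel"
    using linear_continuous_on[of L UNIV] L by (auto intro: borel_measurable_continuous_onI simp: linear_conv_bounded_linear)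
  define B :: "'a set" where "B = ball 0 1"
  have [measurable]: "B \<in> sets borel" unfolding B_def by simp
  define b where "b = emeasure lborel B"
  have b: "b \<noteq> 0" "b \<noteq> \<infinity>"
    using emeasure_lborel_ball_finite[of "0::'a" 1] content_ball_pos[of 1 "0::'a"]
    by (auto simp: b_def B_def measure_def)
  let ?T = "\<lambda>x. c + L x"
  have "emeasure (distr lborel borel ?T) A * b
      = (\<integral>\<^sup>+x. indicator A (?T x) \<partial>lborel) * (\<integral>\<^sup>+y. indicator B y \<partial>lborel)"
    by (simp add: b_def nn_integral_indicator[symmetric] nn_integral_distr del: nn_integral_indicator)
  also have "\<dots> = (\<integral>\<^sup>+y. indicator B y * (\<integral>\<^sup>+x. indicator A (?T x) \<partial>lborel) \<partial>lborel)"
    by (subst nn_integral_multc) (auto simp: mult.commute intro!: borel_measurable_indicator)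
  also have "\<dots> = (\<integral>\<^sup>+y. indicator B y * (\<integral>\<^sup>+x. indicator A (?T x + y) \<partial>lborel) \<partial>lborel)"
  proof (rule nn_integral_cong, rule arg_cong2[where f="(*)", OF refl])
    fix y :: 'a
    have eq: "?T (L' y + x) = ?T x + y" for x
      using L' L by (simp add: linear_add)
    have "(\<integral>\<^sup>+x. indicator A (?T (L' y + x)) \<partial>lborel) = (\<integral>\<^sup>+x. indicator A (?T x) \<partial>lborel)"
      by (rule nn_integral_lborel_translate) measurable
    then show "(\<integral>\<^sup>+x. indicator A (?T x) \<partial>lborel) = (\<integral>\<^sup>+x. indicator A (?T x + y) \<partial>lborel)"
      unfolding eq by (rule sym)
  qed
  also have "\<dots> = (\<integral>\<^sup>+y. (\<integral>\<^sup>+x. indicator B y * indicator A (?T x + y) \<partial>lborel) \<partial>lborel)"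
    by (simp add: nn_integral_cmult)
  also have "\<dots> = (\<integral>\<^sup>+x. (\<integral>\<^sup>+y. indicator B y * indicator A (?T x + y) \<partial>lborel) \<partial>lborel)"
    by (rule lborel_pair.Fubini') measurable
  also have "\<dots> = (\<integral>\<^sup>+x. (\<integral>\<^sup>+y. indicator B (y - ?T x) * indicator A y \<partial>lborel) \<partial>lborel)"
  proof (rule nn_integral_cong)
    fix x
    show "(\<integral>\<^sup>+y. indicator B y * indicator A (?T x + y) \<partial>lborel)
      = (\<integral>\<^sup>+y. indicator B (y - ?T x) * indicator A y \<partial>lborel)"
      using nn_integral_lborel_translate[of "\<lambda>y. indicator B (y - ?T x) * indicator A y" "?T x"]
      by simp
  qed
  also have "\<dots> = (\<integral>\<^sup>+y. (\<integral>\<^sup>+x. indicator B (y - ?T x) * indicator A y \<partial>lborel) \<partial>lborel)"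
    by (rule lborel_pair.Fubini') measurable
  also have "\<dots> = (\<integral>\<^sup>+y. b * indicator A y \<partial>lborel)"
  proof (rule nn_integral_cong)
    fix y
    have "norm (y - ?T x) = dist (L' (y - c)) x" for x
      using norm_L[of "L' (y - c) - x"] unfolding L_diff L' dist_norm by (simp add: diff_diff_eq)
    then have *: "indicator B (y - ?T x) = (indicator (ball (L' (y - c)) 1) x :: ennreal)" for x
      by (simp add: indicator_def B_def)
    have "emeasure lborel (ball (L' (y - c)) 1) = b"
      by (simp add: b_def B_def emeasure_ball)
    then show "(\<integral>\<^sup>+x. indicator B (y - ?T x) * indicator A y \<partial>lborel) = b * indicator A y"
      unfolding * by (subst nn_integral_multc) (auto intro!: borel_measurable_indicator)
  qed
  also have "\<dots> = emeasure lborel A * b"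
    by (subst nn_integral_cmult) (auto simp: mult.commute)
  finally show "emeasure (distr lborel borel ?T) A = emeasure lborel A"
    using b ennreal_mult_cancel_left[of b "emeasure (distr lborel borel ?T) A" "emeasure lborel A"]
    by (simp add: mult.commute)
qed simp

lemma borel_measurable_affine_isometry:
  fixes L :: "'a::euclidean_space \<Rightarrow> 'a"
  assumes "linear L"
  shows "(\<lambda>x. c + L x) \<in> borel_measurable borel"
  by (intro borel_measurable_continuous_onI continuous_on_add continuous_on_const linear_continuous_on)
    (use assms in \<open>simp add: linear_conv_bounded_linear\<close>)

lemma
  fixes L :: "'a::euclidean_space \<Rightarrow> 'a"
  assumes L: "linear L" "\<And>x. norm (L x) = norm x" and T: "\<And>x. T x = c + L x"
  shows nn_integral_lborel_isometry: "h \<in> borel_measurable borel \<Longrightarrow> (\<integral>\<^sup>+x. h (T x) \<partial>lborel) = (\<integral>\<^sup>+x. h x \<partial>lborel)"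
    and integral_lborel_isometry: "g \<in> borel_measurable borel \<Longrightarrow> (\<integral>x. g (T x) \<partial>lborel) = (\<integral>x. g x \<partial>lborel :: real)"
    and integrable_lborel_isometry: "g \<in> borel_measurable borel \<Longrightarrow> integrable lborel g \<Longrightarrow> integrable lborel (\<lambda>x. g (T x) :: real)"
proof -
  have T_eq: "T = (\<lambda>x. c + L x)" using T by auto
  have [measurable]: "T \<in> borel_measurable borel"
    unfolding T_eq by (rule borel_measurable_affine_isometry[OF L(1)])
  have eq: "distr lborel borel T = lborel"
    unfolding T_eq by (rule lborel_distr_isometry[OF L])
  show "h \<in> borel_measurable borel \<Longrightarrow> (\<integral>\<^sup>+x. h (T x) \<partial>lborel) = (\<integral>\<^sup>+x. h x \<partial>lborel)"
    by (subst (2) eq[symmetric]) (simp add: nn_integral_distr)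
  show "g \<in> borel_measurable borel \<Longrightarrow> (\<integral>x. g (T x) \<partial>lborel) = (\<integral>x. g x \<partial>lborel)"
    by (subst (2) eq[symmetric]) (simp add: integral_distr)
  show "g \<in> borel_measurable borel \<Longrightarrow> integrable lborel g \<Longrightarrow> integrable lborel (\<lambda>x. g (T x))"
    using integrable_distr_eq[of T lborel borel g] unfolding eq by simp
qed

section \<open>Square-integrable functions and weak limits\<close>

lemma integrable_mult_of_squares:
  fixes f g :: "'b \<Rightarrow> real"
  assumes [measurable]: "f \<in> borel_measurable M" "g \<in> borel_measurable M"
    and "integrable M (\<lambda>x. (f x)\<^sup>2)" "integrable M (\<lambda>x. (g x)\<^sup>2)"
  shows "integrable M (\<lambda>x. f x * g x)"
proof (rule Bochner_Integration.integrable_bound)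
  show "integrable M (\<lambda>x. (f x)\<^sup>2 + (g x)\<^sup>2)" using assms by simp
  have "\<bar>f x * g x\<bar> \<le> (f x)\<^sup>2 + (g x)\<^sup>2" for x
    using sum_squares_bound[of "\<bar>f x\<bar>" "\<bar>g x\<bar>"] mult_nonneg_nonneg[of "\<bar>f x\<bar>" "\<bar>g x\<bar>"]
    unfolding abs_mult power2_abs by linarith
  then show "AE x in M. norm (f x * g x) \<le> norm ((f x)\<^sup>2 + (g x)\<^sup>2)" by (auto intro: order_trans)
qed simp

lemma integrable_square_diff:
  fixes f g :: "'b \<Rightarrow> real"
  assumes [measurable]: "f \<in> borel_measurable M" "g \<in> borel_measurable M"
    and "integrable M (\<lambda>x. (f x)\<^sup>2)" "integrable M (\<lambda>x. (g x)\<^sup>2)"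
  shows "integrable M (\<lambda>x. (f x - g x)\<^sup>2)"
    "(\<integral>x. (f x - g x)\<^sup>2 \<partial>M) \<le> 2 * (\<integral>x. (f x)\<^sup>2 \<partial>M) + 2 * (\<integral>x. (g x)\<^sup>2 \<partial>M)"
proof -
  have le: "(f x - g x)\<^sup>2 \<le> 2 * (f x)\<^sup>2 + 2 * (g x)\<^sup>2" for x
    using zero_le_power2[of "f x + g x"] by (simp add: power2_eq_square algebra_simps)
  have int: "integrable M (\<lambda>x. 2 * (f x)\<^sup>2 + 2 * (g x)\<^sup>2)" using assms by simp
  show 1: "integrable M (\<lambda>x. (f x - g x)\<^sup>2)"
    by (rule Bochner_Integration.integrable_bound[OF int]) (use le in \<open>auto intro: order_trans\<close>)
  have "(\<integral>x. (f x - g x)\<^sup>2 \<partial>M) \<le> (\<integral>x. 2 * (f x)\<^sup>2 + 2 * (g x)\<^sup>2 \<partial>M)"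
    by (rule integral_mono[OF 1 int]) (rule le)
  then show "(\<integral>x. (f x - g x)\<^sup>2 \<partial>M) \<le> 2 * (\<integral>x. (f x)\<^sup>2 \<partial>M) + 2 * (\<integral>x. (g x)\<^sup>2 \<partial>M)"
    using assms by simp
qed

text \<open>
  A bounded sequence in \<open>L\<^sup>2\<close> that converges almost everywhere converges weakly. With \<open>D\<close> the difference
  of \<open>G n\<close> and \<open>g\<close>, the part where \<open>\<bar>D\<bar> \<le> k \<bar>f\<bar>\<close> is dominated by \<open>k f\<^sup>2\<close>, and on the rest \<open>\<bar>f D\<bar> \<le> D\<^sup>2 / k\<close>
  has integral at most a constant over \<open>k\<close>.
\<close>

lemma weak_L2_limit:
  fixes f g :: "'b \<Rightarrow> real" and G :: "nat \<Rightarrow> 'b \<Rightarrow> real"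
  assumes [measurable]: "f \<in> borel_measurable M" "g \<in> borel_measurable M" "\<And>n. G n \<in> borel_measurable M"
    and f: "integrable M (\<lambda>x. (f x)\<^sup>2)" and g: "integrable M (\<lambda>x. (g x)\<^sup>2)"
    and G: "\<And>n. integrable M (\<lambda>x. (G n x)\<^sup>2)" "\<And>n. (\<integral>x. (G n x)\<^sup>2 \<partial>M) \<le> C"
    and lim: "AE x in M. (\<lambda>n. G n x) \<longlonglongrightarrow> g x"
  shows "(\<lambda>n. \<integral>x. f x * G n x \<partial>M) \<longlonglongrightarrow> (\<integral>x. f x * g x \<partial>M)"
proof (rule LIMSEQ_I)
  fix e :: real assume e: "e > 0"
  define C' where "C' = \<bar>2 * C + 2 * (\<integral>x. (g x)\<^sup>2 \<partial>M)\<bar> + 1"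
  have C': "C' > 0" unfolding C'_def by linarith
  \<comment> \<open>makes the tail \<open>C' / k\<close> equal to half of the tolerance\<close>
  define k where "k = 2 * C' / e"
  have k: "k > 0" using e C' by (simp add: k_def)
  define D where "D n x = G n x - g x" for n x
  have [measurable]: "D n \<in> borel_measurable M" for n unfolding D_def by simp
  have D_int: "integrable M (\<lambda>x. (D n x)\<^sup>2)" for n
    unfolding D_def by (rule integrable_square_diff) (use G g in auto)
  have D_le: "(\<integral>x. (D n x)\<^sup>2 \<partial>M) \<le> C'" for n
    using integrable_square_diff(2)[OF assms(3) assms(2) G(1) g, of n] G(2)[of n]
    unfolding D_def C'_def by linarith
  have fD: "integrable M (\<lambda>x. f x * D n x)" for n
    by (rule integrable_mult_of_squares) (use f D_int in auto)
  let ?m = "\<lambda>n x. min \<bar>f x * D n x\<bar> (k * (f x)\<^sup>2)"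
  have m_int: "integrable M (?m n)" for n
    by (rule Bochner_Integration.integrable_bound[of M "\<lambda>x. k * (f x)\<^sup>2"])
      (use f k in \<open>auto simp: abs_mult\<close>)
  have "(\<lambda>n. \<integral>x. ?m n x \<partial>M) \<longlonglongrightarrow> (\<integral>x. 0 \<partial>M)"
  proof (rule integral_dominated_convergence[where w="\<lambda>x. k * (f x)\<^sup>2"])
    show "AE x in M. (\<lambda>n. ?m n x) \<longlonglongrightarrow> 0"
      using lim
    proof (eventually_elim)
      case (elim x)
      have "(\<lambda>n. min \<bar>f x * D n x\<bar> (k * (f x)\<^sup>2)) \<longlonglongrightarrow> min \<bar>f x * (g x - g x)\<bar> (k * (f x)\<^sup>2)"
        unfolding D_def by (intro tendsto_intros elim)
      then show ?case using k by (simp add: min_def)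
    qed
  qed (use f k in \<open>auto simp: abs_mult\<close>)
  then obtain n0 where n0: "\<And>n. n \<ge> n0 \<Longrightarrow> norm ((\<integral>x. ?m n x \<partial>M) - 0) < e / 2"
    using LIMSEQ_D[of _ _ "e / 2"] e by fastforce
  have "norm ((\<integral>x. f x * G n x \<partial>M) - (\<integral>x. f x * g x \<partial>M)) < e" if "n \<ge> n0" for n
  proof -
    have "(\<integral>x. f x * G n x \<partial>M) - (\<integral>x. f x * g x \<partial>M) = (\<integral>x. f x * D n x \<partial>M)"
      by (subst Bochner_Integration.integral_diff[symmetric])
        (auto intro!: integrable_mult_of_squares f g G simp: D_def algebra_simps)
    also have "norm \<dots> \<le> (\<integral>x. \<bar>f x * D n x\<bar> \<partial>M)" by (simp add: integral_abs_bound)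
    also have "\<dots> \<le> (\<integral>x. ?m n x + (D n x)\<^sup>2 / k \<partial>M)"
    proof (rule integral_mono)
      fix x
      show "\<bar>f x * D n x\<bar> \<le> ?m n x + (D n x)\<^sup>2 / k"
      proof (cases "\<bar>D n x\<bar> \<le> k * \<bar>f x\<bar>")
        case True
        then have "\<bar>f x\<bar> * \<bar>D n x\<bar> \<le> \<bar>f x\<bar> * (k * \<bar>f x\<bar>)" by (intro mult_left_mono) auto
        then have "\<bar>f x * D n x\<bar> \<le> k * (f x)\<^sup>2" by (simp add: abs_mult power2_eq_square mult_ac)
        then show ?thesis using k by simp
      next
        case False
        then have "(k * \<bar>f x\<bar>) * \<bar>D n x\<bar> \<le> \<bar>D n x\<bar> * \<bar>D n x\<bar>" by (intro mult_right_mono) auto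
        then have "\<bar>f x * D n x\<bar> \<le> (D n x)\<^sup>2 / k"
          using k by (simp add: abs_mult power2_eq_square field_simps)
        moreover have "?m n x \<ge> 0" using k by simp
        ultimately show ?thesis by linarith
      qed
    qed (use fD m_int D_int in auto)
    also have "\<dots> = (\<integral>x. ?m n x \<partial>M) + (\<integral>x. (D n x)\<^sup>2 \<partial>M) / k"
      using m_int D_int by simp
    also have "\<dots> < e / 2 + C' / k"
      using n0[OF that] D_le[of n] k by (intro add_less_le_mono divide_right_mono) auto
    also have "\<dots> = e" using C' e by (simp add: k_def field_simps)
    finally show ?thesis .
  qed
  then show "\<exists>n0. \<forall>n\<ge>n0. norm ((\<integral>x. f x * G n x \<partial>M) - (\<integral>x. f x * g x \<partial>M)) < e" by blast
qed

section \<open>The kernel and functions of finite energy\<close>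

lemma ennreal_term_le_suminf: "f n \<le> (\<Sum>n. f n :: ennreal)"
  using sum_le_suminf[OF summableI, of "{n}" f] by simp

text \<open>
  Dyadic decomposition: on \<open>2^(-n-1) < \<bar>z\<bar> \<le> 2^(-n)\<close> the integrand is at most \<open>\<alpha> n\<close> and on
  \<open>2^n \<le> \<bar>z\<bar> < 2^(n+1)\<close> at most \<open>\<beta> n\<close>. Multiplied by the volumes of the balls, these bounds form
  geometric series with ratios \<open>2^(2s-2)\<close> and \<open>2^(-2s)\<close>, both below \<open>1\<close>.
\<close>

lemma truncated_kernel_integrable:
  assumes s: "0 < s" "s < 1"
  shows "integrable lborel (\<lambda>z::'a::euclidean_space. min 1 ((norm z)\<^sup>2) / norm z powr (real DIM('a) + 2 * s))"
proof -
  define N where "N = real DIM('a)"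
  define p where "p = N + 2 * s"
  have N: "N > 0" unfolding N_def by simp
  have p: "p > 0" using s N by (simp add: p_def)
  define \<omega> where "\<omega> = unit_ball_vol N"
  have \<omega>: "\<omega> \<ge> 0" using N unfolding \<omega>_def by simp
  let ?k = "\<lambda>z::'a. min 1 ((norm z)\<^sup>2) / norm z powr p"
  define \<alpha> \<beta> ra rb where "\<alpha> n = 2 powr ((real n + 1) * p - 2 * n)" and "\<beta> n = 2 powr (- (real n * p))"
    and "ra n = 2 powr (- real n)" and "rb n = 2 powr (real n + 1)" for n
  let ?A = "\<lambda>n z::'a. ennreal (\<alpha> n) * indicator (cball 0 (ra n)) z"
  let ?B = "\<lambda>n z::'a. ennreal (\<beta> n) * indicator (cball 0 (rb n)) z"
  have bound: "ennreal (?k z) \<le> (\<Sum>n. ?A n z) + (\<Sum>n. ?B n z)" for z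
  proof (cases "z = 0")
    case False
    define r where "r = norm z"
    have r: "r > 0" using False by (simp add: r_def)
    show ?thesis
    proof (cases "r \<le> 1")
      case True
      define m where "m = - log 2 r"
      define n where "n = nat \<lfloor>m\<rfloor>"
      have "m \<ge> 0" using True r by (simp add: m_def)
      then have n: "real n \<le> m" "m < real n + 1" unfolding n_def by linarith+
      have r_eq: "r = 2 powr (- m)" using r by (simp add: m_def)
      have "?k z \<le> (2 powr (- real n))\<^sup>2 / (2 powr (- (real n + 1))) powr p"
        unfolding r_def[symmetric] r_eq using n p
        by (intro frac_le min.coboundedI2 power_mono powr_mono2 powr_mono) auto
      also have "\<dots> = \<alpha> n"
        by (simp add: \<alpha>_def power2_eq_square powr_powr flip: powr_add powr_diff)
          (simp add: algebra_simps)
      finally have "ennreal (?k z) \<le> ennreal (\<alpha> n)" by (rule ennreal_leI)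
      moreover have "z \<in> cball 0 (ra n)"
        unfolding ra_def using n by (simp add: r_def[symmetric] r_eq)
      ultimately have "ennreal (?k z) \<le> ?A n z" by simp
      also have "\<dots> \<le> (\<Sum>n. ?A n z)"
        by (rule ennreal_term_le_suminf)
      finally show ?thesis by (rule order_trans) simp
    next
      case False
      define m where "m = log 2 r"
      define n where "n = nat \<lfloor>m\<rfloor>"
      have "m \<ge> 0" using False r by (simp add: m_def)
      then have n: "real n \<le> m" "m < real n + 1" unfolding n_def by linarith+
      have r_eq: "r = 2 powr m" using r by (simp add: m_def)
      have "?k z \<le> 1 / (2 powr n) powr p"
        unfolding r_def[symmetric] r_eq using n p
        by (intro frac_le powr_mono2 powr_mono) auto
      also have "\<dots> = \<beta> n"
        by (simp add: \<beta>_def powr_powr powr_minus_divide)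
      finally have "ennreal (?k z) \<le> ennreal (\<beta> n)" by (rule ennreal_leI)
      moreover have "z \<in> cball 0 (rb n)"
        unfolding rb_def using n by (simp add: r_def[symmetric] r_eq)
      ultimately have "ennreal (?k z) \<le> ?B n z" by simp
      also have "\<dots> \<le> (\<Sum>n. ?B n z)"
        by (rule ennreal_term_le_suminf)
      finally show ?thesis by (rule order_trans) simp
    qed
  qed simp
  have vol: "emeasure lborel (cball (0::'a) (2 powr t)) = ennreal (\<omega> * 2 powr (t * N))" for t
    by (simp add: emeasure_cball \<omega>_def N_def powr_powr flip: powr_realpow)
  have "(\<integral>\<^sup>+z. ?A n z \<partial>lborel) = ennreal (\<omega> * 2 powr p * (2 powr (2 * s - 2)) ^ n)" for n
  proof -
    have "(\<integral>\<^sup>+z. ?A n z \<partial>lborel) = ennreal (\<alpha> n) * ennreal (\<omega> * 2 powr ((- real n) * N))"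
      by (subst nn_integral_cmult_indicator) (auto simp: ra_def vol)
    also have "\<dots> = ennreal (\<alpha> n * (\<omega> * 2 powr ((- real n) * N)))"
      by (simp add: ennreal_mult \<alpha>_def \<omega>)
    also have "\<alpha> n * (\<omega> * 2 powr ((- real n) * N)) = \<omega> * 2 powr (p + (2 * s - 2) * n)"
      by (simp add: \<alpha>_def p_def algebra_simps flip: powr_add)
    also have "\<dots> = \<omega> * 2 powr p * (2 powr (2 * s - 2)) ^ n"
      by (simp add: powr_add powr_powr flip: powr_realpow)
    finally show ?thesis .
  qed
  moreover have "summable (\<lambda>n. \<omega> * 2 powr p * (2 powr (2 * s - 2)) ^ n)"
    using s by (intro summable_mult summable_geometric) (simp add: powr_less_one)
  ultimately have sA: "(\<Sum>n. \<integral>\<^sup>+z. ?A n z \<partial>lborel) < \<infinity>"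
    using \<omega> by (simp add: suminf_ennreal2)
  have "(\<integral>\<^sup>+z. ?B n z \<partial>lborel) = ennreal (\<omega> * 2 powr N * (2 powr (- 2 * s)) ^ n)" for n
  proof -
    have "(\<integral>\<^sup>+z. ?B n z \<partial>lborel) = ennreal (\<beta> n) * ennreal (\<omega> * 2 powr ((real n + 1) * N))"
      by (subst nn_integral_cmult_indicator) (auto simp: rb_def vol)
    also have "\<dots> = ennreal (\<beta> n * (\<omega> * 2 powr ((real n + 1) * N)))"
      by (simp add: ennreal_mult \<beta>_def \<omega>)
    also have "\<beta> n * (\<omega> * 2 powr ((real n + 1) * N)) = \<omega> * 2 powr (N + (- 2 * s) * n)"
      by (simp add: \<beta>_def p_def algebra_simps flip: powr_add)
    also have "\<dots> = \<omega> * 2 powr N * (2 powr (- 2 * s)) ^ n"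
      by (subst powr_add) (simp add: powr_powr flip: powr_realpow)
    finally show ?thesis .
  qed
  moreover have "summable (\<lambda>n. \<omega> * 2 powr N * (2 powr (- 2 * s)) ^ n)"
    using s by (intro summable_mult summable_geometric) (simp add: powr_less_one)
  ultimately have sB: "(\<Sum>n. \<integral>\<^sup>+z. ?B n z \<partial>lborel) < \<infinity>"
    using \<omega> by (simp add: suminf_ennreal2)
  have cball_meas: "cball (0::'a) r \<in> sets borel" for r by simp
  have [measurable]: "?A n \<in> borel_measurable borel" "?B n \<in> borel_measurable borel" for n
    using cball_meas by measurable
  have "(\<integral>\<^sup>+z. ennreal (?k z) \<partial>lborel) \<le> (\<integral>\<^sup>+z. (\<Sum>n. ?A n z) + (\<Sum>n. ?B n z) \<partial>lborel)"
    by (rule nn_integral_mono) (rule bound)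
  also have "\<dots> = (\<Sum>n. \<integral>\<^sup>+z. ?A n z \<partial>lborel) + (\<Sum>n. \<integral>\<^sup>+z. ?B n z \<partial>lborel)"
    by (subst nn_integral_add, measurable, subst (1 2) nn_integral_suminf) auto
  also have "\<dots> < \<infinity>" using sA sB by (simp add: less_top)
  finally have "integrable lborel ?k"
    by (intro integrableI_bounded) auto
  then show ?thesis unfolding p_def N_def .
qed

definition frac_kernel :: "real \<Rightarrow> 'a::euclidean_space \<times> 'a \<Rightarrow> real" where
  "frac_kernel s z = 1 / norm (fst z - snd z) powr (real DIM('a) + 2 * s)"

definition energy_density ::
  "real \<Rightarrow> ('a::euclidean_space \<Rightarrow> real) \<Rightarrow> ('a \<Rightarrow> real) \<Rightarrow> 'a \<times> 'a \<Rightarrow> real" where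
  "energy_density s u v z = (u (fst z) - u (snd z)) * (v (fst z) - v (snd z)) * frac_kernel s z"

definition finite_energy :: "real \<Rightarrow> ('a::euclidean_space \<Rightarrow> real) \<Rightarrow> bool" where
  "finite_energy s u \<longleftrightarrow> u \<in> borel_measurable borel \<and> integrable lborel (energy_density s u u)"

lemma energy_eq: "energy c s u v = c / 2 * integral\<^sup>L lborel (energy_density s u v)"
  unfolding energy_def energy_density_def frac_kernel_def by (simp add: case_prod_beta')

lemma frac_kernel_nonneg [simp]: "frac_kernel s z \<ge> 0"
  by (simp add: frac_kernel_def)

lemma measurable_fst_borel [measurable]:
  "fst \<in> borel_measurable (borel :: ('a::euclidean_space \<times> 'b::euclidean_space) measure)"
  by (intro borel_measurable_continuous_onI continuous_intros)

lemma measurable_snd_borel [measurable]: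
  "snd \<in> borel_measurable (borel :: ('a::euclidean_space \<times> 'b::euclidean_space) measure)"
  by (intro borel_measurable_continuous_onI continuous_intros)

lemma borel_measurable_frac_kernel [measurable]: "frac_kernel s \<in> borel_measurable borel"
  unfolding frac_kernel_def by measurable

lemma borel_measurable_energy_density [measurable]:
  assumes [measurable]: "u \<in> borel_measurable borel" "v \<in> borel_measurable borel"
  shows "energy_density s u v \<in> borel_measurable borel"
  unfolding energy_density_def by measurable

lemma finite_energy_measurable: "finite_energy s u \<Longrightarrow> u \<in> borel_measurable borel"
  by (simp add: finite_energy_def)

text \<open>
  Distributing the kernel over both factors turns the energy into an \<open>L\<^sup>2\<close> inner product.
\<close>

lemma energy_density_square:
  "energy_density s u v z
    = ((u (fst z) - u (snd z)) * sqrt (frac_kernel s z)) * ((v (fst z) - v (snd z)) * sqrt (frac_kernel s z))"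
  by (simp add: energy_density_def real_sqrt_mult_self flip: mult.assoc)

lemma energy_density_integrable:
  assumes "finite_energy s u" "finite_energy s v"
  shows "integrable lborel (energy_density s u v)"
proof -
  have [measurable]: "u \<in> borel_measurable borel" "v \<in> borel_measurable borel"
    using assms by (auto simp: finite_energy_def)
  have "integrable lborel (\<lambda>z. ((u (fst z) - u (snd z)) * sqrt (frac_kernel s z))
      * ((v (fst z) - v (snd z)) * sqrt (frac_kernel s z)))"
    by (rule integrable_mult_of_squares)
      (use assms in \<open>auto simp: finite_energy_def power2_eq_square simp flip: energy_density_square\<close>)
  then show ?thesis by (simp flip: energy_density_square)
qed

text \<open>
  Sums, differences and truncations of functions of finite energy have finite energy for this reason.
\<close>

lemma finite_energy_dominated:
  assumes "v \<in> borel_measurable borel" "finite_energy s u" "finite_energy s w"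
    and le: "\<And>x y. \<bar>v x - v y\<bar> \<le> C * \<bar>u x - u y\<bar> + D * \<bar>w x - w y\<bar>"
  shows "finite_energy s v"
  unfolding finite_energy_def
proof
  have [measurable]: "u \<in> borel_measurable borel" "w \<in> borel_measurable borel" "v \<in> borel_measurable borel"
    using assms by (auto simp: finite_energy_def)
  show "integrable lborel (energy_density s v v)"
  proof (rule Bochner_Integration.integrable_bound)
    show "integrable lborel (\<lambda>z. 2 * C\<^sup>2 * energy_density s u u z + 2 * D\<^sup>2 * energy_density s w w z)"
      using assms by (auto simp: finite_energy_def)
    have "norm (energy_density s v v z) \<le> 2 * C\<^sup>2 * energy_density s u u z + 2 * D\<^sup>2 * energy_density s w w z" for z
    proof -
      define a b where "a = C * \<bar>u (fst z) - u (snd z)\<bar>" and "b = D * \<bar>w (fst z) - w (snd z)\<bar>"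
      have "(v (fst z) - v (snd z))\<^sup>2 \<le> (a + b)\<^sup>2"
        using le[of "fst z" "snd z"] unfolding a_def b_def by (metis abs_ge_zero power2_abs power_mono)
      also have "\<dots> \<le> 2 * a\<^sup>2 + 2 * b\<^sup>2"
        using zero_le_power2[of "a - b"] by (simp add: power2_eq_square algebra_simps)
      finally have "(v (fst z) - v (snd z))\<^sup>2 * frac_kernel s z \<le> (2 * a\<^sup>2 + 2 * b\<^sup>2) * frac_kernel s z"
        by (rule mult_right_mono) simp
      then show ?thesis
        by (simp add: a_def b_def energy_density_def abs_mult power_mult_distrib algebra_simps flip: power2_eq_square)
    qed
    then show "AE z in lborel. norm (energy_density s v v z)
        \<le> norm (2 * C\<^sup>2 * energy_density s u u z + 2 * D\<^sup>2 * energy_density s w w z)"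
      by (intro AE_I2) (metis abs_ge_self order_trans real_norm_def)
  qed simp
qed (rule assms)

lemma continuous_on_abs_lipschitz:
  fixes \<phi> :: "'a::euclidean_space \<Rightarrow> real"
  assumes "\<And>x y. \<bar>\<phi> x - \<phi> y\<bar> \<le> L * norm (x - y)"
  shows "continuous_on UNIV \<phi>"
  by (rule lipschitz_on_continuous_on[of "\<bar>L\<bar>"], rule lipschitz_onI)
    (use assms in \<open>auto simp: dist_norm intro: order_trans[OF _ mult_right_mono[OF abs_ge_self]]\<close>)

text \<open>
  If \<open>\<phi>\<close> vanishes outside a ball \<open>B\<close>, an increment is nonzero only when one of its end points is in \<open>B\<close>, and
  its square is at most a constant times \<open>min 1 \<bar>x - y\<bar>\<^sup>2\<close>. The energy is therefore at most a constant times
  the measure of \<open>B\<close> times the integral of the truncated kernel.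
\<close>

lemma finite_energy_lipschitz:
  fixes \<phi> :: "'a::euclidean_space \<Rightarrow> real"
  assumes s: "0 < s" "s < 1"
    and lip: "\<And>x y. \<bar>\<phi> x - \<phi> y\<bar> \<le> L * norm (x - y)"
    and bdd: "\<And>x. \<bar>\<phi> x\<bar> \<le> M"
    and supp: "\<And>x. x \<notin> S \<Longrightarrow> \<phi> x = 0" and S: "bounded S"
  shows "finite_energy s \<phi>"
  unfolding finite_energy_def
proof
  have "continuous_on UNIV \<phi>" by (rule continuous_on_abs_lipschitz[OF lip])
  then show meas[measurable]: "\<phi> \<in> borel_measurable borel" by (rule borel_measurable_continuous_onI)
  obtain R where R: "S \<subseteq> ball 0 R" "R > 0"
    using S by (metis bounded_subset_ballD)
  define k where "k z = min 1 ((norm z)\<^sup>2) / norm z powr (real DIM('a) + 2 * s)" for z :: 'a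
  have k_int: "integrable lborel k"
    unfolding k_def by (rule truncated_kernel_integrable[OF s])
  have [measurable]: "k \<in> borel_measurable borel" unfolding k_def by measurable
  have k_nonneg: "k z \<ge> 0" for z by (simp add: k_def)
  define B :: "'a set" where "B = ball 0 R"
  have [measurable]: "B \<in> sets borel" by (simp add: B_def)
  define C where "C = max (L\<^sup>2) (4 * M\<^sup>2)"
  have C: "C \<ge> 0" by (simp add: C_def le_max_iff_disj)
  have pointwise: "energy_density s \<phi> \<phi> (x, y) \<le> C * (indicator B x * k (x - y)) + C * (indicator B y * k (x - y))" for x y
  proof (cases "x \<in> B \<or> y \<in> B")
    case True
    have "(\<phi> x - \<phi> y)\<^sup>2 \<le> C * min 1 ((norm (x - y))\<^sup>2)"
    proof -
      have "(\<phi> x - \<phi> y)\<^sup>2 \<le> (L * norm (x - y))\<^sup>2"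
        using lip[of x y] by (metis abs_ge_zero power2_abs power_mono)
      also have "\<dots> \<le> C * (norm (x - y))\<^sup>2"
        unfolding power_mult_distrib C_def by (intro mult_right_mono) auto
      finally have 1: "(\<phi> x - \<phi> y)\<^sup>2 \<le> C * (norm (x - y))\<^sup>2" .
      have "\<bar>\<phi> x - \<phi> y\<bar> \<le> 2 * M" using bdd[of x] bdd[of y] by linarith
      then have "(\<phi> x - \<phi> y)\<^sup>2 \<le> (2 * M)\<^sup>2" by (metis abs_ge_zero power2_abs power_mono)
      then have "(\<phi> x - \<phi> y)\<^sup>2 \<le> C" by (simp add: C_def power_mult_distrib)
      with 1 show ?thesis by (simp add: min_def)
    qed
    then have "energy_density s \<phi> \<phi> (x, y) \<le> C * k (x - y)"
      unfolding energy_density_def frac_kernel_def k_def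
      by (simp add: divide_right_mono flip: power2_eq_square)
    moreover have "0 \<le> C * k (x - y)" using C k_nonneg by simp
    ultimately show ?thesis using True by (auto simp: indicator_def)
  next
    case False
    then have "x \<notin> S" "y \<notin> S" using R by (auto simp: B_def)
    then have "\<phi> x = 0" "\<phi> y = 0" by (auto intro: supp)
    then show ?thesis using False by (simp add: energy_density_def)
  qed
  have ball_fin: "emeasure lborel B < \<infinity>" unfolding B_def by (rule emeasure_lborel_ball_finite)
  have k_fin: "(\<integral>\<^sup>+z. ennreal (k z) \<partial>lborel) < \<infinity>"
    using k_int k_nonneg by (simp add: integrable_iff_bounded)
  have shift1: "(\<integral>\<^sup>+y. ennreal (k (x - y)) \<partial>lborel) = (\<integral>\<^sup>+z. ennreal (k z) \<partial>lborel)" for x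
    by (rule nn_integral_lborel_isometry[where L=uminus and c=x and h="\<lambda>z. ennreal (k z)"]) (auto simp: linear_uminus)
  have shift2: "(\<integral>\<^sup>+x. ennreal (k (x - y)) \<partial>lborel) = (\<integral>\<^sup>+z. ennreal (k z) \<partial>lborel)" for y
    using nn_integral_lborel_translate[of "\<lambda>z. ennreal (k z)" "- y"] by simp
  have "(\<integral>\<^sup>+z. ennreal (energy_density s \<phi> \<phi> z) \<partial>lborel)
      \<le> (\<integral>\<^sup>+z. ennreal C * (indicator B (fst z) * ennreal (k (fst z - snd z)))
          + ennreal C * (indicator B (snd z) * ennreal (k (fst z - snd z))) \<partial>lborel)"
  proof (rule nn_integral_mono)
    fix z :: "'a \<times> 'a"
    have "ennreal (energy_density s \<phi> \<phi> z)
        \<le> ennreal (C * (indicator B (fst z) * k (fst z - snd z)) + C * (indicator B (snd z) * k (fst z - snd z)))"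
      using pointwise[of "fst z" "snd z"] by (simp add: ennreal_leI)
    also have "\<dots> = ennreal C * (indicator B (fst z) * ennreal (k (fst z - snd z)))
          + ennreal C * (indicator B (snd z) * ennreal (k (fst z - snd z)))"
      using C k_nonneg by (simp add: ennreal_mult indicator_def)
    finally show "ennreal (energy_density s \<phi> \<phi> z) \<le> \<dots>" .
  qed
  also have "\<dots> = ennreal C * (\<integral>\<^sup>+z. indicator B (fst z) * ennreal (k (fst z - snd z)) \<partial>lborel)
      + ennreal C * (\<integral>\<^sup>+z. indicator B (snd z) * ennreal (k (fst z - snd z)) \<partial>lborel)"
    by (subst nn_integral_add) (auto simp: nn_integral_cmult)
  also have "(\<integral>\<^sup>+z. indicator B (fst z) * ennreal (k (fst z - snd z)) \<partial>lborel)
      = (\<integral>\<^sup>+x. \<integral>\<^sup>+y. indicator B x * ennreal (k (x - y)) \<partial>lborel \<partial>lborel)"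
    by (subst lborel_prod[symmetric], subst lborel.nn_integral_fst[symmetric]) auto
  also have "\<dots> = emeasure lborel B * (\<integral>\<^sup>+z. ennreal (k z) \<partial>lborel)"
    by (simp add: nn_integral_cmult nn_integral_multc shift1)
  also have "(\<integral>\<^sup>+z. indicator B (snd z) * ennreal (k (fst z - snd z)) \<partial>lborel)
      = (\<integral>\<^sup>+y. \<integral>\<^sup>+x. indicator B y * ennreal (k (x - y)) \<partial>lborel \<partial>lborel)"
    by (subst lborel_prod[symmetric], subst lborel_pair.nn_integral_snd[symmetric]) auto
  also have "\<dots> = emeasure lborel B * (\<integral>\<^sup>+z. ennreal (k z) \<partial>lborel)"
    by (simp add: nn_integral_cmult nn_integral_multc shift2)
  also have "ennreal C * (emeasure lborel B * (\<integral>\<^sup>+z. ennreal (k z) \<partial>lborel))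
      + ennreal C * (emeasure lborel B * (\<integral>\<^sup>+z. ennreal (k z) \<partial>lborel)) < \<infinity>"
    using ball_fin k_fin by (simp add: ennreal_mult_less_top)
  finally show "integrable lborel (energy_density s \<phi> \<phi>)"
    by (intro integrableI_nonneg) (auto simp: energy_density_def)
qed

section \<open>Finite energy of functions in the energy space\<close>

lemma continuous_compact_support_bounded:
  fixes g :: "'a::euclidean_space \<Rightarrow> real"
  assumes "continuous_on UNIV g" "\<And>x. x \<notin> S \<Longrightarrow> g x = 0" "compact S"
  obtains M where "M \<ge> 0" "\<And>x. \<bar>g x\<bar> \<le> M"
proof -
  have "compact (g ` S)"
    by (rule compact_continuous_image[OF continuous_on_subset[OF assms(1)] assms(3)]) simp
  then obtain M where M: "\<And>y. y \<in> g ` S \<Longrightarrow> norm y \<le> M"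
    using compact_imp_bounded bounded_iff by metis
  show ?thesis
  proof (rule that[of "\<bar>M\<bar>"])
    show "\<bar>g x\<bar> \<le> \<bar>M\<bar>" for x
      using M[of "g x"] assms(2)[of x] by (cases "x \<in> S") auto
  qed simp
qed

lemma test_function_finite_energy:
  fixes \<phi> :: "'a::euclidean_space \<Rightarrow> real"
  assumes s: "0 < s" "s < 1" and \<phi>: "\<phi> \<in> test_functions U"
  shows "finite_energy s \<phi>"
proof -
  define S where "S = closure {x. \<phi> x \<noteq> 0}"
  have S: "compact S" and smooth: "\<And>k. C_k k \<phi>" using \<phi> by (auto simp: test_functions_def S_def)
  have zero: "\<phi> x = 0" if "x \<notin> S" for x using that closure_subset[of "{x. \<phi> x \<noteq> 0}"] unfolding S_def by blast
  obtain M where M: "\<And>x. \<bar>\<phi> x\<bar> \<le> M"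
    using continuous_compact_support_bounded[OF C_k_continuous[OF smooth] zero S] by blast
  obtain \<phi>' where \<phi>': "\<And>x. (\<phi> has_derivative \<phi>' x) (at x)"
    "\<And>b. b \<in> Basis \<Longrightarrow> C_k 0 (\<lambda>x. \<phi>' x b)"
    using smooth[of "Suc 0"] by (rule C_k_SucE) blast
  have \<phi>'_zero: "\<phi>' x h = 0" if "x \<notin> S" for x h
  proof -
    have "(\<phi> has_derivative (\<lambda>h. 0)) (at x)"
    proof (rule has_derivative_transform_within_open[where s="- S"])
      show "((\<lambda>x. 0::real) has_derivative (\<lambda>h. 0)) (at x)" by simp
    qed (use that zero S in \<open>auto simp: compact_imp_closed open_Compl\<close>)
    then have "\<phi>' x = (\<lambda>h. 0)" by (rule has_derivative_unique[OF \<phi>'(1)])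
    then show ?thesis by simp
  qed
  have "\<forall>b\<in>Basis. \<exists>m\<ge>0. \<forall>x. \<bar>\<phi>' x b\<bar> \<le> m"
  proof
    fix b :: 'a assume b: "b \<in> Basis"
    have "continuous_on UNIV (\<lambda>x. \<phi>' x b)" using \<phi>'(2)[OF b] by simp
    then obtain m where "m \<ge> 0" "\<And>x. \<bar>\<phi>' x b\<bar> \<le> m"
      by (rule continuous_compact_support_bounded[OF _ \<phi>'_zero S]) auto
    then show "\<exists>m\<ge>0. \<forall>x. \<bar>\<phi>' x b\<bar> \<le> m" by blast
  qed
  then obtain m where "\<forall>b\<in>Basis. m b \<ge> 0 \<and> (\<forall>x. \<bar>\<phi>' x b\<bar> \<le> m b)"
    by (rule bchoice[THEN exE])
  then have m: "\<And>b. b \<in> Basis \<Longrightarrow> m b \<ge> 0" "\<And>b x. b \<in> Basis \<Longrightarrow> \<bar>\<phi>' x b\<bar> \<le> m b"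
    by auto
  define L where "L = (\<Sum>b\<in>Basis. m b)"
  have "onorm (\<phi>' x) \<le> L" for x
  proof (rule onorm_bound)
    show "L \<ge> 0" unfolding L_def by (rule sum_nonneg) (rule m)
    fix h
    have lin: "linear (\<phi>' x)" using \<phi>'(1) has_derivative_linear by blast
    have "\<phi>' x h = \<phi>' x (\<Sum>b\<in>Basis. (h \<bullet> b) *\<^sub>R b)" by (simp add: euclidean_representation)
    also have "\<dots> = (\<Sum>b\<in>Basis. (h \<bullet> b) * \<phi>' x b)"
      unfolding linear_sum[OF lin] linear_cmul[OF lin] by simp
    also have "norm \<dots> \<le> (\<Sum>b\<in>Basis. norm h * m b)"
    proof (rule sum_norm_le)
      fix b :: 'a assume b: "b \<in> Basis"
      have "\<bar>h \<bullet> b\<bar> * \<bar>\<phi>' x b\<bar> \<le> norm h * m b"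
        by (rule mult_mono) (use b m Basis_le_norm in auto)
      then show "norm ((h \<bullet> b) * \<phi>' x b) \<le> norm h * m b" by (simp add: abs_mult)
    qed
    finally show "norm (\<phi>' x h) \<le> L * norm h"
      by (simp add: L_def sum_distrib_left mult.commute)
  qed
  then have lip: "\<bar>\<phi> x - \<phi> y\<bar> \<le> L * norm (x - y)" for x y
    using differentiable_bound[of UNIV \<phi> \<phi>' L x y] \<phi>'(1) by (simp add: has_derivative_at_withinI)
  show ?thesis
    by (rule finite_energy_lipschitz[OF s lip M zero compact_imp_bounded[OF S]])
qed

lemma AE_lborel_pair:
  assumes "AE x in lborel. P (x :: 'a::euclidean_space)"
  shows "AE z in lborel. P (fst z) \<and> P (snd z)"
proof -
  obtain N where N: "N \<in> null_sets lborel" "{x. \<not> P x} \<subseteq> N"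
    using assms by (auto simp: eventually_ae_filter)
  then have "N \<in> sets borel" and [simp]: "emeasure lborel N = 0" by auto
  have "N \<times> UNIV \<in> null_sets (lborel \<Otimes>\<^sub>M lborel)" "UNIV \<times> N \<in> null_sets (lborel \<Otimes>\<^sub>M lborel)"
    using \<open>N \<in> sets borel\<close> by (auto simp: null_sets_def lborel.emeasure_pair_measure_Times)
  then have "(N \<times> UNIV) \<union> (UNIV \<times> N) \<in> null_sets lborel"
    unfolding lborel_prod by (rule null_sets.Un)
  moreover have "{z \<in> space lborel. \<not> (P (fst z) \<and> P (snd z))} \<subseteq> (N \<times> UNIV) \<union> (UNIV \<times> N)"
    using N(2) by auto
  ultimately show ?thesis by (rule AE_I')
qed

lemma energy_density_diff_le:
  "energy_density s w w z \<le> 2 * energy_density s u u z + 2 * energy_density s (\<lambda>x. u x - w x) (\<lambda>x. u x - w x) z"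
proof -
  define a b where "a = u (fst z) - u (snd z)" and "b = w (fst z) - w (snd z)"
  have "0 \<le> (2 * a - b)\<^sup>2" by simp
  then have "b * b \<le> 2 * (a * a) + 2 * ((a - b) * (a - b))"
    by (simp add: power2_eq_square algebra_simps)
  then have "b * b * frac_kernel s z \<le> (2 * (a * a) + 2 * ((a - b) * (a - b))) * frac_kernel s z"
    by (rule mult_right_mono) simp
  moreover have "energy_density s w w z = b * b * frac_kernel s z"
    "energy_density s u u z = a * a * frac_kernel s z"
    "energy_density s (\<lambda>x. u x - w x) (\<lambda>x. u x - w x) z = (a - b) * (a - b) * frac_kernel s z"
    by (simp_all add: energy_density_def a_def b_def algebra_simps)
  ultimately show ?thesis by (simp only: distrib_right mult.assoc)
qed

lemma energy_density_nonneg: "energy_density s u u z \<ge> 0"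
  by (simp add: energy_density_def)

text \<open>
  The energies of an energy-Cauchy sequence are bounded, and Fatou's lemma passes the bound to the
  almost everywhere limit.
\<close>

lemma D_space_finite_energy:
  fixes u :: "'a::euclidean_space \<Rightarrow> real"
  assumes s: "0 < s" "s < 1" and c: "0 < c" and u: "u \<in> D_space c s"
  shows "finite_energy s u"
proof -
  obtain \<phi> where \<phi>: "\<And>n. \<phi> n \<in> test_functions UNIV"
    and Cauchy: "\<And>e. e > 0 \<Longrightarrow> \<exists>M. \<forall>m\<ge>M. \<forall>n\<ge>M. energy_norm c s (\<lambda>x. \<phi> m x - \<phi> n x) < e"
    and lim: "AE x in lborel. (\<lambda>n. \<phi> n x) \<longlonglongrightarrow> u x"
    using u unfolding D_space_def by blast
  have [measurable]: "u \<in> borel_measurable borel" using u by (simp add: D_space_def)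
  have fin: "finite_energy s (\<phi> n)" for n by (rule test_function_finite_energy[OF s \<phi>])
  have [measurable]: "\<phi> n \<in> borel_measurable borel" for n using fin finite_energy_measurable by blast
  obtain M where M: "\<And>n. n \<ge> M \<Longrightarrow> energy_norm c s (\<lambda>x. \<phi> M x - \<phi> n x) < 1"
    using Cauchy[of 1] by fastforce
  have fin_diff: "finite_energy s (\<lambda>x. \<phi> M x - \<phi> n x)" for n
    by (rule finite_energy_dominated[OF _ fin[of M] fin[of n], where C=1 and D=1]) auto
  define A where "A = 2 * (\<integral>z. energy_density s (\<phi> M) (\<phi> M) z \<partial>lborel) + 2 * (2 / c)"
  have bound: "(\<integral>z. energy_density s (\<phi> n) (\<phi> n) z \<partial>lborel) \<le> A" if "n \<ge> M" for n
  proof -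
    have "c / 2 * (\<integral>z. energy_density s (\<lambda>x. \<phi> M x - \<phi> n x) (\<lambda>x. \<phi> M x - \<phi> n x) z \<partial>lborel) \<le> 1"
      using M[OF that] unfolding energy_norm_def energy_eq by simp
    then have "(\<integral>z. energy_density s (\<lambda>x. \<phi> M x - \<phi> n x) (\<lambda>x. \<phi> M x - \<phi> n x) z \<partial>lborel) \<le> 2 / c"
      using c by (simp add: field_simps)
    moreover have "(\<integral>z. energy_density s (\<phi> n) (\<phi> n) z \<partial>lborel)
      \<le> (\<integral>z. 2 * energy_density s (\<phi> M) (\<phi> M) z
          + 2 * energy_density s (\<lambda>x. \<phi> M x - \<phi> n x) (\<lambda>x. \<phi> M x - \<phi> n x) z \<partial>lborel)"
      by (rule integral_mono)
        (use fin fin_diff in \<open>auto simp: finite_energy_def intro: energy_density_diff_le\<close>)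
    ultimately show ?thesis
      using fin[of M] fin_diff[of n] by (simp add: A_def finite_energy_def)
  qed
  have nn_bound: "(\<integral>\<^sup>+z. ennreal (energy_density s (\<phi> n) (\<phi> n) z) \<partial>lborel) \<le> ennreal A" if "n \<ge> M" for n
    using fin[of n] bound[OF that]
    by (subst nn_integral_eq_integral) (auto simp: finite_energy_def energy_density_nonneg ennreal_leI)
  have "AE z in lborel. (\<lambda>n. ennreal (energy_density s (\<phi> n) (\<phi> n) z)) \<longlonglongrightarrow> ennreal (energy_density s u u z)"
    using AE_lborel_pair[OF lim]
  proof eventually_elim
    case (elim z)
    then show ?case unfolding energy_density_def by (auto intro!: tendsto_intros)
  qed
  then have "AE z in lborel. ennreal (energy_density s u u z) = liminf (\<lambda>n. ennreal (energy_density s (\<phi> n) (\<phi> n) z))"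
    by eventually_elim (simp add: lim_imp_Liminf)
  then have "(\<integral>\<^sup>+z. ennreal (energy_density s u u z) \<partial>lborel)
      = (\<integral>\<^sup>+z. liminf (\<lambda>n. ennreal (energy_density s (\<phi> n) (\<phi> n) z)) \<partial>lborel)"
    by (rule nn_integral_cong_AE)
  also have "\<dots> \<le> liminf (\<lambda>n. \<integral>\<^sup>+z. ennreal (energy_density s (\<phi> n) (\<phi> n) z) \<partial>lborel)"
    by (rule nn_integral_liminf) simp
  also have "\<dots> \<le> ennreal A"
    by (rule Liminf_le) (use nn_bound in \<open>auto simp: eventually_sequentially\<close>)
  also have "\<dots> < \<infinity>" by simp
  finally have "integrable lborel (energy_density s u u)"
    by (intro integrableI_nonneg) (auto simp: energy_density_nonneg)
  then show ?thesis by (simp add: finite_energy_def)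
qed

section \<open>Mollification and non-smooth test functions\<close>

text \<open>
  Jensen's inequality for the probability density \<open>\<eta>\<close>: the squared increment of an average is at most
  the average of the squared increments. The kernel depends only on the difference of the variables
  and can be translated along.
\<close>

lemma energy_density_average_le:
  fixes v \<eta> :: "'a::euclidean_space \<Rightarrow> real"
  assumes \<eta>: "\<And>x. \<eta> x \<ge> 0" "integrable lborel \<eta>" "integral\<^sup>L lborel \<eta> = 1"
    and v[measurable]: "v \<in> borel_measurable borel" and M: "\<And>x. \<bar>v x\<bar> \<le> M"
  shows "ennreal (energy_density s (\<lambda>x. \<integral>h. \<eta> h * v (x - h) \<partial>lborel) (\<lambda>x. \<integral>h. \<eta> h * v (x - h) \<partial>lborel) z)
    \<le> (\<integral>\<^sup>+h. ennreal (\<eta> h) * ennreal (energy_density s v v ((- h, - h) + z)) \<partial>lborel)"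
proof -
  have [measurable]: "\<eta> \<in> borel_measurable borel" using \<eta>(2) by auto
  define d where "d h = v (fst z - h) - v (snd z - h)" for h
  have [measurable]: "d \<in> borel_measurable borel" unfolding d_def by measurable
  have d_le: "\<bar>d h\<bar> \<le> 2 * M" for h
    using M[of "fst z - h"] M[of "snd z - h"] by (simp add: d_def)
  have bdd: "integrable lborel (\<lambda>h. \<eta> h * g h)" if "g \<in> borel_measurable borel" "\<And>h. \<bar>g h\<bar> \<le> B" for g B
  proof (rule Bochner_Integration.integrable_bound)
    show "integrable lborel (\<lambda>h. B * \<eta> h)" using \<eta>(2) by simp
    show "(\<lambda>h. \<eta> h * g h) \<in> borel_measurable lborel" using that(1) by simp
    have "\<bar>\<eta> h * g h\<bar> \<le> B * \<eta> h" for h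
      using mult_left_mono[OF that(2)[of h] \<eta>(1)[of h]] \<eta>(1)[of h] by (simp add: abs_mult mult.commute)
    then have "\<bar>\<eta> h * g h\<bar> \<le> \<bar>B * \<eta> h\<bar>" for h by (meson abs_ge_self order_trans)
    then show "AE h in lborel. norm (\<eta> h * g h) \<le> norm (B * \<eta> h)" by simp
  qed
  define m where "m = (\<integral>h. \<eta> h * d h \<partial>lborel)"
  have int_d: "integrable lborel (\<lambda>h. \<eta> h * d h)" by (rule bdd[OF _ d_le]) simp
  have int_d2: "integrable lborel (\<lambda>h. \<eta> h * (d h)\<^sup>2)"
    by (rule bdd[where B="(2 * M)\<^sup>2"]) (use power_mono[OF d_le, where n=2] in auto)
  \<comment> \<open>the variance of \<open>d\<close> under the density \<open>\<eta>\<close> is nonnegative\<close>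
  have "0 \<le> (\<integral>h. \<eta> h * (d h - m)\<^sup>2 \<partial>lborel)"
    using \<eta> by (intro integral_nonneg_AE) auto
  also have "\<dots> = (\<integral>h. \<eta> h * (d h)\<^sup>2 + (m\<^sup>2 * \<eta> h - 2 * m * (\<eta> h * d h)) \<partial>lborel)"
    by (intro Bochner_Integration.integral_cong) (auto simp: power2_eq_square algebra_simps)
  also have "\<dots> = (\<integral>h. \<eta> h * (d h)\<^sup>2 \<partial>lborel) + (m\<^sup>2 * 1 - 2 * m * m)"
    using int_d int_d2 \<eta> by (simp add: m_def)
  finally have jensen: "m\<^sup>2 \<le> (\<integral>h. \<eta> h * (d h)\<^sup>2 \<partial>lborel)" by (simp add: power2_eq_square)
  have int_v: "integrable lborel (\<lambda>h. \<eta> h * v (x - h))" for x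
    by (rule bdd[where B=M]) (use M in auto)
  have "(\<integral>h. \<eta> h * v (fst z - h) \<partial>lborel) - (\<integral>h. \<eta> h * v (snd z - h) \<partial>lborel) = m"
    unfolding m_def d_def by (subst Bochner_Integration.integral_diff[symmetric])
      (auto intro!: int_v simp: algebra_simps)
  then have "energy_density s (\<lambda>x. \<integral>h. \<eta> h * v (x - h) \<partial>lborel) (\<lambda>x. \<integral>h. \<eta> h * v (x - h) \<partial>lborel) z
      = m\<^sup>2 * frac_kernel s z"
    by (simp add: energy_density_def power2_eq_square)
  also have "\<dots> \<le> (\<integral>h. \<eta> h * (d h)\<^sup>2 \<partial>lborel) * frac_kernel s z"
    by (intro mult_right_mono jensen) simp
  also have "\<dots> = (\<integral>h. \<eta> h * energy_density s v v ((- h, - h) + z) \<partial>lborel)"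
    by (subst integral_mult_left_zero[symmetric])
      (simp add: energy_density_def d_def frac_kernel_def power2_eq_square mult_ac)
  also have "ennreal \<dots> = (\<integral>\<^sup>+h. ennreal (\<eta> h * energy_density s v v ((- h, - h) + z)) \<partial>lborel)"
  proof (rule nn_integral_eq_integral[symmetric])
    have "(\<lambda>h. \<eta> h * energy_density s v v ((- h, - h) + z)) = (\<lambda>h. \<eta> h * (d h)\<^sup>2 * frac_kernel s z)"
      by (auto simp: energy_density_def d_def frac_kernel_def power2_eq_square mult_ac)
    then show "integrable lborel (\<lambda>h. \<eta> h * energy_density s v v ((- h, - h) + z))"
      using int_d2 by simp
  qed (use \<eta> in \<open>auto simp: energy_density_nonneg\<close>)
  finally show ?thesis using \<eta> by (simp add: ennreal_leI ennreal_mult energy_density_nonneg)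
qed

text \<open>
  Integrating the pointwise bound and exchanging the integrals: every translate of \<open>v\<close> has the energy
  of \<open>v\<close>, so averaging does not increase the energy.
\<close>

lemma energy_average_le:
  fixes v \<eta> :: "'a::euclidean_space \<Rightarrow> real"
  assumes \<eta>: "\<And>x. \<eta> x \<ge> 0" "integrable lborel \<eta>" "integral\<^sup>L lborel \<eta> = 1"
    and v: "finite_energy s v" and M: "\<And>x. \<bar>v x\<bar> \<le> M"
    and w: "w = (\<lambda>x. \<integral>h. \<eta> h * v (x - h) \<partial>lborel)" and w_meas[measurable]: "w \<in> borel_measurable borel"
  shows "finite_energy s w"
    and "(\<integral>z. energy_density s w w z \<partial>lborel) \<le> (\<integral>z. energy_density s v v z \<partial>lborel)"
proof -
  have [measurable]: "v \<in> borel_measurable borel" "\<eta> \<in> borel_measurable borel"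
    using finite_energy_measurable[OF v] \<eta>(2) by auto
  define E where "E = (\<integral>\<^sup>+z. ennreal (energy_density s v v z) \<partial>lborel)"
  have "(\<integral>\<^sup>+z. ennreal (energy_density s w w z) \<partial>lborel)
      \<le> (\<integral>\<^sup>+z. \<integral>\<^sup>+h. ennreal (\<eta> h) * ennreal (energy_density s v v ((- h, - h) + z)) \<partial>lborel \<partial>lborel)"
    unfolding w by (intro nn_integral_mono energy_density_average_le[OF \<eta> _ M]) simp
  also have "\<dots> = (\<integral>\<^sup>+h. \<integral>\<^sup>+z. ennreal (\<eta> h) * ennreal (energy_density s v v ((- h, - h) + z)) \<partial>lborel \<partial>lborel)"
    by (rule lborel_pair.Fubini') (unfold energy_density_def frac_kernel_def, measurable)
  also have "\<dots> = (\<integral>\<^sup>+h. ennreal (\<eta> h) * E \<partial>lborel)"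
    unfolding E_def
    by (subst nn_integral_cmult) (auto simp: nn_integral_lborel_translate[of "\<lambda>z. ennreal (energy_density s v v z)"])
  also have "\<dots> = (\<integral>\<^sup>+h. ennreal (\<eta> h) \<partial>lborel) * E"
    by (rule nn_integral_multc) simp
  also have "(\<integral>\<^sup>+h. ennreal (\<eta> h) \<partial>lborel) = 1"
    using \<eta> by (subst nn_integral_eq_integral) auto
  finally have le: "(\<integral>\<^sup>+z. ennreal (energy_density s w w z) \<partial>lborel) \<le> E" by simp
  have E: "E = ennreal (\<integral>z. energy_density s v v z \<partial>lborel)"
    unfolding E_def using v by (intro nn_integral_eq_integral) (auto simp: finite_energy_def energy_density_nonneg)
  have int: "integrable lborel (energy_density s w w)"
    using le_less_trans[OF le, of \<infinity>] E by (intro integrableI_nonneg) (auto simp: energy_density_nonneg)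
  then show "finite_energy s w" by (simp add: finite_energy_def)
  have "ennreal (\<integral>z. energy_density s w w z \<partial>lborel) \<le> ennreal (\<integral>z. energy_density s v v z \<partial>lborel)"
    using le unfolding E by (subst nn_integral_eq_integral[symmetric]) (auto simp: int energy_density_nonneg)
  then show "(\<integral>z. energy_density s w w z \<partial>lborel) \<le> (\<integral>z. energy_density s v v z \<partial>lborel)"
    by (subst (asm) ennreal_le_iff) (auto intro!: integral_nonneg_AE simp: energy_density_nonneg)
qed

text \<open>
  The mollifications of \<open>v\<close> are test functions in \<open>U\<close> once the mollification radius is below the distance
  from the support of \<open>v\<close> to the complement of \<open>U\<close>. Their energies are at most that of \<open>v\<close> and they
  converge pointwise to \<open>v\<close>, so the energy pairing with \<open>u\<close> converges as a weak \<open>L\<^sup>2\<close> limit.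
\<close>

lemma weak_solution_continuous_test:
  fixes u v g :: "'a::euclidean_space \<Rightarrow> real"
  assumes s: "0 < s" "s < 1" and c: "0 < c"
    and sol: "weak_solution c s U g u" and U: "open U" and g: "continuous_on UNIV g"
    and v: "continuous_on UNIV v" "\<And>x. x \<notin> S \<Longrightarrow> v x = 0" and S: "compact S" "S \<subseteq> U"
    and fin: "finite_energy s v"
  shows "c / 2 * (\<integral>z. energy_density s u v z \<partial>lborel) = (\<integral>x. g x * v x \<partial>lborel)"
proof -
  have u_fin: "finite_energy s u"
    by (rule D_space_finite_energy[OF s c]) (use sol in \<open>simp add: weak_solution_def\<close>)
  have [measurable]: "u \<in> borel_measurable borel" "v \<in> borel_measurable borel" "g \<in> borel_measurable borel"
    using finite_energy_measurable[OF u_fin] finite_energy_measurable[OF fin] borel_measurable_continuous_onI[OF g]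
    by auto
  obtain M where M: "M \<ge> 0" "\<And>x. \<bar>v x\<bar> \<le> M"
    using continuous_compact_support_bounded[OF v S(1)] by blast
  obtain d where d: "d > 0" "(\<Union>x\<in>S. cball x d) \<subseteq> U"
    by (rule compact_subset_open_imp_cball_epsilon_subset[OF S(1) U S(2)])
  define S' where "S' = {x + y |x y. x \<in> S \<and> y \<in> cball (0::'a) d}"
  have S': "compact S'" unfolding S'_def by (rule compact_sums[OF S(1) compact_cball])
  have "S' \<subseteq> U"
  proof
    fix z assume "z \<in> S'"
    then obtain x y where "z = x + y" "x \<in> S" "norm y \<le> d" by (auto simp: S'_def)
    then have "z \<in> cball x d" by (simp add: dist_norm)
    then show "z \<in> U" using \<open>x \<in> S\<close> d(2) by blast
  qed
  define \<delta> where "\<delta> n = d / real (Suc n)" for n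
  have \<delta>: "\<delta> n > 0" "\<delta> n \<le> d" for n using d(1) by (auto simp: \<delta>_def field_simps)
  have "\<exists>\<eta> :: 'a \<Rightarrow> real. (\<forall>k. C_k k \<eta>) \<and> (\<forall>x. \<eta> x \<ge> 0) \<and> (\<forall>x. norm x \<ge> \<delta> n \<longrightarrow> \<eta> x = 0)
      \<and> integrable lborel \<eta> \<and> integral\<^sup>L lborel \<eta> = 1" for n
    using mollifier_exists[OF \<delta>(1)[of n]] by metis
  then obtain \<eta> :: "nat \<Rightarrow> 'a \<Rightarrow> real" where \<eta>: "\<And>n k. C_k k (\<eta> n)" "\<And>n x. \<eta> n x \<ge> 0"
    "\<And>n x. norm x \<ge> \<delta> n \<Longrightarrow> \<eta> n x = 0" "\<And>n. integrable lborel (\<eta> n)" "\<And>n. integral\<^sup>L lborel (\<eta> n) = 1"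
    by metis
  have [measurable]: "\<eta> n \<in> borel_measurable borel" for n using \<eta>(4)[of n] by auto
  define \<phi> where "\<phi> n = (\<lambda>x. \<integral>h. \<eta> n h * v (x - h) \<partial>lborel)" for n
  have int_v: "integrable lborel (\<lambda>h. \<eta> n h * v (x - h))" for n x
  proof (rule Bochner_Integration.integrable_bound)
    show "integrable lborel (\<lambda>h. M * \<eta> n h)" using \<eta>(4) by simp
    have "\<bar>\<eta> n h * v (x - h)\<bar> \<le> \<bar>M * \<eta> n h\<bar>" for h
      using mult_left_mono[OF M(2)[of "x - h"] \<eta>(2)[of n h]] M(1) \<eta>(2)[of n h]
      by (simp add: abs_mult mult.commute)
    then show "AE h in lborel. norm (\<eta> n h * v (x - h)) \<le> norm (M * \<eta> n h)" by simp
  qed simp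
  obtain l r where lr: "S \<subseteq> cbox l r"
    using bounded_subset_cbox_symmetric[OF compact_imp_bounded[OF S(1)]] by metis
  have \<phi>_eq: "\<phi> n = (\<lambda>x. integral (cbox l r) (\<lambda>y. v y * \<eta> n (x - y)))" for n
  proof
    fix x
    have "\<phi> n x = (\<integral>y. \<eta> n (x - y) * v y \<partial>lborel)"
      unfolding \<phi>_def
      using integral_lborel_isometry[of uminus "\<lambda>y. x - y" x "\<lambda>h. \<eta> n h * v (x - h)"]
      by (simp add: linear_uminus)
    also have "\<dots> = (\<integral>y. indicator (cbox l r) y *\<^sub>R (v y * \<eta> n (x - y)) \<partial>lborel)"
      using v(2) lr by (intro Bochner_Integration.integral_cong) (auto simp: indicator_def)
    also have "\<dots> = integral (cbox l r) (\<lambda>y. v y * \<eta> n (x - y))"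
    proof -
      have "continuous_on (cbox l r) (\<lambda>y. v y * \<eta> n (x - y))"
        by (intro continuous_on_mult continuous_on_subset[OF v(1)]
            continuous_on_compose2[OF C_k_continuous[OF \<eta>(1)[of 0 n]]] continuous_intros) auto
      then have "set_integrable lborel (cbox l r) (\<lambda>y. v y * \<eta> n (x - y))"
        unfolding set_integrable_def by (intro borel_integrable_compact) auto
      from set_borel_integral_eq_integral(2)[OF this] show ?thesis
        by (simp add: set_lebesgue_integral_def)
    qed
    finally show "\<phi> n x = integral (cbox l r) (\<lambda>y. v y * \<eta> n (x - y))" .
  qed
  have \<phi>_smooth: "C_k k (\<phi> n)" for k n
    unfolding \<phi>_eq by (rule C_k_convolution[OF v(1) \<eta>(1)])
  have \<phi>_zero: "\<phi> n x = 0" if "x \<notin> S'" for n x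
  proof -
    have 0: "\<eta> n h * v (x - h) = 0" for h
    proof (cases "norm h \<ge> \<delta> n")
      case False
      then have "h \<in> cball 0 d" using \<delta>[of n] by simp
      then have "x - h \<notin> S" using that unfolding S'_def by (metis (mono_tags, lifting) diff_add_cancel mem_Collect_eq)
      then show ?thesis using v(2) by simp
    qed (use \<eta>(3) in simp)
    show ?thesis unfolding \<phi>_def 0 by simp
  qed
  have \<phi>_test: "\<phi> n \<in> test_functions U" for n
  proof -
    have "closure {x. \<phi> n x \<noteq> 0} \<subseteq> S'"
      using \<phi>_zero by (intro closure_minimal compact_imp_closed S') auto
    moreover from this have "compact (closure {x. \<phi> n x \<noteq> 0})"
      using S' bounded_subset compact_eq_bounded_closed by blast
    ultimately show ?thesis
      using \<phi>_smooth \<open>S' \<subseteq> U\<close> unfolding test_functions_def by blast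
  qed
  have [measurable]: "\<phi> n \<in> borel_measurable borel" for n
    by (rule borel_measurable_continuous_onI) (rule C_k_continuous[OF \<phi>_smooth])
  note avg = energy_average_le[OF \<eta>(2,4,5) fin M(2) \<phi>_def]
  have \<phi>_bdd: "\<bar>\<phi> n x\<bar> \<le> M" for n x
  proof -
    have "\<bar>\<phi> n x\<bar> \<le> (\<integral>h. \<bar>\<eta> n h * v (x - h)\<bar> \<partial>lborel)" unfolding \<phi>_def by (rule integral_abs_bound)
    also have "\<dots> \<le> (\<integral>h. M * \<eta> n h \<partial>lborel)"
    proof (rule integral_mono)
      show "\<bar>\<eta> n h * v (x - h)\<bar> \<le> M * \<eta> n h" for h
        using mult_left_mono[OF M(2)[of "x - h"] \<eta>(2)[of n h]] \<eta>(2)[of n h]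
        by (simp add: abs_mult mult.commute)
    qed (use int_v \<eta> in auto)
    finally show ?thesis using \<eta>(5) by simp
  qed
  have \<phi>_lim: "(\<lambda>n. \<phi> n x) \<longlonglongrightarrow> v x" for x
  proof (rule LIMSEQ_I)
    fix e :: real assume e: "e > 0"
    have "isCont v x" using v(1) by (simp add: continuous_on_eq_continuous_at)
    then obtain t where t: "t > 0" "\<And>y. dist y x < t \<Longrightarrow> dist (v y) (v x) < e / 2"
      using e unfolding continuous_at_eps_delta by (metis half_gt_zero)
    obtain n0 where n0: "\<delta> n0 < t"
    proof -
      obtain n0 where "d / t < real n0" using reals_Archimedean2 by blast
      then have "\<delta> n0 < t" using t(1) by (simp add: \<delta>_def field_simps)
      then show ?thesis by (rule that)
    qed
    have "norm (\<phi> n x - v x) < e" if "n \<ge> n0" for n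
    proof -
      have "\<delta> n \<le> \<delta> n0" using that d(1) unfolding \<delta>_def by (intro divide_left_mono) auto
      have "\<phi> n x - v x = (\<integral>h. \<eta> n h * v (x - h) \<partial>lborel) - (\<integral>h. \<eta> n h * v x \<partial>lborel)"
        using \<eta>(5)[of n] by (simp add: \<phi>_def)
      also have "\<dots> = (\<integral>h. \<eta> n h * (v (x - h) - v x) \<partial>lborel)"
        using int_v \<eta>(4) by (subst Bochner_Integration.integral_diff[symmetric]) (auto simp: right_diff_distrib)
      also have "\<bar>\<dots>\<bar> \<le> (\<integral>h. \<bar>\<eta> n h * (v (x - h) - v x)\<bar> \<partial>lborel)" by (rule integral_abs_bound)
      also have "\<dots> \<le> (\<integral>h. (e / 2) * \<eta> n h \<partial>lborel)"
      proof (rule integral_mono)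
        show "integrable lborel (\<lambda>h. \<bar>\<eta> n h * (v (x - h) - v x)\<bar>)"
          using int_v[of n x] \<eta>(4)[of n] by (simp add: right_diff_distrib)
        show "\<bar>\<eta> n h * (v (x - h) - v x)\<bar> \<le> (e / 2) * \<eta> n h" for h
        proof (cases "norm h \<ge> \<delta> n")
          case False
          then have "dist (x - h) x < t" using n0 \<open>\<delta> n \<le> \<delta> n0\<close> by (simp add: dist_norm)
          from t(2)[OF this] have "\<bar>v (x - h) - v x\<bar> \<le> e / 2" by (simp add: dist_real_def)
          from mult_left_mono[OF this \<eta>(2)[of n h]] \<eta>(2)[of n h] show ?thesis by (simp add: abs_mult mult.commute)
        qed (use \<eta>(3) in simp)
      qed (use \<eta> in auto)
      also have "\<dots> < e" using \<eta>(5)[of n] e by simp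
      finally show ?thesis by simp
    qed
    then show "\<exists>n0. \<forall>n\<ge>n0. norm (\<phi> n x - v x) < e" by blast
  qed
  have weak: "c / 2 * (\<integral>z. energy_density s u (\<phi> n) z \<partial>lborel) = (\<integral>x. g x * \<phi> n x \<partial>lborel)" for n
  proof -
    have "c / 2 * (\<integral>z. energy_density s u (\<phi> n) z \<partial>lborel) = set_lebesgue_integral lborel U (\<lambda>x. g x * \<phi> n x)"
      using sol \<phi>_test[of n] unfolding weak_solution_def energy_eq by blast
    also have "\<dots> = (\<integral>x. g x * \<phi> n x \<partial>lborel)"
      unfolding set_lebesgue_integral_def
    proof (rule Bochner_Integration.integral_cong[OF refl])
      fix x
      show "indicator U x *\<^sub>R (g x * \<phi> n x) = g x * \<phi> n x"
        using \<phi>_zero[of x n] \<open>S' \<subseteq> U\<close> by (cases "x \<in> U") (auto simp: indicator_def)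
    qed
    finally show ?thesis .
  qed
  have "(\<lambda>n. \<integral>z. energy_density s u (\<phi> n) z \<partial>lborel) \<longlonglongrightarrow> (\<integral>z. energy_density s u v z \<partial>lborel)"
    unfolding energy_density_square
  proof (rule weak_L2_limit)
    show "integrable lborel (\<lambda>z. ((u (fst z) - u (snd z)) * sqrt (frac_kernel s z))\<^sup>2)"
      "integrable lborel (\<lambda>z. ((v (fst z) - v (snd z)) * sqrt (frac_kernel s z))\<^sup>2)"
      "\<And>n. integrable lborel (\<lambda>z. ((\<phi> n (fst z) - \<phi> n (snd z)) * sqrt (frac_kernel s z))\<^sup>2)"
      using u_fin fin avg(1)
      by (auto simp: power2_eq_square finite_energy_def simp flip: energy_density_square)
    show "(\<integral>z. ((\<phi> n (fst z) - \<phi> n (snd z)) * sqrt (frac_kernel s z))\<^sup>2 \<partial>lborel)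
        \<le> (\<integral>z. energy_density s v v z \<partial>lborel)" for n
      using avg(2)[of n] by (simp add: power2_eq_square flip: energy_density_square)
    show "AE z in lborel. (\<lambda>n. (\<phi> n (fst z) - \<phi> n (snd z)) * sqrt (frac_kernel s z))
        \<longlonglongrightarrow> (v (fst z) - v (snd z)) * sqrt (frac_kernel s z)"
      by (intro AE_I2 tendsto_intros \<phi>_lim)
  qed measurable
  then have 1: "(\<lambda>n. c / 2 * (\<integral>z. energy_density s u (\<phi> n) z \<partial>lborel))
      \<longlonglongrightarrow> c / 2 * (\<integral>z. energy_density s u v z \<partial>lborel)"
    by (intro tendsto_intros)
  have 2: "(\<lambda>n. \<integral>x. g x * \<phi> n x \<partial>lborel) \<longlonglongrightarrow> (\<integral>x. g x * v x \<partial>lborel)"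
  proof (rule integral_dominated_convergence[where w="\<lambda>x. indicator S' x *\<^sub>R (\<bar>g x\<bar> * M)"])
    show "integrable lborel (\<lambda>x. indicator S' x *\<^sub>R (\<bar>g x\<bar> * M))"
      by (intro borel_integrable_compact S' continuous_intros continuous_on_subset[OF g]) auto
    show "AE x in lborel. norm (g x * \<phi> n x) \<le> indicator S' x *\<^sub>R (\<bar>g x\<bar> * M)" for n
    proof (rule AE_I2)
      fix x
      show "norm (g x * \<phi> n x) \<le> indicator S' x *\<^sub>R (\<bar>g x\<bar> * M)"
        using \<phi>_bdd[of n x] \<phi>_zero[of x n]
        by (cases "x \<in> S'") (auto simp: abs_mult intro: mult_left_mono)
    qed
    show "AE x in lborel. (\<lambda>n. g x * \<phi> n x) \<longlonglongrightarrow> g x * v x"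
      by (intro AE_I2 tendsto_intros \<phi>_lim)
  qed simp_all
  show ?thesis
    using LIMSEQ_unique[OF 1[unfolded weak] 2] .
qed

section \<open>Reflection across a hyperplane and the folded energy\<close>

locale hyperplane =
  fixes x0 e :: "'a::euclidean_space" and l :: real
  assumes norm_e: "norm e = 1"
begin

definition R :: "'a \<Rightarrow> 'a" where "R x = x + (2 * (l - (x - x0) \<bullet> e)) *\<^sub>R e"

definition H :: "'a set" where "H = {x. (x - x0) \<bullet> e > l}"

lemma inner_e [simp]: "e \<bullet> e = 1"
  using norm_e by (simp add: dot_square_norm)

lemma height_R: "(R x - x0) \<bullet> e = 2 * l - (x - x0) \<bullet> e"
  by (simp add: R_def inner_left_distrib inner_diff_left algebra_simps)

lemma R_R [simp]: "R (R x) = x"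
proof -
  have "R (R x) = R x + (2 * (l - (R x - x0) \<bullet> e)) *\<^sub>R e" by (simp add: R_def[of "R x"])
  also have "\<dots> = x + (2 * (l - (x - x0) \<bullet> e)) *\<^sub>R e + (2 * (l - (2 * l - (x - x0) \<bullet> e))) *\<^sub>R e"
    unfolding height_R by (simp add: R_def)
  also have "\<dots> = x" by (simp add: add.assoc flip: scaleR_left_distrib)
  finally show ?thesis .
qed

lemma open_H: "open H"
  unfolding H_def by (intro open_Collect_less continuous_intros)

lemma R_H: "x \<in> H \<Longrightarrow> R x \<notin> H"
  using height_R[of x] by (simp add: H_def)

lemma R_boundary: "(x - x0) \<bullet> e = l \<Longrightarrow> R x = x"
  by (simp add: R_def)

lemma continuous_R: "continuous_on A R"
  unfolding R_def by (intro continuous_intros)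

lemma R_affine: "R x = (2 * (l + x0 \<bullet> e)) *\<^sub>R e + (x - (2 * (x \<bullet> e)) *\<^sub>R e)"
  by (simp add: R_def inner_diff_left algebra_simps)

lemma linear_reflection: "linear (\<lambda>x. x - (2 * (x \<bullet> e)) *\<^sub>R e)"
  by (rule linearI) (simp_all add: inner_left_distrib algebra_simps)

lemma norm_reflection: "norm (x - (2 * (x \<bullet> e)) *\<^sub>R e) = norm x"
  unfolding norm_eq_sqrt_inner
  by (simp add: inner_diff_left inner_diff_right algebra_simps inner_commute)

lemma norm_R_diff: "norm (R x - R y) = norm (x - y)"
proof -
  have "R x - R y = (x - y) - (2 * ((x - y) \<bullet> e)) *\<^sub>R e"
    by (simp add: R_affine inner_diff_left algebra_simps)
  then show ?thesis using norm_reflection by simp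
qed

lemma norm_add_scaleR_e_sq: "(norm (h + t *\<^sub>R e))\<^sup>2 = (norm h)\<^sup>2 + 2 * t * (h \<bullet> e) + t\<^sup>2"
  unfolding power2_norm_eq_inner
  by (simp add: inner_left_distrib inner_right_distrib inner_commute[of e h] power2_eq_square algebra_simps)

lemma norm_diff_R_sq:
  "(norm (x - R y))\<^sup>2 = (norm (x - y))\<^sup>2 + 4 * ((x - x0) \<bullet> e - l) * ((y - x0) \<bullet> e - l)"
proof -
  define t where "t = (y - x0) \<bullet> e - l"
  have "(x - y) \<bullet> e = ((x - x0) \<bullet> e - l) - t" by (simp add: t_def inner_diff_left)
  moreover have eq: "x - R y = (x - y) + (2 * t) *\<^sub>R e" by (simp add: R_def t_def algebra_simps)
  have "(norm (x - R y))\<^sup>2 = (norm (x - y))\<^sup>2 + 4 * t * ((x - y) \<bullet> e) + 4 * t\<^sup>2"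
    unfolding eq norm_add_scaleR_e_sq by (simp add: power2_eq_square)
  ultimately show ?thesis by (simp add: t_def power2_eq_square algebra_simps)
qed

lemma norm_R_center_sq: "(norm (R x - x0))\<^sup>2 = (norm (x - x0))\<^sup>2 - 4 * l * ((x - x0) \<bullet> e - l)"
proof -
  define t where "t = (x - x0) \<bullet> e - l"
  have eq: "R x - x0 = (x - x0) + (- 2 * t) *\<^sub>R e" by (simp add: R_def t_def algebra_simps)
  have "(norm (R x - x0))\<^sup>2 = (norm (x - x0))\<^sup>2 - 4 * t * ((x - x0) \<bullet> e) + 4 * t\<^sup>2"
    unfolding eq norm_add_scaleR_e_sq by (simp add: power2_eq_square)
  then show ?thesis by (simp add: t_def power2_eq_square algebra_simps)
qed

lemma measurable_R [measurable]: "R \<in> borel_measurable borel"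
  by (rule borel_measurable_continuous_onI) (rule continuous_R)

lemma frac_kernel_R_R: "frac_kernel s (R x, R y) = frac_kernel s (x, y)"
  by (simp add: frac_kernel_def norm_R_diff)

lemma frac_kernel_R_left: "frac_kernel s (R x, y) = frac_kernel s (x, R y)"
  using frac_kernel_R_R[of s "R x" y] by simp

text \<open>
  On one side of the plane, reflecting one of two points does not decrease their distance. The case
  \<open>x = y\<close> is excluded because \<open>frac_kernel\<close> has the default value \<open>0\<close> on the diagonal.
\<close>

lemma frac_kernel_R_le:
  assumes "0 < s" "(x - x0) \<bullet> e \<ge> l" "(y - x0) \<bullet> e \<ge> l" "x \<noteq> y"
  shows "frac_kernel s (x, R y) \<le> frac_kernel s (x, y)"
proof -
  have "(norm (x - y))\<^sup>2 \<le> (norm (x - R y))\<^sup>2" using assms by (simp add: norm_diff_R_sq)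
  then have "norm (x - y) \<le> norm (x - R y)" by (rule power2_le_imp_le) simp
  moreover have "norm (x - y) > 0" using assms by simp
  moreover from calculation have "norm (x - R y) > 0" by linarith
  ultimately show ?thesis unfolding frac_kernel_def fst_conv snd_conv
    using assms by (intro divide_left_mono powr_mono2 mult_pos_pos) auto
qed

lemma frac_kernel_R_less:
  assumes "0 < s" "x \<in> H" "y \<in> H" "x \<noteq> y"
  shows "frac_kernel s (x, R y) < frac_kernel s (x, y)"
proof -
  have "0 < ((x - x0) \<bullet> e - l) * ((y - x0) \<bullet> e - l)" using assms by (simp add: H_def)
  then have "(norm (x - y))\<^sup>2 < (norm (x - R y))\<^sup>2" unfolding norm_diff_R_sq mult.assoc by simp
  then have "norm (x - y) < norm (x - R y)" by (rule power_less_imp_less_base) simp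
  moreover have "norm (x - y) > 0" using assms by simp
  moreover from calculation have "norm (x - R y) > 0" by linarith
  ultimately show ?thesis unfolding frac_kernel_def fst_conv snd_conv
    using assms by (intro divide_strict_left_mono powr_less_mono2 mult_pos_pos) (auto simp: add_pos_pos)
qed

text \<open>
  The energy density folded across the plane in its second variable. For odd functions the result
  is invariant under reflecting either variable, so its sign needs to be known only on one side of the
  plane.
\<close>

definition sym_density :: "real \<Rightarrow> ('a \<Rightarrow> real) \<Rightarrow> ('a \<Rightarrow> real) \<Rightarrow> 'a \<times> 'a \<Rightarrow> real" where
  "sym_density s u v z = energy_density s u v z + energy_density s u v (fst z, R (snd z))"

lemma linear_pair_reflection:
  "linear (\<lambda>z::'a \<times> 'a. (fst z, snd z - (2 * (snd z \<bullet> e)) *\<^sub>R e))"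
  "linear (\<lambda>z::'a \<times> 'a. (fst z - (2 * (fst z \<bullet> e)) *\<^sub>R e, snd z - (2 * (snd z \<bullet> e)) *\<^sub>R e))"
  by (rule linearI; simp add: inner_left_distrib algebra_simps)+

lemma integral_R: "g \<in> borel_measurable borel \<Longrightarrow> (\<integral>x. g (R x) \<partial>lborel) = (\<integral>x. g x \<partial>lborel :: real)"
  by (rule integral_lborel_isometry[OF linear_reflection norm_reflection R_affine])

lemma
  fixes g :: "'a \<times> 'a \<Rightarrow> real"
  assumes g: "g \<in> borel_measurable borel"
  shows integral_R_snd: "(\<integral>z. g (fst z, R (snd z)) \<partial>lborel) = (\<integral>z. g z \<partial>lborel)"
    and integrable_R_snd: "integrable lborel g \<Longrightarrow> integrable lborel (\<lambda>z. g (fst z, R (snd z)))"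
proof -
  let ?c = "(0, (2 * (l + x0 \<bullet> e)) *\<^sub>R e) :: 'a \<times> 'a"
  have 1: "norm (fst z, snd z - (2 * (snd z \<bullet> e)) *\<^sub>R e) = norm z" for z :: "'a \<times> 'a"
    by (cases z) (simp add: norm_Pair norm_reflection)
  have 2: "(fst z, R (snd z)) = ?c + (fst z, snd z - (2 * (snd z \<bullet> e)) *\<^sub>R e)" for z :: "'a \<times> 'a"
    by (simp add: R_affine)
  show "(\<integral>z. g (fst z, R (snd z)) \<partial>lborel) = (\<integral>z. g z \<partial>lborel)"
    by (rule integral_lborel_isometry[OF linear_pair_reflection(1) 1 2 g])
  show "integrable lborel g \<Longrightarrow> integrable lborel (\<lambda>z. g (fst z, R (snd z)))"
    by (rule integrable_lborel_isometry[OF linear_pair_reflection(1) 1 2 g])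
qed

lemma
  fixes g :: "'a \<times> 'a \<Rightarrow> real"
  assumes g: "g \<in> borel_measurable borel"
  shows integral_R_R: "(\<integral>z. g (R (fst z), R (snd z)) \<partial>lborel) = (\<integral>z. g z \<partial>lborel)"
    and integrable_R_R: "integrable lborel g \<Longrightarrow> integrable lborel (\<lambda>z. g (R (fst z), R (snd z)))"
proof -
  let ?c = "((2 * (l + x0 \<bullet> e)) *\<^sub>R e, (2 * (l + x0 \<bullet> e)) *\<^sub>R e) :: 'a \<times> 'a"
  have 1: "norm (fst z - (2 * (fst z \<bullet> e)) *\<^sub>R e, snd z - (2 * (snd z \<bullet> e)) *\<^sub>R e) = norm z" for z :: "'a \<times> 'a"
    by (cases z) (simp add: norm_Pair norm_reflection)
  have 2: "(R (fst z), R (snd z))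
      = ?c + (fst z - (2 * (fst z \<bullet> e)) *\<^sub>R e, snd z - (2 * (snd z \<bullet> e)) *\<^sub>R e)" for z :: "'a \<times> 'a"
    by (simp add: R_affine)
  show "(\<integral>z. g (R (fst z), R (snd z)) \<partial>lborel) = (\<integral>z. g z \<partial>lborel)"
    by (rule integral_lborel_isometry[OF linear_pair_reflection(2) 1 2 g])
  show "integrable lborel g \<Longrightarrow> integrable lborel (\<lambda>z. g (R (fst z), R (snd z)))"
    by (rule integrable_lborel_isometry[OF linear_pair_reflection(2) 1 2 g])
qed

lemma energy_density_R:
  "energy_density s (\<lambda>x. u (R x)) (\<lambda>x. v (R x)) z = energy_density s u v (R (fst z), R (snd z))"
  using frac_kernel_R_R[of s "fst z" "snd z"] by (simp add: energy_density_def)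

lemma finite_energy_R:
  assumes "finite_energy s u" shows "finite_energy s (\<lambda>x. u (R x))"
proof -
  have [measurable]: "u \<in> borel_measurable borel" using assms by (rule finite_energy_measurable)
  have "integrable lborel (energy_density s (\<lambda>x. u (R x)) (\<lambda>x. u (R x)))"
    unfolding energy_density_R
    by (rule integrable_R_R) (use assms in \<open>auto simp: finite_energy_def\<close>)
  then show ?thesis by (simp add: finite_energy_def)
qed

lemma finite_energy_diff:
  assumes "finite_energy s u" "finite_energy s v"
  shows "finite_energy s (\<lambda>x. u x - v x)"
proof (rule finite_energy_dominated[OF _ assms])
  show "(\<lambda>x. u x - v x) \<in> borel_measurable borel"
    using assms[THEN finite_energy_measurable] by (rule borel_measurable_diff)
  show "\<bar>u x - v x - (u y - v y)\<bar> \<le> 1 * \<bar>u x - u y\<bar> + 1 * \<bar>v x - v y\<bar>" for x y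
    using abs_triangle_ineq4[of "u x - u y" "v x - v y"] by (simp add: algebra_simps)
qed

lemma
  assumes "finite_energy s u" "finite_energy s v"
  shows sym_density_integrable: "integrable lborel (sym_density s u v)"
    and integral_sym_density: "(\<integral>z. sym_density s u v z \<partial>lborel) = 2 * (\<integral>z. energy_density s u v z \<partial>lborel)"
proof -
  have [measurable]: "u \<in> borel_measurable borel" "v \<in> borel_measurable borel"
    using assms by (auto dest: finite_energy_measurable)
  have 1: "integrable lborel (energy_density s u v)" by (rule energy_density_integrable[OF assms])
  have 2: "integrable lborel (\<lambda>z. energy_density s u v (fst z, R (snd z)))"
    by (rule integrable_R_snd[OF _ 1]) simp
  show "integrable lborel (sym_density s u v)" unfolding sym_density_def using 1 2 by simp
  show "(\<integral>z. sym_density s u v z \<partial>lborel) = 2 * (\<integral>z. energy_density s u v z \<partial>lborel)"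
    unfolding sym_density_def using 1 2 by (simp add: integral_R_snd)
qed

text \<open>
  The link between the folded energy and the equation for \<open>u\<close>: with \<open>\<phi> = v - v \<circ> R\<close>, folding doubles
  the integral, and by reflection invariance of the energy the pairings of \<open>u \<circ> R\<close> and of \<open>- u\<close> with
  the odd function \<open>\<phi>\<close> coincide.
\<close>

lemma integral_sym_density_odd_part:
  assumes u: "finite_energy s u" and v: "finite_energy s v"
  shows "(\<integral>z. sym_density s (\<lambda>x. u (R x) - u x) (\<lambda>x. v x - v (R x)) z \<partial>lborel)
    = - 4 * (\<integral>z. energy_density s u (\<lambda>x. v x - v (R x)) z \<partial>lborel)"
proof -
  let ?v = "\<lambda>x. v x - v (R x)"
  have [measurable]: "u \<in> borel_measurable borel" "v \<in> borel_measurable borel"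
    using assms by (auto dest: finite_energy_measurable)
  have v': "finite_energy s ?v" by (intro finite_energy_diff v finite_energy_R)
  have uR: "finite_energy s (\<lambda>x. u (R x))" by (rule finite_energy_R[OF u])
  have "energy_density s (\<lambda>x. u (R x)) ?v z = - energy_density s u ?v (R (fst z), R (snd z))" for z
    using energy_density_R[of s u "\<lambda>x. v (R x) - v x" z] by (simp add: energy_density_def algebra_simps)
  then have *: "(\<integral>z. energy_density s (\<lambda>x. u (R x)) ?v z \<partial>lborel) = - (\<integral>z. energy_density s u ?v z \<partial>lborel)"
    by (simp add: integral_R_R)
  have "energy_density s (\<lambda>x. u (R x) - u x) ?v z
      = energy_density s (\<lambda>x. u (R x)) ?v z - energy_density s u ?v z" for z
    by (simp add: energy_density_def algebra_simps)
  then have "(\<integral>z. energy_density s (\<lambda>x. u (R x) - u x) ?v z \<partial>lborel)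
      = - 2 * (\<integral>z. energy_density s u ?v z \<partial>lborel)"
    using energy_density_integrable[OF uR v'] energy_density_integrable[OF u v'] * by simp
  then show ?thesis
    by (subst integral_sym_density) (auto intro: finite_energy_diff u uR v')
qed

lemma sym_density_odd:
  assumes "\<And>x. w (R x) = - w x" "\<And>x. v (R x) = - v x"
  shows "sym_density s w v (x, y) = (w x - w y) * (v x - v y) * frac_kernel s (x, y)
    + (w x + w y) * (v x + v y) * frac_kernel s (x, R y)"
  using assms by (simp add: sym_density_def energy_density_def)

lemma sym_density_R:
  assumes w: "\<And>x. w (R x) = - w x" and v: "\<And>x. v (R x) = - v x"
  shows "sym_density s w v (R x, y) = sym_density s w v (x, y)"
    and "sym_density s w v (x, R y) = sym_density s w v (x, y)"
  unfolding sym_density_odd[of w v, OF assms] w v frac_kernel_R_left R_R by (simp_all add: algebra_simps)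

lemma reflect_wlog:
  assumes inv: "\<And>x y. P (R x) y \<longleftrightarrow> P x y" "\<And>x y. P x (R y) \<longleftrightarrow> P x y"
    and "\<And>x y. (x - x0) \<bullet> e \<ge> l \<Longrightarrow> (y - x0) \<bullet> e \<ge> l \<Longrightarrow> P x y"
  shows "P x y"
proof -
  have "\<exists>x'\<in>{x, R x}. (x' - x0) \<bullet> e \<ge> l" for x using height_R[of x] by auto
  then obtain x' y' where "x' \<in> {x, R x}" "(x' - x0) \<bullet> e \<ge> l" "y' \<in> {y, R y}" "(y' - x0) \<bullet> e \<ge> l"
    by meson
  then show ?thesis using assms(3)[of x' y'] inv by auto
qed

end

section \<open>Pointwise inequalities for the folded energy\<close>

text \<open>
  The integrand of the folded energy of \<open>w\<close> against its truncated negative part, at two points on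
  the same side. Here \<open>K\<close> is the kernel and \<open>K'\<close> the kernel with one point reflected. The second
  inequality keeps the gain from pairs of which only the first point has \<open>w < 0\<close>; this term
  later absorbs the reaction. The alternative \<open>wx = wy\<close> covers the diagonal, where \<open>K = 0 < K'\<close>.
\<close>

lemma negative_part_symmetrized_le:
  fixes wx wy \<epsilon> K K' :: real
  assumes "\<epsilon> > 0" "K \<ge> 0" "K' \<ge> 0" "K' \<le> K \<or> wx = wy"
    and vx: "vx = max 0 (- wx - \<epsilon>)" and vy: "vy = max 0 (- wy - \<epsilon>)"
  shows "(wx - wy) * (vx - vy) * K + (wx + wy) * (vx + vy) * K' \<le> 0"
    and "wy \<ge> 0 \<Longrightarrow> (wx - wy) * (vx - vy) * K + (wx + wy) * (vx + vy) * K' \<le> - (vx\<^sup>2 * K)"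
proof -
  have one: "(w1 - w2) * v1 * K + (w1 + w2) * v1 * K' \<le> - (v1\<^sup>2 * K)"
    if "v1 > 0" "w1 = - v1 - \<epsilon>" "w2 \<ge> - \<epsilon>" "K' \<le> K" for w1 w2 v1
  proof -
    have "(w1 - w2) * K + (w1 + w2) * K' = w1 * (K + K') - w2 * (K - K')" by (simp add: algebra_simps)
    also have "\<dots> \<le> (- v1 - \<epsilon>) * (K + K') + \<epsilon> * (K - K')"
      using mult_right_mono[OF that(3), of "K - K'"] that by simp
    also have "\<dots> = - v1 * K - (v1 * K' + 2 * \<epsilon> * K')" by (simp add: algebra_simps)
    also have "\<dots> \<le> - v1 * K"
    proof -
      have "0 \<le> v1 * K'" "0 \<le> 2 * \<epsilon> * K'" using assms that by simp_all
      then show ?thesis by linarith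
    qed
    finally have "v1 * ((w1 - w2) * K + (w1 + w2) * K') \<le> v1 * (- v1 * K)"
      by (rule mult_left_mono) (use that in simp)
    then show ?thesis by (simp add: power2_eq_square algebra_simps)
  qed
  have "vx \<ge> 0" "vy \<ge> 0" using vx vy by auto
  then consider "vx = 0" "vy = 0" | "vx > 0" "vy > 0" | "vx > 0" "vy = 0" | "vx = 0" "vy > 0" by linarith
  then have "(wx - wy) * (vx - vy) * K + (wx + wy) * (vx + vy) * K' \<le> 0
    \<and> (wy \<ge> 0 \<longrightarrow> (wx - wy) * (vx - vy) * K + (wx + wy) * (vx + vy) * K' \<le> - (vx\<^sup>2 * K))"
  proof cases
    case 2
    then have w: "wx = - vx - \<epsilon>" "wy = - vy - \<epsilon>" using vx vy by (auto simp: max_def split: if_splits)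
    have "(wx - wy) * (vx - vy) * K = - ((vx - vy)\<^sup>2 * K)" unfolding w by algebra
    then have "(wx - wy) * (vx - vy) * K \<le> 0" using \<open>K \<ge> 0\<close> by simp
    moreover have "(wx + wy) * (vx + vy) * K' \<le> 0"
      by (intro mult_nonpos_nonneg) (use 2 w assms(1,3) in linarith)+
    moreover have "\<not> wy \<ge> 0" using 2 w assms(1) by linarith
    ultimately show ?thesis by (intro conjI impI; linarith)
  next
    case 3
    then have w: "wx = - vx - \<epsilon>" "wy \<ge> - \<epsilon>" using vx vy by (auto simp: max_def split: if_splits)
    then have "K' \<le> K" using assms(4) 3 by auto
    have "(wx - wy) * (vx - vy) * K + (wx + wy) * (vx + vy) * K' \<le> - (vx\<^sup>2 * K)"
      using one[OF 3(1) w \<open>K' \<le> K\<close>] 3 by simp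
    moreover have "0 \<le> vx\<^sup>2 * K" using \<open>K \<ge> 0\<close> by simp
    ultimately show ?thesis by linarith
  next
    case 4
    then have w: "wy = - vy - \<epsilon>" "wx \<ge> - \<epsilon>" using vx vy by (auto simp: max_def split: if_splits)
    then have "K' \<le> K" using assms(4) 4 by auto
    have "(wx - wy) * (vx - vy) * K + (wx + wy) * (vx + vy) * K' \<le> - (vy\<^sup>2 * K)"
      using one[OF 4(2) w \<open>K' \<le> K\<close>] 4 by (simp add: algebra_simps)
    also have "\<dots> \<le> 0" using \<open>K \<ge> 0\<close> by simp
    finally show ?thesis using w 4 assms(1) by simp
  qed simp
  then show "(wx - wy) * (vx - vy) * K + (wx + wy) * (vx + vy) * K' \<le> 0"
    "wy \<ge> 0 \<Longrightarrow> (wx - wy) * (vx - vy) * K + (wx + wy) * (vx + vy) * K' \<le> - (vx\<^sup>2 * K)" by auto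
qed

text \<open>
  The same for nonnegative \<open>w\<close> and the truncation \<open>v = max 0 (p - w / \<sigma>)\<close>, which lives where
  \<open>w < \<sigma> p\<close>. Splitting
  \<open>(wx - wy) (vx - vy) K + (wx + wy) (vx + vy) K' = (wx - wy) (vx - vy) (K - K') + 2 K' (wx vx + wy vy)\<close>
  bounds the integrand by \<open>\<sigma>\<close> times that of \<open>p\<close> against itself. If \<open>w\<close> is at least \<open>m\<close> at the second
  point, outside the support of \<open>p\<close>, there is an additional negative term that is independent
  of \<open>\<sigma>\<close>.
\<close>

lemma truncation_symmetrized_le:
  fixes wx wy px py \<sigma> K K' :: real
  assumes "\<sigma> > 0" "K \<ge> 0" "K' \<ge> 0" "K' \<le> K \<or> wx = wy \<and> px = py"
    and "wx \<ge> 0" "wy \<ge> 0" "px \<ge> 0" "py \<ge> 0"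
    and vx: "vx = max 0 (px - wx / \<sigma>)" and vy: "vy = max 0 (py - wy / \<sigma>)"
  shows "(wx - wy) * (vx - vy) * K + (wx + wy) * (vx + vy) * K'
      \<le> \<sigma> * ((px - py) * (px - py) * K + (px + py) * (px + py) * K')"
    and "m \<ge> 0 \<Longrightarrow> py = 0 \<Longrightarrow> wy \<ge> m \<Longrightarrow> \<sigma> * px \<le> m / 2 \<Longrightarrow> K' \<le> K \<Longrightarrow>
      (wx - wy) * (vx - vy) * K + (wx + wy) * (vx + vy) * K'
      \<le> \<sigma> * ((px - py) * (px - py) * K + (px + py) * (px + py) * K') - m / 2 * vx * (K - K')"
proof -
  have kill: "w * max 0 (p - w / \<sigma>) \<le> \<sigma> * p\<^sup>2" if "w \<ge> 0" "p \<ge> 0" for w p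
  proof (cases "w \<le> \<sigma> * p")
    case True
    then have "w / \<sigma> \<le> p" using assms(1) by (simp add: field_simps)
    then have "w * max 0 (p - w / \<sigma>) \<le> (\<sigma> * p) * p"
      using True that assms(1) by (intro mult_mono) auto
    then show ?thesis by (simp add: power2_eq_square)
  next
    case False
    then have "p - w / \<sigma> \<le> 0" using assms(1) by (simp add: field_simps)
    then show ?thesis using assms(1) by (simp add: max_def)
  qed
  have kx: "wx * vx \<le> \<sigma> * px\<^sup>2" and ky: "wy * vy \<le> \<sigma> * py\<^sup>2"
    unfolding vx vy using kill assms by auto
  have quad: "\<sigma> * ((b - d) * d) \<le> \<sigma> * (b * b)" for b d :: real
  proof (rule mult_left_mono)
    have "0 \<le> (b - d) * (b - d) + b * b + d * d" by simp
    then show "(b - d) * d \<le> b * b" by (simp add: algebra_simps)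
  qed (use assms in simp)
  have pos: "w1 = \<sigma> * (p1 - max 0 (p1 - w1 / \<sigma>))" if "max 0 (p1 - w1 / \<sigma>) > 0" for w1 p1
    using that assms(1) by (simp add: max_def field_simps split: if_splits)
  have zero: "w1 \<ge> \<sigma> * p1" if "max 0 (p1 - w1 / \<sigma>) = 0" for w1 p1
    using that assms(1) by (simp add: max_def field_simps split: if_splits)
  have mixed: "(w1 - w2) * v1 \<le> \<sigma> * ((p1 - p2) * (p1 - p2))"
    if "v1 > 0" "w1 = \<sigma> * (p1 - v1)" "w2 \<ge> \<sigma> * p2" for w1 w2 p1 p2 v1
  proof -
    have "(w1 - w2) * v1 \<le> (\<sigma> * (p1 - p2 - v1)) * v1"
      using that by (intro mult_right_mono) (auto simp: algebra_simps)
    also have "\<dots> \<le> \<sigma> * ((p1 - p2) * (p1 - p2))" using quad[of "p1 - p2" v1] by (simp add: mult.assoc)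
    finally show ?thesis .
  qed
  have cross: "(wx - wy) * (vx - vy) \<le> \<sigma> * ((px - py) * (px - py))"
  proof -
    have "vx \<ge> 0" "vy \<ge> 0" using vx vy by auto
    then consider "vx = 0" "vy = 0" | "vx > 0" "vy > 0" | "vx > 0" "vy = 0" | "vx = 0" "vy > 0" by linarith
    then show ?thesis
    proof cases
      case 1 then show ?thesis using assms(1) by simp
    next
      case 2
      have w: "wx = \<sigma> * (px - vx)" "wy = \<sigma> * (py - vy)"
        by (rule pos[of px wx, folded vx, OF 2(1)], rule pos[of py wy, folded vy, OF 2(2)])
      have "(wx - wy) * (vx - vy) = \<sigma> * (((px - py) - (vx - vy)) * (vx - vy))"
        unfolding w by algebra
      also have "\<dots> \<le> \<sigma> * ((px - py) * (px - py))" by (rule quad)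
      finally show ?thesis .
    next
      case 3
      show ?thesis
        using mixed[OF 3(1) pos[of px wx, folded vx, OF 3(1)] zero[of py wy, folded vy, OF 3(2)]] 3(2)
        by simp
    next
      case 4
      have "(wx - wy) * (vx - vy) = (wy - wx) * vy" unfolding 4(1) by algebra
      also have "\<dots> \<le> \<sigma> * ((py - px) * (py - px))"
        by (rule mixed[OF 4(2) pos[of py wy, folded vy, OF 4(2)] zero[of px wx, folded vx, OF 4(1)]])
      also have "\<dots> = \<sigma> * ((px - py) * (px - py))" by algebra
      finally show ?thesis .
    qed
  qed
  have split_l: "(wx - wy) * (vx - vy) * K + (wx + wy) * (vx + vy) * K'
      = (wx - wy) * (vx - vy) * (K - K') + 2 * K' * (wx * vx + wy * vy)" by (simp add: algebra_simps)
  have split_r: "\<sigma> * ((px - py) * (px - py) * K + (px + py) * (px + py) * K')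
      = \<sigma> * ((px - py) * (px - py)) * (K - K') + 2 * K' * (\<sigma> * px\<^sup>2 + \<sigma> * py\<^sup>2)"
    by (simp add: algebra_simps power2_eq_square)
  have k: "2 * K' * (wx * vx + wy * vy) \<le> 2 * K' * (\<sigma> * px\<^sup>2 + \<sigma> * py\<^sup>2)"
    using kx ky assms(3) by (intro mult_left_mono) auto
  have "(wx - wy) * (vx - vy) * (K - K') \<le> \<sigma> * ((px - py) * (px - py)) * (K - K')"
  proof (cases "K' \<le> K")
    case True
    then show ?thesis using cross by (intro mult_right_mono) auto
  next
    case False
    then show ?thesis using assms(4) by simp
  qed
  then show "(wx - wy) * (vx - vy) * K + (wx + wy) * (vx + vy) * K'
      \<le> \<sigma> * ((px - py) * (px - py) * K + (px + py) * (px + py) * K')"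
    unfolding split_l split_r using k by linarith
  assume gain: "m \<ge> 0" "py = 0" "wy \<ge> m" "\<sigma> * px \<le> m / 2" "K' \<le> K"
  have "0 \<le> wy / \<sigma>" using gain assms(1) by simp
  then have "vy = 0" unfolding vy gain(2) by (intro max_absorb1) simp
  have "(wx - wy) * vx \<le> - (m / 2) * vx"
  proof (cases "vx > 0")
    case True
    then have "wx = \<sigma> * px - \<sigma> * vx"
      using pos[of px wx, folded vx] unfolding right_diff_distrib by blast
    moreover have "\<sigma> * vx > 0" using True assms(1) by simp
    ultimately show ?thesis using True gain by (intro mult_right_mono) linarith+
  next
    case False
    then have "vx = 0" using vx by auto
    then show ?thesis by simp
  qed
  then have "(wx - wy) * (vx - vy) * (K - K') \<le> (- (m / 2) * vx) * (K - K')"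
    using gain \<open>vy = 0\<close> by (intro mult_right_mono) auto
  moreover have "0 \<le> \<sigma> * ((px - py) * (px - py)) * (K - K')" using gain assms(1) by simp
  ultimately show "(wx - wy) * (vx - vy) * K + (wx + wy) * (vx + vy) * K'
      \<le> \<sigma> * ((px - py) * (px - py) * K + (px + py) * (px + py) * K') - m / 2 * vx * (K - K')"
    unfolding split_l split_r using k by linarith
qed

section \<open>The reflected difference and its equation\<close>

lemma lipschitz_cutoff:
  fixes C :: "'a::euclidean_space set"
  assumes "compact C" "open \<Omega>" "C \<subseteq> \<Omega>"
  obtains \<psi> :: "'a \<Rightarrow> real" and S M
  where "\<And>x y. \<bar>\<psi> x - \<psi> y\<bar> \<le> M * norm (x - y)" "\<And>x. 0 \<le> \<psi> x" "\<And>x. \<psi> x \<le> 1"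
    "\<And>x. x \<in> C \<Longrightarrow> \<psi> x = 1" "\<And>x. x \<notin> S \<Longrightarrow> \<psi> x = 0" "compact S" "S \<subseteq> \<Omega>"
proof (cases "C = {}")
  case True
  show ?thesis by (rule that[of "\<lambda>_. 0" 0 "{}"]) (use True in auto)
next
  case False
  obtain d where d: "d > 0" "(\<Union>x\<in>C. cball x d) \<subseteq> \<Omega>"
    by (rule compact_subset_open_imp_cball_epsilon_subset[OF assms])
  let ?S = "{x + y |x y. x \<in> C \<and> y \<in> cball (0::'a) d}"
  let ?\<psi> = "\<lambda>x. max 0 (1 - infdist x C / d)"
  show ?thesis
  proof (rule that[of ?\<psi> "1 / d" ?S])
    fix x y
    have "\<bar>max 0 (1 - p) - max 0 (1 - q)\<bar> \<le> \<bar>p - q\<bar>" for p q :: real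
      by (simp add: max_def abs_if)
    then have "\<bar>?\<psi> x - ?\<psi> y\<bar> \<le> \<bar>infdist x C / d - infdist y C / d\<bar>" .
    also have "\<dots> = \<bar>infdist x C - infdist y C\<bar> / d"
      using d(1) by (simp add: diff_divide_distrib[symmetric] abs_divide)
    also have "\<dots> \<le> norm (x - y) / d"
      using d(1) infdist_triangle_abs[of x C y] by (intro divide_right_mono) (auto simp: dist_norm)
    finally show "\<bar>?\<psi> x - ?\<psi> y\<bar> \<le> 1 / d * norm (x - y)" by simp
  next
    fix x assume x: "x \<notin> ?S"
    obtain p where p: "p \<in> C" "infdist x C = dist x p"
      using infdist_attains_inf[OF compact_imp_closed[OF assms(1)] False] by blast
    have "x = p + (x - p)" by simp
    then have "x - p \<notin> cball 0 d" using x p(1) by blast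
    then have "d < infdist x C" unfolding p(2) by (simp add: dist_norm norm_minus_commute)
    then show "?\<psi> x = 0" using d(1) by (simp add: max_def field_simps)
  next
    show "?S \<subseteq> \<Omega>"
    proof
      fix z assume "z \<in> ?S"
      then obtain x y where "z = x + y" "x \<in> C" "norm y \<le> d" by auto
      then have "z \<in> cball x d" by (simp add: dist_norm)
      then show "z \<in> \<Omega>" using \<open>x \<in> C\<close> d(2) by blast
    qed
    show "compact ?S" by (rule compact_sums[OF assms(1) compact_cball])
    fix x
    show "?\<psi> x \<le> 1" using infdist_nonneg[of x C] d(1) by simp
    show "x \<in> C \<Longrightarrow> ?\<psi> x = 1" by simp
  qed simp
qed

lemma finite_energy_cutoff:
  fixes C :: "'a::euclidean_space set"
  assumes "0 < s" "s < 1" "compact C" "open \<Omega>" "C \<subseteq> \<Omega>"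
  obtains \<psi> :: "'a \<Rightarrow> real" and S
  where "continuous_on UNIV \<psi>" "finite_energy s \<psi>" "\<And>x. 0 \<le> \<psi> x" "\<And>x. \<psi> x \<le> 1"
    "\<And>x. x \<in> C \<Longrightarrow> \<psi> x = 1" "\<And>x. x \<notin> S \<Longrightarrow> \<psi> x = 0" "compact S" "S \<subseteq> \<Omega>"
proof -
  obtain \<psi> S M where \<psi>: "\<And>x y. \<bar>\<psi> x - \<psi> y\<bar> \<le> M * norm (x - y)" "\<And>x. 0 \<le> \<psi> x" "\<And>x. \<psi> x \<le> 1"
    "\<And>x. x \<in> C \<Longrightarrow> \<psi> x = 1" "\<And>x. x \<notin> S \<Longrightarrow> \<psi> x = 0" "compact S" "S \<subseteq> \<Omega>"
    using lipschitz_cutoff[OF assms(3-5)] by metis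
  have "\<bar>\<psi> x\<bar> \<le> 1" for x using \<psi>(2,3)[of x] by simp
  then have "finite_energy s \<psi>"
    by (rule finite_energy_lipschitz[OF assms(1,2) \<psi>(1) _ \<psi>(5) compact_imp_bounded[OF \<psi>(6)]])
  then show ?thesis
    using that[OF continuous_on_abs_lipschitz[OF \<psi>(1)] _ \<psi>(2-7)] by simp
qed

text \<open>
  The exterior problem, with a Lipschitz constant \<open>L\<close> of \<open>f\<close>
  on the range \<open>{0..a}\<close> of \<open>u\<close>.
\<close>

locale exterior_solution =
  fixes s c a \<rho> t0 L :: real and f :: "real \<Rightarrow> real" and u :: "'a::euclidean_space \<Rightarrow> real" and x0 :: 'a
  assumes s: "0 < s" "s < 1" and c: "0 < c" and a: "0 < a" and \<rho>: "0 < \<rho>" and t0: "0 < t0"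
    and f_cont: "continuous_on UNIV f"
    and L: "0 \<le> L" "\<And>t t'. t \<in> {0..a} \<Longrightarrow> t' \<in> {0..a} \<Longrightarrow> \<bar>f t - f t'\<bar> \<le> L * \<bar>t - t'\<bar>"
    and f_anti: "\<And>t t'. 0 \<le> t \<Longrightarrow> t \<le> t' \<Longrightarrow> t' \<le> t0 \<Longrightarrow> f t' \<le> f t"
    and u_cont: "continuous_on UNIV u"
    and sol: "weak_solution c s (- cball x0 \<rho>) (\<lambda>x. f (u x)) u"
    and u_ball: "\<And>x. x \<in> cball x0 \<rho> \<Longrightarrow> u x = a"
    and u_nonneg: "\<And>x. 0 \<le> u x"
    and u_less: "\<And>x. x \<notin> cball x0 \<rho> \<Longrightarrow> u x < a"
    and u_lim: "(u \<longlongrightarrow> 0) at_infinity"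
begin

lemma u_le: "u x \<le> a"
  using u_ball u_less by (metis less_eq_real_def)

lemma u_small:
  assumes "\<eta> > 0"
  obtains r where "r > 0" "\<And>x. u x \<ge> \<eta> \<Longrightarrow> norm (x - x0) \<le> r"
proof -
  obtain b where b: "\<And>x. norm x \<ge> b \<Longrightarrow> dist (u x) 0 < \<eta>"
    using u_lim assms unfolding Lim_at_infinity by blast
  show ?thesis
  proof (rule that[of "\<bar>b\<bar> + norm x0 + 1"])
    fix x assume "u x \<ge> \<eta>"
    then have "norm x < b" using b[of x] by (auto simp: not_le[symmetric])
    then show "norm (x - x0) \<le> \<bar>b\<bar> + norm x0 + 1" using norm_triangle_ineq4[of x x0] by linarith
  qed (simp add: add_nonneg_pos)
qed

lemma finite_energy_u: "finite_energy s u"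
  by (rule D_space_finite_energy[OF s c]) (use sol in \<open>simp add: weak_solution_def\<close>)

lemma measurable_u [measurable]: "u \<in> borel_measurable borel"
  by (rule borel_measurable_continuous_onI) (rule u_cont)

lemma continuous_f_u: "continuous_on UNIV (\<lambda>x. f (u x))"
  by (rule continuous_on_compose2[OF f_cont u_cont]) simp

end

locale moving_plane = exterior_solution s c a \<rho> t0 L f u x0 + hyperplane x0 e l
  for s c a \<rho> t0 L :: real and f :: "real \<Rightarrow> real" and u :: "'a::euclidean_space \<Rightarrow> real" and x0 e :: 'a and l :: real +
  assumes l: "0 < l"
begin

definition w :: "'a \<Rightarrow> real" where "w x = u (R x) - u x"

definition \<Omega> :: "'a set" where "\<Omega> = {x \<in> H. x \<notin> cball x0 \<rho> \<and> R x \<notin> cball x0 \<rho>}"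

lemma w_R: "w (R x) = - w x"
  by (simp add: w_def)

lemma w_cont: "continuous_on UNIV w"
  unfolding w_def by (intro continuous_intros continuous_on_compose2[OF u_cont] continuous_R u_cont) auto

lemma measurable_w [measurable]: "w \<in> borel_measurable borel"
  by (rule borel_measurable_continuous_onI) (rule w_cont)

lemma w_boundary: "(x - x0) \<bullet> e = l \<Longrightarrow> w x = 0"
  by (simp add: w_def R_boundary)

lemma abs_w_le: "\<bar>w x\<bar> \<le> a"
  using u_nonneg[of x] u_nonneg[of "R x"] u_le[of x] u_le[of "R x"] by (simp add: w_def)

lemma u_ge_neg_w: "- w x \<le> u x"
  using u_nonneg[of "R x"] by (simp add: w_def)

lemma R_cball:
  assumes "x \<in> H" "x \<in> cball x0 \<rho>"
  shows "R x \<in> cball x0 \<rho>"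
proof -
  have "0 \<le> 4 * l * ((x - x0) \<bullet> e - l)" using l assms(1) by (simp add: H_def)
  then have "(norm (R x - x0))\<^sup>2 \<le> (norm (x - x0))\<^sup>2" unfolding norm_R_center_sq by simp
  then have "norm (R x - x0) \<le> norm (x - x0)" by (rule power2_le_imp_le) simp
  then show ?thesis using assms(2) by (simp add: dist_norm norm_minus_commute)
qed

text \<open>
  Where \<open>w\<close> is negative on the far side of the plane, both \<open>u\<close> and its reflection solve the equation.
  This is what makes the negative part of \<open>w\<close> an admissible test function.
\<close>

lemma w_neg_imp_\<Omega>:
  assumes "(x - x0) \<bullet> e \<ge> l" "w x < 0"
  shows "x \<in> \<Omega>"
proof -
  have "x \<in> H" using assms w_boundary[of x] by (fastforce simp: H_def)
  moreover have "R x \<notin> cball x0 \<rho>"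
    using assms(2) u_ball[of "R x"] u_le[of x] by (auto simp: w_def)
  ultimately show ?thesis using R_cball by (auto simp: \<Omega>_def)
qed

lemma open_\<Omega>: "open \<Omega>"
proof -
  have "\<Omega> = H \<inter> (- cball x0 \<rho>) \<inter> R -` (- cball x0 \<rho>)" by (auto simp: \<Omega>_def)
  moreover have "open (R -` (- cball x0 \<rho>))"
    by (rule open_vimage[OF _ continuous_R]) (simp add: open_Compl)
  ultimately show ?thesis using open_H by (simp add: open_Int open_Compl)
qed

lemma finite_energy_w: "finite_energy s w"
  unfolding w_def by (intro finite_energy_diff finite_energy_R finite_energy_u)

text \<open>
  The equation for \<open>w\<close> in weak form. Testing the equation for \<open>u\<close> with \<open>v - v \<circ> R\<close> is allowed, since \<open>\<Omega>\<close>
  and its mirror image avoid the ball.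
\<close>

lemma integral_sym_density_test:
  assumes v: "continuous_on UNIV v" "\<And>x. x \<notin> C \<Longrightarrow> v x = 0" and C: "compact C" "C \<subseteq> \<Omega>"
    and fin: "finite_energy s v"
  shows "(\<integral>z. sym_density s w (\<lambda>x. v x - v (R x)) z \<partial>lborel)
      = 8 / c * (\<integral>x. (f (u (R x)) - f (u x)) * v x \<partial>lborel)"
proof -
  let ?v = "\<lambda>x. v x - v (R x)"
  let ?E = "\<integral>z. energy_density s u ?v z \<partial>lborel"
  have RC: "compact (R ` C)" by (rule compact_continuous_image[OF continuous_R C(1)])
  have vR_cont: "continuous_on UNIV (\<lambda>x. v (R x))"
    by (rule continuous_on_compose2[OF v(1) continuous_R]) simp
  have vR_zero: "v (R x) = 0" if "x \<notin> R ` C" for x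
    using that v(2)[of "R x"] by (metis R_R image_eqI)
  have fuR_cont: "continuous_on UNIV (\<lambda>x. f (u (R x)))"
    by (rule continuous_on_compose2[OF continuous_f_u continuous_R]) simp
  have [measurable]: "v \<in> borel_measurable borel" by (rule borel_measurable_continuous_onI[OF v(1)])
  have [measurable]: "(\<lambda>x. f (u (R x))) \<in> borel_measurable borel"
    by (rule borel_measurable_continuous_onI[OF fuR_cont])
  have "c / 2 * ?E = (\<integral>x. f (u x) * ?v x \<partial>lborel)"
  proof (rule weak_solution_continuous_test[OF s c sol])
    show "compact (C \<union> R ` C)" using C(1) RC by (rule compact_Un)
    show "?v x = 0" if "x \<notin> C \<union> R ` C" for x using that v(2) vR_zero by simp
    show "C \<union> R ` C \<subseteq> - cball x0 \<rho>" using C(2) by (auto simp: \<Omega>_def)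
    show "finite_energy s ?v" by (intro finite_energy_diff finite_energy_R fin)
  qed (auto intro!: continuous_intros continuous_f_u v(1) vR_cont)
  also have "\<dots> = (\<integral>x. f (u x) * v x \<partial>lborel) - (\<integral>x. f (u x) * v (R x) \<partial>lborel)"
  proof -
    have "integrable lborel (\<lambda>x. f (u x) * v x)"
      by (rule lborel_integrable_continuous_compact_support[of _ C])
        (use C v in \<open>auto intro!: continuous_on_mult continuous_f_u\<close>)
    moreover have "integrable lborel (\<lambda>x. f (u x) * v (R x))"
      by (rule lborel_integrable_continuous_compact_support[of _ "R ` C"])
        (use RC vR_zero in \<open>auto intro!: continuous_on_mult continuous_f_u vR_cont\<close>)
    ultimately show ?thesis by (simp add: right_diff_distrib)
  qed
  also have "(\<integral>x. f (u x) * v (R x) \<partial>lborel) = (\<integral>x. f (u (R x)) * v x \<partial>lborel)"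
    using integral_R[of "\<lambda>x. f (u (R x)) * v x"] by simp
  also have "(\<integral>x. f (u x) * v x \<partial>lborel) - (\<integral>x. f (u (R x)) * v x \<partial>lborel)
      = - (\<integral>x. (f (u (R x)) - f (u x)) * v x \<partial>lborel)"
  proof -
    have "integrable lborel (\<lambda>x. f (u x) * v x)" "integrable lborel (\<lambda>x. f (u (R x)) * v x)"
      by (rule lborel_integrable_continuous_compact_support[of _ C];
        use C v in \<open>auto intro!: continuous_on_mult continuous_f_u fuR_cont\<close>)+
    then show ?thesis by (simp add: left_diff_distrib)
  qed
  finally have "?E = - 2 / c * (\<integral>x. (f (u (R x)) - f (u x)) * v x \<partial>lborel)"
    using c by (simp add: field_simps)
  moreover have "(\<integral>z. sym_density s w ?v z \<partial>lborel) = - 4 * ?E"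
    unfolding w_def by (rule integral_sym_density_odd_part[OF finite_energy_u fin])
  ultimately show ?thesis by simp
qed

text \<open>
  The point \<open>y0\<close> is the mirror image of a point of the ball between its center and its far pole \<open>x0 - \<rho> e\<close>. It lies
  in \<open>H\<close> and outside the ball whether or not the plane meets the ball, so \<open>w = a - u > 0\<close> at \<open>y0\<close>.
\<close>

lemma gain_set:
  obtains D m where "open D" "D \<noteq> {}" "m > 0" "\<And>y. y \<in> D \<Longrightarrow> y \<in> H \<and> w y \<ge> m \<and> y \<notin> \<Omega>"
proof -
  \<comment> \<open>\<open>\<tau> \<le> l\<close> keeps \<open>y0\<close> outside the ball, \<open>0 < \<tau> \<le> \<rho>\<close> puts its mirror image inside\<close>
  define \<tau> where "\<tau> = min l \<rho>"
  have \<tau>: "0 < \<tau>" "\<tau> \<le> l" "\<tau> \<le> \<rho>" using l \<rho> by (auto simp: \<tau>_def)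
  define y0 where "y0 = x0 + (2 * l + \<rho> - \<tau>) *\<^sub>R e"
  have "y0 \<in> H" using \<tau> l \<rho> by (simp add: H_def y0_def)
  have "R y0 = x0 + (\<tau> - \<rho>) *\<^sub>R e" by (simp add: R_def y0_def algebra_simps flip: scaleR_left_distrib)
  then have R_y0: "R y0 \<in> ball x0 \<rho>" using \<tau> by (simp add: dist_norm norm_e)
  then have "R y0 \<in> cball x0 \<rho>" by simp
  moreover have "y0 \<notin> cball x0 \<rho>" using \<tau> l by (simp add: y0_def dist_norm norm_e)
  ultimately have "w y0 > 0" using u_ball[of "R y0"] u_less[of y0] by (simp add: w_def)
  define D where "D = H \<inter> {y. w y > w y0 / 2} \<inter> R -` ball x0 \<rho>"
  have "open D"
    unfolding D_def
    by (intro open_Int open_H open_Collect_less continuous_intros w_cont open_vimage continuous_R open_ball)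
  moreover have "y0 \<in> D" using \<open>y0 \<in> H\<close> \<open>w y0 > 0\<close> R_y0 by (simp add: D_def)
  moreover have "y \<in> H \<and> w y \<ge> w y0 / 2 \<and> y \<notin> \<Omega>" if "y \<in> D" for y
    using that by (auto simp: D_def \<Omega>_def)
  ultimately show ?thesis using that[of D "w y0 / 2"] \<open>w y0 > 0\<close> by auto
qed

end

section \<open>Weak maximum principle\<close>

lemma nn_integral_lborel_pair:
  fixes h :: "'a::euclidean_space \<times> 'b::euclidean_space \<Rightarrow> ennreal"
  assumes "h \<in> borel_measurable borel"
  shows "(\<integral>\<^sup>+z. h z \<partial>lborel) = (\<integral>\<^sup>+x. \<integral>\<^sup>+y. h (x, y) \<partial>lborel \<partial>lborel)"
proof -
  have "h \<in> borel_measurable (lborel \<Otimes>\<^sub>M lborel)" using assms by (simp add: lborel_prod)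
  from lborel.nn_integral_fst[OF this] show ?thesis by (simp add: lborel_prod)
qed

context moving_plane
begin

text \<open>
  The negative part of \<open>w\<close> in \<open>H\<close>, lowered by \<open>\<epsilon>\<close> so that its support is a compact subset of \<open>\<Omega>\<close>.
\<close>

definition deficit :: "real \<Rightarrow> 'a \<Rightarrow> real" where
  "deficit \<epsilon> x = (if x \<in> H then max 0 (- w x - \<epsilon>) else 0)"

definition deficit_support :: "real \<Rightarrow> 'a set" where
  "deficit_support \<epsilon> = {x. (x - x0) \<bullet> e \<ge> l \<and> w x \<le> - \<epsilon>}"

text \<open>
  The weight that the squared deficit at \<open>x\<close> receives in the energy estimate. It may be infinite at
  points that \<open>{w \<ge> 0}\<close> surrounds.
\<close>

definition gain :: "'a \<Rightarrow> ennreal" where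
  "gain x = (\<integral>\<^sup>+y. indicator {y \<in> H. w y \<ge> 0} y * ennreal (frac_kernel s (x, y)) \<partial>lborel)"

text \<open>
  The part of \<open>{w < 0}\<close> in which the reaction term may have the wrong sign.
\<close>

definition reaction_set :: "'a set" where
  "reaction_set = {x \<in> H. w x < 0 \<and> u x > t0}"

lemma sets_H [measurable]: "H \<in> sets borel"
  using open_H by simp

lemma sets_nonneg [measurable]: "{y \<in> H. w y \<ge> 0} \<in> sets borel"
proof -
  have "{y \<in> H. w y \<ge> 0} = H \<inter> {y \<in> space borel. w y \<ge> 0}" by auto
  then show ?thesis by simp
qed

lemma sets_reaction_set [measurable]: "reaction_set \<in> sets borel"
proof -
  have "reaction_set = H \<inter> {y \<in> space borel. w y < 0 \<and> u y > t0}" by (auto simp: reaction_set_def)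
  then show ?thesis by simp
qed

lemma deficit_support_subset: "\<epsilon> > 0 \<Longrightarrow> deficit_support \<epsilon> \<subseteq> \<Omega>"
  unfolding deficit_support_def using w_neg_imp_\<Omega> by auto

lemma compact_deficit_support:
  assumes "\<epsilon> > 0" shows "compact (deficit_support \<epsilon>)"
proof -
  have "closed (deficit_support \<epsilon>)"
    unfolding deficit_support_def by (intro closed_Collect_conj closed_Collect_le continuous_intros w_cont)
  moreover obtain r where r: "\<And>x. u x \<ge> \<epsilon> \<Longrightarrow> norm (x - x0) \<le> r" using u_small[OF assms] by blast
  have "deficit_support \<epsilon> \<subseteq> cball x0 r"
  proof
    fix x assume "x \<in> deficit_support \<epsilon>"
    then have "u x \<ge> \<epsilon>" using u_ge_neg_w[of x] by (simp add: deficit_support_def)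
    from r[OF this] show "x \<in> cball x0 r" by (simp add: dist_norm norm_minus_commute)
  qed
  then have "bounded (deficit_support \<epsilon>)" using bounded_cball bounded_subset by blast
  ultimately show ?thesis by (simp add: compact_eq_bounded_closed)
qed

lemma deficit_nonneg: "deficit \<epsilon> x \<ge> 0" by (simp add: deficit_def)

lemma deficit_le: "\<epsilon> > 0 \<Longrightarrow> deficit \<epsilon> x \<le> a"
  using abs_w_le[of x] a by (auto simp: deficit_def)

lemma deficit_pos: "deficit \<epsilon> x > 0 \<Longrightarrow> x \<in> H \<and> w x = - deficit \<epsilon> x - \<epsilon>"
  by (auto simp: deficit_def max_def split: if_splits)

lemma deficit_zero: "\<epsilon> > 0 \<Longrightarrow> x \<notin> deficit_support \<epsilon> \<Longrightarrow> deficit \<epsilon> x = 0"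
  by (auto simp: deficit_def deficit_support_def H_def)

text \<open>
  On its compact support the deficit is at most \<open>a\<close>, so it is the minimum of \<open>max 0 (- w - \<epsilon>)\<close>, taken
  on the whole space, and \<open>a\<close> times a Lipschitz cutoff. This displays it as a function of finite energy.
\<close>

lemma deficit_regular:
  assumes "\<epsilon> > 0"
  shows "continuous_on UNIV (deficit \<epsilon>)" "finite_energy s (deficit \<epsilon>)"
proof -
  obtain \<psi> S where \<psi>_cont: "continuous_on UNIV \<psi>" and fin_\<psi>: "finite_energy s \<psi>"
    and \<psi>: "\<And>x. 0 \<le> \<psi> x" "\<And>x. x \<in> deficit_support \<epsilon> \<Longrightarrow> \<psi> x = 1" "\<And>x. x \<notin> S \<Longrightarrow> \<psi> x = 0" "S \<subseteq> \<Omega>"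
    using finite_energy_cutoff[OF s compact_deficit_support[OF assms] open_\<Omega> deficit_support_subset[OF assms]] by metis
  have deficit_eq: "deficit \<epsilon> x = min (max 0 (- w x - \<epsilon>)) (a * \<psi> x)" for x
  proof (cases "x \<in> deficit_support \<epsilon>")
    case True
    then have "x \<in> H" "\<psi> x = 1" using deficit_support_subset[OF assms] \<psi>(2) by (auto simp: \<Omega>_def)
    moreover have "max 0 (- w x - \<epsilon>) \<le> a" using abs_w_le[of x] a assms by simp
    ultimately show ?thesis by (simp add: deficit_def min_def)
  next
    case False
    show ?thesis
    proof (cases "x \<in> H")
      case True
      then have "- w x - \<epsilon> \<le> 0" using False by (auto simp: deficit_support_def H_def)
      then show ?thesis using \<psi>(1)[of x] a by (simp add: deficit_def)
    next
      case False
      then have "\<psi> x = 0" using \<psi>(3,4) by (auto simp: \<Omega>_def)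
      then show ?thesis using False by (simp add: deficit_def)
    qed
  qed
  show cont: "continuous_on UNIV (deficit \<epsilon>)"
    unfolding deficit_eq[abs_def] by (intro continuous_intros w_cont \<psi>_cont)
  show "finite_energy s (deficit \<epsilon>)"
  proof (rule finite_energy_dominated[OF _ finite_energy_w fin_\<psi>])
    show "deficit \<epsilon> \<in> borel_measurable borel" by (rule borel_measurable_continuous_onI[OF cont])
    fix x y
    have min_max: "\<bar>min (max 0 (- p - \<epsilon>)) q - min (max 0 (- p' - \<epsilon>)) q'\<bar> \<le> \<bar>p - p'\<bar> + \<bar>q - q'\<bar>"
      for p p' q q' :: real by (simp add: min_def max_def abs_if)
    have "a * \<psi> x - a * \<psi> y = a * (\<psi> x - \<psi> y)" by (simp add: right_diff_distrib)
    then have "\<bar>a * \<psi> x - a * \<psi> y\<bar> = a * \<bar>\<psi> x - \<psi> y\<bar>" using a by (simp add: abs_mult)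
    then show "\<bar>deficit \<epsilon> x - deficit \<epsilon> y\<bar> \<le> 1 * \<bar>w x - w y\<bar> + a * \<bar>\<psi> x - \<psi> y\<bar>"
      using min_max[of "w x" "a * \<psi> x" "w y" "a * \<psi> y"] unfolding deficit_eq by simp
  qed
qed

lemma integrable_deficit_products:
  assumes "\<epsilon> > 0"
  shows "integrable lborel (\<lambda>x. indicator reaction_set x * ((deficit \<epsilon> x + \<epsilon>) * deficit \<epsilon> x))"
    and "integrable lborel (\<lambda>x. indicator reaction_set x * (deficit \<epsilon> x)\<^sup>2)"
    and "integrable lborel (\<lambda>x. (f (u (R x)) - f (u x)) * deficit \<epsilon> x)"
proof -
  note cont = deficit_regular(1)[OF assms]
  have int: "integrable lborel g" if "continuous_on UNIV g" "\<And>x. deficit \<epsilon> x = 0 \<Longrightarrow> g x = 0" for g :: "'a \<Rightarrow> real"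
  proof (rule lborel_integrable_continuous_compact_support[OF that(1)])
    show "g x = 0" if "x \<notin> deficit_support \<epsilon>" for x by (rule \<open>\<And>x. deficit \<epsilon> x = 0 \<Longrightarrow> g x = 0\<close>[OF deficit_zero[OF assms that]])
  qed (rule compact_deficit_support[OF assms])
  have ind: "integrable lborel (\<lambda>x. indicator reaction_set x * g x)" if "integrable lborel g" for g :: "'a \<Rightarrow> real"
    using integrable_mult_indicator[of reaction_set lborel g] that by simp
  show "integrable lborel (\<lambda>x. indicator reaction_set x * ((deficit \<epsilon> x + \<epsilon>) * deficit \<epsilon> x))"
    by (intro ind int) (auto intro!: continuous_intros cont)
  show "integrable lborel (\<lambda>x. indicator reaction_set x * (deficit \<epsilon> x)\<^sup>2)"
    by (intro ind int) (auto intro!: continuous_intros cont)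
  show "integrable lborel (\<lambda>x. (f (u (R x)) - f (u x)) * deficit \<epsilon> x)"
    by (rule int)
      (auto intro!: continuous_intros cont continuous_f_u continuous_on_compose2[OF continuous_f_u continuous_R])
qed

text \<open>
  Testing with the deficit. The folded energy is nonpositive and pairs of a point with \<open>w < 0\<close> and a
  point with \<open>w \<ge> 0\<close> contribute the left-hand side; the reaction contributes only on the reaction set,
  where \<open>f u - f (u \<circ> R) \<le> L \<bar>w\<bar>\<close>.
\<close>

lemma weak_maximum_energy:
  assumes \<epsilon>: "\<epsilon> > 0"
  shows "(\<integral>\<^sup>+x. ennreal ((deficit \<epsilon> x)\<^sup>2) * gain x \<partial>lborel)
    \<le> ennreal (8 * L / c * (\<integral>x. indicator reaction_set x * ((deficit \<epsilon> x + \<epsilon>) * deficit \<epsilon> x) \<partial>lborel))"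
proof -
  let ?v = "\<lambda>x. deficit \<epsilon> x - deficit \<epsilon> (R x)"
  let ?S = "sym_density s w ?v"
  let ?P = "{y \<in> H. w y \<ge> 0}"
  note fin = deficit_regular(2)[OF \<epsilon>]
  have [measurable]: "deficit \<epsilon> \<in> borel_measurable borel" by (rule finite_energy_measurable[OF fin])
  have odd: "?v (R x) = - ?v x" for x by simp
  have deficit_upper: "?v x = max 0 (- w x - \<epsilon>)" if "(x - x0) \<bullet> e \<ge> l" for x
  proof (cases "x \<in> H")
    case True
    then show ?thesis using R_H by (simp add: deficit_def)
  next
    case False
    then have "(x - x0) \<bullet> e = l" using that by (simp add: H_def)
    then show ?thesis using False w_boundary[of x] R_boundary[of x] \<epsilon> by (simp add: deficit_def)
  qed
  have K: "frac_kernel s (x, R y) \<le> frac_kernel s (x, y) \<or> w x = w y"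
    if "(x - x0) \<bullet> e \<ge> l" "(y - x0) \<bullet> e \<ge> l" for x y
    using frac_kernel_R_le[OF s(1) that] by (cases "x = y") auto
  have S_le_0: "?S (x, y) \<le> 0" for x y
  proof (rule reflect_wlog)
    show "?S (R x, y) \<le> 0 \<longleftrightarrow> ?S (x, y) \<le> 0" "?S (x, R y) \<le> 0 \<longleftrightarrow> ?S (x, y) \<le> 0" for x y
      using sym_density_R[of w ?v, OF w_R odd] by simp_all
    fix x y assume xy: "(x - x0) \<bullet> e \<ge> l" "(y - x0) \<bullet> e \<ge> l"
    show "?S (x, y) \<le> 0"
      unfolding sym_density_odd[of w ?v, OF w_R odd]
      by (rule negative_part_symmetrized_le(1)[OF \<epsilon> _ _ K[OF xy] deficit_upper[OF xy(1)] deficit_upper[OF xy(2)]]) simp_all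
  qed
  have S_le: "?S (x, y) \<le> - ((deficit \<epsilon> x)\<^sup>2 * frac_kernel s (x, y))" if "x \<in> H" "y \<in> ?P" for x y
  proof -
    have xy: "(x - x0) \<bullet> e \<ge> l" "(y - x0) \<bullet> e \<ge> l" and "w y \<ge> 0" using that by (auto simp: H_def)
    have "?v x = deficit \<epsilon> x" using R_H[OF that(1)] by (simp add: deficit_def)
    moreover have "?S (x, y) \<le> - ((?v x)\<^sup>2 * frac_kernel s (x, y))"
      unfolding sym_density_odd[of w ?v, OF w_R odd]
      by (rule negative_part_symmetrized_le(2)[OF \<epsilon> _ _ K[OF xy] deficit_upper[OF xy(1)] deficit_upper[OF xy(2)] \<open>w y \<ge> 0\<close>]) simp_all
    ultimately show ?thesis by simp
  qed
  have S_int: "integrable lborel ?S"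
    by (intro sym_density_integrable finite_energy_w finite_energy_diff finite_energy_R fin)
  have "(\<integral>\<^sup>+x. ennreal ((deficit \<epsilon> x)\<^sup>2) * gain x \<partial>lborel)
      = (\<integral>\<^sup>+x. \<integral>\<^sup>+y. ennreal ((deficit \<epsilon> x)\<^sup>2) * (indicator ?P y * ennreal (frac_kernel s (x, y))) \<partial>lborel \<partial>lborel)"
    unfolding gain_def by (subst nn_integral_cmult) auto
  also have "\<dots> = (\<integral>\<^sup>+z. ennreal ((deficit \<epsilon> (fst z))\<^sup>2) * (indicator ?P (snd z) * ennreal (frac_kernel s z)) \<partial>lborel)"
    by (subst nn_integral_lborel_pair) auto
  also have "\<dots> \<le> (\<integral>\<^sup>+z. ennreal (- ?S z) \<partial>lborel)"
  proof (rule nn_integral_mono)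
    fix z :: "'a \<times> 'a"
    obtain x y where z: "z = (x, y)" by (cases z)
    show "ennreal ((deficit \<epsilon> (fst z))\<^sup>2) * (indicator ?P (snd z) * ennreal (frac_kernel s z)) \<le> ennreal (- ?S z)"
    proof (cases "x \<in> H \<and> y \<in> ?P")
      case True
      then have "(deficit \<epsilon> x)\<^sup>2 * frac_kernel s (x, y) \<le> - ?S (x, y)" using S_le[of x y] by simp
      then show ?thesis using True by (simp add: z ennreal_leI flip: ennreal_mult)
    next
      case False
      then have "deficit \<epsilon> x = 0 \<or> y \<notin> ?P" by (auto simp: deficit_def)
      then show ?thesis by (auto simp: z)
    qed
  qed
  also have "\<dots> = ennreal (- (\<integral>z. ?S z \<partial>lborel))"
    using S_int S_le_0 by (subst nn_integral_eq_integral) auto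
  also have "- (\<integral>z. ?S z \<partial>lborel) = 8 / c * (\<integral>x. - ((f (u (R x)) - f (u x)) * deficit \<epsilon> x) \<partial>lborel)"
    using integral_sym_density_test[OF deficit_regular(1)[OF \<epsilon>] deficit_zero[OF \<epsilon>] compact_deficit_support[OF \<epsilon>] deficit_support_subset[OF \<epsilon>] fin]
    by simp
  also have "\<dots> \<le> 8 / c * (\<integral>x. L * (indicator reaction_set x * ((deficit \<epsilon> x + \<epsilon>) * deficit \<epsilon> x)) \<partial>lborel)"
  proof (intro mult_left_mono integral_mono)
    fix x
    show "- ((f (u (R x)) - f (u x)) * deficit \<epsilon> x) \<le> L * (indicator reaction_set x * ((deficit \<epsilon> x + \<epsilon>) * deficit \<epsilon> x))"
    proof (cases "deficit \<epsilon> x > 0")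
      case False
      then show ?thesis using deficit_nonneg[of \<epsilon> x] by (simp add: less_eq_real_def)
    next
      case True
      note pos = deficit_pos[OF True]
      have d: "u x - u (R x) = deficit \<epsilon> x + \<epsilon>" using pos by (simp add: w_def)
      show ?thesis
      proof (cases "u x \<le> t0")
        case u_le_t0: True
        have "f (u x) \<le> f (u (R x))" using f_anti[OF u_nonneg[of "R x"] _ u_le_t0] d True \<epsilon> by simp
        then have "- ((f (u (R x)) - f (u x)) * deficit \<epsilon> x) \<le> 0" using True by simp
        also have "0 \<le> L * (indicator reaction_set x * ((deficit \<epsilon> x + \<epsilon>) * deficit \<epsilon> x))"
          using True \<epsilon> L(1) by (intro mult_nonneg_nonneg) auto
        finally show ?thesis .
      next
        case False
        then have "x \<in> reaction_set" using pos True \<epsilon> by (simp add: reaction_set_def)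
        have "f (u x) - f (u (R x)) \<le> L * (deficit \<epsilon> x + \<epsilon>)"
          using L(2)[of "u x" "u (R x)"] u_nonneg u_le d True \<epsilon> by (simp add: abs_le_iff)
        then have "(f (u x) - f (u (R x))) * deficit \<epsilon> x \<le> L * (deficit \<epsilon> x + \<epsilon>) * deficit \<epsilon> x"
          by (rule mult_right_mono) (use True in simp)
        then show ?thesis using \<open>x \<in> reaction_set\<close> by (simp add: algebra_simps)
      qed
    qed
  qed (use c integrable_deficit_products[OF \<epsilon>] in \<open>auto intro!: integrable_mult_right simp del: mult_minus_left\<close>)
  also have "\<dots> = 8 * L / c * (\<integral>x. indicator reaction_set x * ((deficit \<epsilon> x + \<epsilon>) * deficit \<epsilon> x) \<partial>lborel)" by simp
  finally show ?thesis by (simp add: ennreal_leI)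
qed

lemma emeasure_reaction_set_finite: "emeasure lborel reaction_set < \<infinity>"
proof -
  obtain r where r: "\<And>x. u x \<ge> t0 \<Longrightarrow> norm (x - x0) \<le> r" using u_small[OF t0] by blast
  have "reaction_set \<subseteq> cball x0 r"
    using r by (auto simp: reaction_set_def dist_norm norm_minus_commute less_imp_le)
  then have "emeasure lborel reaction_set \<le> emeasure lborel (cball x0 r)" by (intro emeasure_mono) auto
  also have "\<dots> < \<infinity>" by (rule emeasure_lborel_cball_finite)
  finally show ?thesis .
qed

text \<open>
  The set \<open>{w \<ge> 0}\<close> contains the nonempty open set of \<open>gain_set\<close>, and the kernel is positive off the
  diagonal.
\<close>

lemma gain_pos: "gain x \<noteq> 0"
proof
  assume "gain x = 0"
  moreover have "(\<lambda>y. indicator {y \<in> H. w y \<ge> 0} y * ennreal (frac_kernel s (x, y))) \<in> borel_measurable lborel"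
    by measurable
  ultimately have "AE y in lborel. indicator {y \<in> H. w y \<ge> 0} y * ennreal (frac_kernel s (x, y)) = 0"
    unfolding gain_def by (subst (asm) nn_integral_0_iff_AE) auto
  then have "AE y in lborel. \<not> (y \<in> H \<and> w y \<ge> 0)"
    using AE_lborel_singleton[of x]
  proof eventually_elim
    case (elim y)
    then have "frac_kernel s (x, y) > 0" by (simp add: frac_kernel_def)
    then show ?case using elim(1) by (auto simp: indicator_def split: if_splits)
  qed
  moreover obtain D m where D: "open D" "D \<noteq> {}" "m > 0" "\<And>y. y \<in> D \<Longrightarrow> y \<in> H \<and> w y \<ge> m \<and> y \<notin> \<Omega>"
    using gain_set by metis
  ultimately have "AE y in lborel. y \<notin> D" by (elim AE_mp) (use D in \<open>fastforce intro!: AE_I2\<close>)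
  then have "y \<notin> D" for y by (rule AE_lborel_imp_everywhere) (simp add: D(1))
  then show False using D(2) by auto
qed

text \<open>
  If the gain is at least twice the constant \<open>8 L / c\<close> of the energy estimate on the reaction set, the
  right-hand side of that estimate is absorbed up to a term of order \<open>\<epsilon>\<close>. The left-hand side is monotone in \<open>\<epsilon>\<close>,
  hence it vanishes for every \<open>\<epsilon>\<close>.
\<close>

lemma weak_maximum_principle:
  assumes gain_reaction_set: "\<And>x. x \<in> reaction_set \<Longrightarrow> ennreal (16 * L / c) \<le> gain x" and x: "x \<in> H"
  shows "w x \<ge> 0"
proof -
  define \<kappa> where "\<kappa> = 8 * L / c"
  have \<kappa>: "\<kappa> \<ge> 0" using L c by (simp add: \<kappa>_def)
  define \<mu> where "\<mu> = measure lborel reaction_set"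
  define I where "I \<epsilon> = (\<integral>\<^sup>+x. ennreal ((deficit \<epsilon> x)\<^sup>2) * gain x \<partial>lborel)" for \<epsilon>
  have gain_meas [measurable]: "gain \<in> borel_measurable borel"
    unfolding gain_def by measurable
  have deficit_meas [measurable]: "deficit \<epsilon> \<in> borel_measurable borel" if "\<epsilon> > 0" for \<epsilon>
    by (rule finite_energy_measurable[OF deficit_regular(2)[OF that]])
  have reaction_set_int: "integrable lborel (\<lambda>x. indicator reaction_set x * C :: real)" for C
    using emeasure_reaction_set_finite by (intro integrable_mult_left) (auto simp: integrable_indicator_iff)
  have I_le: "I \<epsilon> \<le> ennreal (2 * \<kappa> * a * \<mu> * \<epsilon>)" if \<epsilon>: "\<epsilon> > 0" for \<epsilon>
  proof -
    \<comment> \<open>\<open>2 \<kappa> J \<le> I \<epsilon> \<le> \<kappa> X\<close> and \<open>X \<le> J + O(\<epsilon>)\<close> bound \<open>J\<close>, and with it \<open>X\<close> and \<open>I \<epsilon>\<close>, by \<open>O(\<epsilon>)\<close>\<close>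
    define J where "J = (\<integral>x. indicator reaction_set x * (deficit \<epsilon> x)\<^sup>2 \<partial>lborel)"
    define X where "X = (\<integral>x. indicator reaction_set x * ((deficit \<epsilon> x + \<epsilon>) * deficit \<epsilon> x) \<partial>lborel)"
    have J: "J \<ge> 0" unfolding J_def by (intro integral_nonneg_AE) auto
    have "X \<le> (\<integral>x. indicator reaction_set x * (deficit \<epsilon> x)\<^sup>2 + indicator reaction_set x * (\<epsilon> * a) \<partial>lborel)"
      unfolding X_def
    proof (rule integral_mono)
      fix x
      have "\<epsilon> * deficit \<epsilon> x \<le> \<epsilon> * a" using deficit_le[OF \<epsilon>] \<epsilon> by simp
      then show "indicator reaction_set x * ((deficit \<epsilon> x + \<epsilon>) * deficit \<epsilon> x) \<le> indicator reaction_set x * (deficit \<epsilon> x)\<^sup>2 + indicator reaction_set x * (\<epsilon> * a)"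
        by (simp add: indicator_def power2_eq_square algebra_simps)
    qed (use integrable_deficit_products[OF \<epsilon>] reaction_set_int in auto)
    also have "\<dots> = J + \<epsilon> * a * \<mu>"
      using integrable_deficit_products[OF \<epsilon>] reaction_set_int by (simp add: J_def \<mu>_def)
    finally have X: "X \<le> J + \<epsilon> * a * \<mu>" .
    have "ennreal (2 * \<kappa> * J) = (\<integral>\<^sup>+x. ennreal (2 * \<kappa> * (indicator reaction_set x * (deficit \<epsilon> x)\<^sup>2)) \<partial>lborel)"
      using integrable_deficit_products(2)[OF \<epsilon>] \<kappa> by (subst nn_integral_eq_integral) (auto simp: J_def)
    also have "\<dots> \<le> I \<epsilon>"
      unfolding I_def
    proof (rule nn_integral_mono)
      fix x
      show "ennreal (2 * \<kappa> * (indicator reaction_set x * (deficit \<epsilon> x)\<^sup>2)) \<le> ennreal ((deficit \<epsilon> x)\<^sup>2) * gain x"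
      proof (cases "x \<in> reaction_set")
        case True
        have "ennreal (2 * \<kappa> * (indicator reaction_set x * (deficit \<epsilon> x)\<^sup>2)) = ennreal ((deficit \<epsilon> x)\<^sup>2) * ennreal (16 * L / c)"
          using True by (simp add: \<kappa>_def mult_ac flip: ennreal_mult'')
        also have "\<dots> \<le> ennreal ((deficit \<epsilon> x)\<^sup>2) * gain x" by (intro mult_left_mono gain_reaction_set True) simp
        finally show ?thesis .
      qed simp
    qed
    also have I_X: "I \<epsilon> \<le> ennreal (\<kappa> * X)"
      unfolding I_def \<kappa>_def X_def by (rule weak_maximum_energy[OF \<epsilon>])
    finally have "ennreal (2 * \<kappa> * J) \<le> ennreal (\<kappa> * X)" .
    moreover have "0 \<le> X"
      unfolding X_def using deficit_nonneg \<epsilon> by (intro integral_nonneg_AE) (auto simp: add_nonneg_nonneg)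
    ultimately have "2 * \<kappa> * J \<le> \<kappa> * X" using \<kappa> by (simp add: ennreal_le_iff)
    moreover have "\<kappa> * X \<le> \<kappa> * (J + \<epsilon> * a * \<mu>)" using X \<kappa> by (rule mult_left_mono)
    ultimately have "\<kappa> * X \<le> 2 * \<kappa> * a * \<mu> * \<epsilon>" by (simp add: algebra_simps)
    then show ?thesis using I_X by (meson ennreal_leI order_trans)
  qed
  have key: "w x \<ge> - \<epsilon>0" if \<epsilon>0: "\<epsilon>0 > 0" for \<epsilon>0
  proof -
    let ?\<epsilon> = "\<lambda>n. \<epsilon>0 / real (Suc n)"
    have bound: "I \<epsilon>0 \<le> ennreal (2 * \<kappa> * a * \<mu> * ?\<epsilon> n)" for n
    proof -
      have "?\<epsilon> n > 0" "?\<epsilon> n \<le> \<epsilon>0" using \<epsilon>0 by (auto simp: field_simps)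
      then have "deficit \<epsilon>0 x \<le> deficit (?\<epsilon> n) x" for x
        unfolding deficit_def by (cases "x \<in> H") (simp_all only: if_True if_False diff_left_mono max.mono order_refl)
      then have "I \<epsilon>0 \<le> I (?\<epsilon> n)"
        unfolding I_def by (intro nn_integral_mono mult_right_mono ennreal_leI power_mono deficit_nonneg) auto
      also have "\<dots> \<le> ennreal (2 * \<kappa> * a * \<mu> * ?\<epsilon> n)" by (rule I_le) fact
      finally show ?thesis .
    qed
    have "(\<lambda>n. 2 * \<kappa> * a * \<mu> * ?\<epsilon> n) \<longlonglongrightarrow> 2 * \<kappa> * a * \<mu> * 0"
      by (intro tendsto_mult tendsto_const LIMSEQ_Suc[OF lim_const_over_n])
    then have "(\<lambda>n. ennreal (2 * \<kappa> * a * \<mu> * ?\<epsilon> n)) \<longlonglongrightarrow> ennreal (2 * \<kappa> * a * \<mu> * 0)" by (rule tendsto_ennrealI)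
    then have "I \<epsilon>0 \<le> ennreal (2 * \<kappa> * a * \<mu> * 0)" by (rule LIMSEQ_le_const) (use bound in blast)
    then have "(\<integral>\<^sup>+x. ennreal ((deficit \<epsilon>0 x)\<^sup>2) * gain x \<partial>lborel) = 0" by (simp add: I_def)
    moreover have "(\<lambda>x. ennreal ((deficit \<epsilon>0 x)\<^sup>2) * gain x) \<in> borel_measurable lborel"
      using deficit_meas[OF \<epsilon>0] by measurable
    ultimately have "AE x in lborel. ennreal ((deficit \<epsilon>0 x)\<^sup>2) * gain x = 0"
      using nn_integral_0_iff_AE by blast
    then have "AE x in lborel. deficit \<epsilon>0 x = 0" by eventually_elim (use gain_pos in auto)
    moreover have "open {x. deficit \<epsilon>0 x \<noteq> 0}"
      using deficit_regular(1)[OF \<epsilon>0] by (intro open_Collect_neq) auto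
    ultimately have "deficit \<epsilon>0 x = 0" by (rule AE_lborel_imp_everywhere)
    then show ?thesis using x by (simp add: deficit_def max_def split: if_splits)
  qed
  show ?thesis
  proof (rule ccontr)
    assume "\<not> w x \<ge> 0"
    then show False using key[of "- w x / 2"] by simp
  qed
qed

end

section \<open>Negative set of small measure\<close>

context exterior_solution
begin

text \<open>
  Half the volume of a ball of radius \<open>r / 2\<close>; any other center gives the same value.
\<close>

definition half_volume :: "real \<Rightarrow> real" where
  "half_volume r = measure lborel (ball x0 (r / 2)) / 2"

text \<open>
  Half a ball of radius \<open>r / 2\<close>, seen from distance at most \<open>r\<close>, has kernel mass at least twice the
  constant \<open>8 L / c\<close> of the energy estimate.
\<close>

definition absorbing_radius :: "real \<Rightarrow> bool" where
  "absorbing_radius r \<longleftrightarrow>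
    0 < r \<and> r \<le> 1 \<and> 16 * L / c \<le> half_volume r / r powr (real DIM('a) + 2 * s)"

lemma half_volume_eq: "0 < r \<Longrightarrow> half_volume r = unit_ball_vol (real DIM('a)) * (r / 2) ^ DIM('a) / 2"
  by (simp add: half_volume_def content_ball)

text \<open>
  The bound scales like \<open>r^(-2s)\<close>, so a small radius makes it as large as desired.
\<close>

lemma absorbing_radius_exists: obtains r where "absorbing_radius r"
proof -
  define \<omega> where "\<omega> = unit_ball_vol (real DIM('a)) / 2 ^ DIM('a) / 2"
  have \<omega>: "\<omega> > 0" by (simp add: \<omega>_def)
  \<comment> \<open>chosen so that \<open>r^(-2s) = A\<close> and \<open>\<omega> A\<close> exceeds the target; the summand \<open>1\<close> keeps \<open>r \<le> 1\<close>\<close>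
  define A where "A = 16 * L / c / \<omega> + 1"
  have A: "A \<ge> 1" using L c \<omega> by (simp add: A_def)
  define r where "r = A powr (- 1 / (2 * s))"
  have r: "r > 0" using A by (simp add: r_def)
  have "r \<le> A powr 0" unfolding r_def using A s by (intro powr_mono) auto
  then have "r \<le> 1" using A by simp
  have "r powr (- 2 * s) = A" unfolding r_def using A s by (simp add: powr_powr)
  have "16 * L / c \<le> \<omega> * A" using \<omega> by (simp add: A_def field_simps)
  also have "\<dots> = \<omega> * r powr (- 2 * s)" using \<open>r powr (- 2 * s) = A\<close> by simp
  also have "r powr (- 2 * s) = r ^ DIM('a) / r powr (real DIM('a) + 2 * s)"
    using r by (simp add: powr_add powr_minus_divide flip: powr_realpow)
  also have "\<omega> * \<dots> = half_volume r / r powr (real DIM('a) + 2 * s)"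
    using r by (simp add: half_volume_eq \<omega>_def power_divide)
  finally show ?thesis using that[of r] r \<open>r \<le> 1\<close> by (simp add: absorbing_radius_def)
qed

end

context moving_plane
begin

definition negative_set :: "real \<Rightarrow> 'a set" where
  "negative_set r0 = {y \<in> H. w y < 0 \<and> norm (y - x0) \<le> r0 + 1}"

lemma sets_negative_set [measurable]: "negative_set r0 \<in> sets borel"
proof -
  have "negative_set r0 = H \<inter> {y \<in> space borel. w y < 0 \<and> norm (y - x0) \<le> r0 + 1}"
    by (auto simp: negative_set_def)
  then show ?thesis by simp
qed

text \<open>
  The ball of radius \<open>r / 2\<close> about \<open>x + (r / 2) e\<close> lies in \<open>H\<close> and within distance \<open>r\<close> of \<open>x\<close>. At most half of
  its volume is lost to \<open>{w < 0}\<close>, and the kernel is at least \<open>r^(-N-2s)\<close> on the rest.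
\<close>

lemma gain_lower_bound:
  assumes r: "0 < r" "r \<le> 1" and x: "x \<in> H" "norm (x - x0) \<le> r0"
    and small: "emeasure lborel (negative_set r0) \<le> ennreal (half_volume r)"
  shows "ennreal (half_volume r / r powr (real DIM('a) + 2 * s)) \<le> gain x"
proof -
  let ?N = "negative_set r0"
  define V where "V = unit_ball_vol (real DIM('a)) * (r / 2) ^ DIM('a)"
  have V: "V \<ge> 0" "half_volume r = V / 2" using r by (simp_all add: V_def half_volume_eq)
  define p where "p = real DIM('a) + 2 * s"
  have p: "p > 0" using s by (simp add: p_def add_pos_pos)
  define B where "B = ball (x + (r / 2) *\<^sub>R e) (r / 2)"
  have [measurable]: "B \<in> sets borel" by (simp add: B_def)
  have B: "y \<in> H \<and> y \<noteq> x \<and> norm (x - y) \<le> r \<and> norm (y - x0) \<le> r0 + 1" if "y \<in> B" for y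
  proof -
    define z where "z = y - (x + (r / 2) *\<^sub>R e)"
    have z: "norm z < r / 2" using that by (simp add: B_def z_def dist_norm norm_minus_commute)
    have y: "y = x + (r / 2) *\<^sub>R e + z" by (simp add: z_def)
    have "\<bar>z \<bullet> e\<bar> < r / 2" using Cauchy_Schwarz_ineq2[of z e] z norm_e by simp
    then have "(y - x0) \<bullet> e > l"
      using x(1) by (simp add: y H_def inner_diff_left inner_left_distrib)
    moreover have "y \<noteq> x"
    proof
      assume "y = x"
      then have "z = - ((r / 2) *\<^sub>R e)" using y by (simp add: add_eq_0_iff)
      then show False using z r norm_e by simp
    qed
    moreover have "norm ((r / 2) *\<^sub>R e + z) \<le> r / 2 + r / 2"
      using norm_triangle_ineq[of "(r / 2) *\<^sub>R e" z] z r norm_e by simp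
    then have "norm (y - x) \<le> r" by (simp add: y)
    moreover have "norm (y - x0) \<le> norm (y - x) + norm (x - x0)"
      using norm_triangle_ineq[of "y - x" "x - x0"] by simp
    ultimately show ?thesis using x(2) r by (simp add: H_def norm_minus_commute)
  qed
  have "ennreal (V / 2) + ennreal (V / 2) = ennreal V" using V(1) by (simp flip: ennreal_plus)
  also have "\<dots> = emeasure lborel B" using r by (simp add: B_def V_def emeasure_ball)
  also have "\<dots> \<le> emeasure lborel ((B - ?N) \<union> ?N)" by (rule emeasure_mono) auto
  also have "\<dots> \<le> emeasure lborel (B - ?N) + emeasure lborel ?N" by (rule emeasure_subadditive) auto
  also have "\<dots> \<le> emeasure lborel (B - ?N) + ennreal (V / 2)"
    using small by (intro add_left_mono) (simp add: V(2))
  finally have "ennreal (V / 2) + ennreal (V / 2) \<le> ennreal (V / 2) + emeasure lborel (B - ?N)"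
    by (simp add: add.commute)
  then have half: "ennreal (V / 2) \<le> emeasure lborel (B - ?N)"
    by (simp add: ennreal_add_left_cancel_le)
  have "ennreal (V / 2 / r powr p) = ennreal (1 / r powr p) * ennreal (V / 2)"
    using V(1) by (simp flip: ennreal_mult)
  also have "\<dots> \<le> ennreal (1 / r powr p) * emeasure lborel (B - ?N)" using half by (rule mult_left_mono) simp
  also have "\<dots> = (\<integral>\<^sup>+y. ennreal (1 / r powr p) * indicator (B - ?N) y \<partial>lborel)"
    by (rule nn_integral_cmult_indicator[symmetric]) auto
  also have "\<dots> \<le> gain x"
    unfolding gain_def
  proof (rule nn_integral_mono)
    fix y
    show "ennreal (1 / r powr p) * indicator (B - ?N) y
        \<le> indicator {y \<in> H. w y \<ge> 0} y * ennreal (frac_kernel s (x, y))"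
    proof (cases "y \<in> B - ?N")
      case True
      note y = B[of y]
      have "w y \<ge> 0" using True y by (auto simp: negative_set_def)
      have "norm (x - y) powr p \<le> r powr p" using y True p by (intro powr_mono2) auto
      then have "1 / r powr p \<le> frac_kernel s (x, y)"
        unfolding frac_kernel_def p_def[symmetric] using y True by (intro divide_left_mono mult_pos_pos) auto
      then show ?thesis using True y \<open>w y \<ge> 0\<close> by (simp add: ennreal_leI)
    qed simp
  qed
  finally show ?thesis by (simp add: V(2) p_def)
qed

lemma weak_maximum_small_measure:
  assumes r: "absorbing_radius r"
    and r0: "\<And>x. u x \<ge> t0 \<Longrightarrow> norm (x - x0) \<le> r0"
    and small: "emeasure lborel (negative_set r0) \<le> ennreal (half_volume r)"
    and x: "x \<in> H"
  shows "w x \<ge> 0"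
proof (rule weak_maximum_principle[OF _ x])
  fix x assume "x \<in> reaction_set"
  then have "x \<in> H" "norm (x - x0) \<le> r0" using r0[of x] by (auto simp: reaction_set_def)
  have "0 < r" "r \<le> 1" "16 * L / c \<le> half_volume r / r powr (real DIM('a) + 2 * s)"
    using r by (simp_all add: absorbing_radius_def)
  from gain_lower_bound[OF this(1,2) \<open>x \<in> H\<close> \<open>norm (x - x0) \<le> r0\<close> small] ennreal_leI[OF this(3)]
  show "ennreal (16 * L / c) \<le> gain x" by (rule order_trans[rotated])
qed

section \<open>Strong maximum principle\<close>

text \<open>
  Test with the truncation of \<open>\<psi> - w / \<sigma>\<close>, where \<open>\<psi>\<close> is a cutoff that is \<open>1\<close> on \<open>C\<close>. Its energy cost and
  the reaction term are both of order \<open>\<sigma>\<close>. The interaction with the set \<open>D\<close> on which \<open>w \<ge> m\<close> has the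
  opposite sign and does not decay, because the truncation equals \<open>\<psi>\<close> wherever \<open>w = 0\<close>. For \<open>\<sigma> \<rightarrow> 0\<close> the
  zero set of \<open>w\<close> in \<open>C\<close> must be null.
\<close>

lemma strong_maximum_compact:
  assumes w_nonneg: "\<And>x. x \<in> H \<Longrightarrow> w x \<ge> 0" and C: "compact C" "C \<subseteq> \<Omega>"
  shows "AE x in lborel. x \<in> C \<longrightarrow> w x \<noteq> 0"
proof -
  obtain \<psi> S where \<psi>_cont: "continuous_on UNIV \<psi>" and fin_\<psi>: "finite_energy s \<psi>"
    and \<psi>: "\<And>x. 0 \<le> \<psi> x" "\<And>x. \<psi> x \<le> 1" "\<And>x. x \<in> C \<Longrightarrow> \<psi> x = 1" "\<And>x. x \<notin> S \<Longrightarrow> \<psi> x = 0"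
    and S: "compact S" "S \<subseteq> \<Omega>"
    using finite_energy_cutoff[OF s C(1) open_\<Omega> C(2)] by metis
  obtain D m where D: "open D" "D \<noteq> {}" "m > 0" "\<And>y. y \<in> D \<Longrightarrow> y \<in> H \<and> w y \<ge> m \<and> y \<notin> \<Omega>"
    using gain_set by metis
  have [measurable]: "D \<in> sets borel" using D(1) by simp
  have [measurable]: "\<psi> \<in> borel_measurable borel" by (rule borel_measurable_continuous_onI[OF \<psi>_cont])
  have \<psi>_outside: "\<psi> x = 0" if "x \<notin> \<Omega>" for x using that \<psi>(4) S(2) by auto
  have \<psi>_lower: "\<psi> x = 0" if "x \<notin> H" for x using that by (intro \<psi>_outside) (auto simp: \<Omega>_def)
  let ?q = "\<lambda>x. \<psi> x - \<psi> (R x)"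
  let ?T = "sym_density s ?q ?q"
  have q_odd: "?q (R x) = - ?q x" for x by simp
  have q_upper: "?q x = \<psi> x" if "(x - x0) \<bullet> e \<ge> l" for x
  proof (cases "x \<in> H")
    case True
    then show ?thesis using R_H \<psi>_lower by simp
  next
    case False
    then have "R x = x" using that by (intro R_boundary) (simp add: H_def)
    then show ?thesis using \<psi>_lower[OF False] by simp
  qed
  have T_int: "integrable lborel ?T"
    by (intro sym_density_integrable finite_energy_diff finite_energy_R fin_\<psi>)
  have \<psi>_int: "integrable lborel \<psi>"
    by (rule lborel_integrable_continuous_compact_support[OF \<psi>_cont _ S(1)]) (rule \<psi>(4))
  define A where "A = (\<integral>z. ?T z \<partial>lborel) + 8 / c * (L * (\<integral>x. \<psi> x \<partial>lborel))"
  let ?K = "\<lambda>x y. frac_kernel s (x, y) - frac_kernel s (x, R y)"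
  let ?Z = "{x \<in> H. w x = 0}"
  have [measurable]: "?Z \<in> sets borel"
  proof -
    have "?Z = H \<inter> {x \<in> space borel. w x = 0}" by auto
    then show ?thesis by simp
  qed
  let ?Q = "\<lambda>z. indicator ?Z (fst z) * indicator D (snd z) * (m / 2 * \<psi> (fst z) * ?K (fst z) (snd z))"
  have Q_le: "(\<integral>\<^sup>+z. ennreal (?Q z) \<partial>lborel) \<le> ennreal (\<sigma> * A)" if \<sigma>: "0 < \<sigma>" "\<sigma> \<le> m / 2" for \<sigma>
  proof -
    define v where "v x = max 0 (\<psi> x - \<bar>w x\<bar> / \<sigma>)" for x
    have v_cont: "continuous_on UNIV v"
      unfolding v_def using \<sigma> by (intro continuous_intros \<psi>_cont w_cont) auto
    have v_zero: "v x = 0" if "\<psi> x = 0" for x using that \<sigma> by (simp add: v_def)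
    have v_bounds: "0 \<le> v x" "v x \<le> \<psi> x" for x using \<psi>(1) \<sigma> by (auto simp: v_def)
    have fin: "finite_energy s v"
    proof (rule finite_energy_dominated[OF _ fin_\<psi> finite_energy_w])
      show "v \<in> borel_measurable borel" by (rule borel_measurable_continuous_onI[OF v_cont])
      fix x y
      have "\<bar>max 0 (p - \<bar>q\<bar>) - max 0 (p' - \<bar>q'\<bar>)\<bar> \<le> \<bar>p - p'\<bar> + \<bar>q - q'\<bar>" for p p' q q' :: real
        by (simp add: max_def abs_if)
      from this[of "\<psi> x" "w x / \<sigma>" "\<psi> y" "w y / \<sigma>"]
      have "\<bar>v x - v y\<bar> \<le> \<bar>\<psi> x - \<psi> y\<bar> + \<bar>w x / \<sigma> - w y / \<sigma>\<bar>"
        using \<sigma> by (simp add: v_def)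
      also have "\<bar>w x / \<sigma> - w y / \<sigma>\<bar> = 1 / \<sigma> * \<bar>w x - w y\<bar>"
        using \<sigma> by (simp add: abs_divide flip: diff_divide_distrib)
      finally show "\<bar>v x - v y\<bar> \<le> 1 * \<bar>\<psi> x - \<psi> y\<bar> + 1 / \<sigma> * \<bar>w x - w y\<bar>" by simp
    qed
    let ?v = "\<lambda>x. v x - v (R x)"
    let ?S = "sym_density s w ?v"
    have v_odd: "?v (R x) = - ?v x" for x by simp
    have v_upper: "?v x = max 0 (?q x - w x / \<sigma>)" if "(x - x0) \<bullet> e \<ge> l" for x
    proof (cases "x \<in> H")
      case True
      then have "v (R x) = 0" using R_H \<psi>_lower v_zero by simp
      then show ?thesis using q_upper[OF that] w_nonneg[OF True] by (simp add: v_def)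
    next
      case False
      then have bd: "(x - x0) \<bullet> e = l" using that by (simp add: H_def)
      then show ?thesis using q_upper[OF that] \<psi>_lower[OF False] w_boundary[OF bd] R_boundary[OF bd] by simp
    qed
    have w_upper: "w x \<ge> 0" if "(x - x0) \<bullet> e \<ge> l" for x
      using that w_nonneg[of x] w_boundary[of x] by (cases "(x - x0) \<bullet> e = l") (auto simp: H_def)
    have q_nonneg: "?q x \<ge> 0" if "(x - x0) \<bullet> e \<ge> l" for x
      using q_upper[OF that] \<psi>(1)[of x] by simp
    have K: "frac_kernel s (x, R y) \<le> frac_kernel s (x, y) \<or> w x = w y \<and> ?q x = ?q y"
      if "(x - x0) \<bullet> e \<ge> l" "(y - x0) \<bullet> e \<ge> l" for x y
      using frac_kernel_R_le[OF s(1) that] by (cases "x = y") auto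
    have S_le: "?S (x, y) \<le> \<sigma> * ?T (x, y)" for x y
    proof (rule reflect_wlog)
      show "?S (R x, y) \<le> \<sigma> * ?T (R x, y) \<longleftrightarrow> ?S (x, y) \<le> \<sigma> * ?T (x, y)"
        "?S (x, R y) \<le> \<sigma> * ?T (x, R y) \<longleftrightarrow> ?S (x, y) \<le> \<sigma> * ?T (x, y)" for x y
        using sym_density_R[of w ?v, OF w_R v_odd] sym_density_R[of ?q ?q, OF q_odd q_odd] by simp_all
      fix x y assume xy: "(x - x0) \<bullet> e \<ge> l" "(y - x0) \<bullet> e \<ge> l"
      show "?S (x, y) \<le> \<sigma> * ?T (x, y)"
        unfolding sym_density_odd[of w ?v, OF w_R v_odd] sym_density_odd[of ?q ?q, OF q_odd q_odd]
        by (rule truncation_symmetrized_le(1)[OF \<sigma>(1) _ _ K[OF xy] w_upper[OF xy(1)] w_upper[OF xy(2)]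
              q_nonneg[OF xy(1)] q_nonneg[OF xy(2)] v_upper[OF xy(1)] v_upper[OF xy(2)]]) simp_all
    qed
    have S_le_gain: "?S (x, y) \<le> \<sigma> * ?T (x, y) - m / 2 * v x * ?K x y" if "x \<in> H" "y \<in> D" for x y
    proof (cases "x = y")
      case True
      then have "v x = 0" using that D(4) \<psi>_outside v_zero by blast
      then show ?thesis using S_le[of x y] by simp
    next
      case False
      have y: "y \<in> H" "w y \<ge> m" "y \<notin> \<Omega>" using D(4)[OF that(2)] by auto
      have xy: "(x - x0) \<bullet> e \<ge> l" "(y - x0) \<bullet> e \<ge> l" using that(1) y(1) by (auto simp: H_def)
      have "?v x = v x" using R_H[OF that(1)] \<psi>_lower v_zero by simp
      moreover have "\<sigma> * ?q x \<le> m / 2"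
        using q_upper[OF xy(1)] \<psi>(1,2)[of x] \<sigma> mult_mono[of \<sigma> "m / 2" "\<psi> x" 1] by simp
      moreover have "?q y = 0" using q_upper[OF xy(2)] \<psi>_outside[OF y(3)] by simp
      ultimately show ?thesis
        unfolding sym_density_odd[of w ?v, OF w_R v_odd] sym_density_odd[of ?q ?q, OF q_odd q_odd]
        using truncation_symmetrized_le(2)[OF \<sigma>(1) _ _ K[OF xy] w_upper[OF xy(1)] w_upper[OF xy(2)]
              q_nonneg[OF xy(1)] q_nonneg[OF xy(2)] v_upper[OF xy(1)] v_upper[OF xy(2)], of m]
          y(2) D(3) frac_kernel_R_le[OF s(1) xy False]
        by simp
    qed
    have S_int: "integrable lborel ?S"
      by (intro sym_density_integrable finite_energy_w finite_energy_diff finite_energy_R fin)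
    have "(\<integral>\<^sup>+z. ennreal (?Q z) \<partial>lborel) \<le> (\<integral>\<^sup>+z. ennreal (\<sigma> * ?T z - ?S z) \<partial>lborel)"
    proof (intro nn_integral_mono ennreal_leI)
      fix z :: "'a \<times> 'a"
      obtain x y where z: "z = (x, y)" by (cases z)
      show "?Q z \<le> \<sigma> * ?T z - ?S z"
      proof (cases "x \<in> ?Z \<and> y \<in> D")
        case True
        then have "v x = \<psi> x" using \<psi>(1)[of x] by (simp add: v_def)
        then show ?thesis using S_le_gain[of x y] True by (simp add: z)
      next
        case False
        then show ?thesis using S_le[of x y] by (auto simp: z)
      qed
    qed
    also have "\<dots> = ennreal (\<integral>z. \<sigma> * ?T z - ?S z \<partial>lborel)"
      using S_int T_int S_le by (intro nn_integral_eq_integral) auto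
    also have "(\<integral>z. \<sigma> * ?T z - ?S z \<partial>lborel) = \<sigma> * (\<integral>z. ?T z \<partial>lborel) - (\<integral>z. ?S z \<partial>lborel)"
      using S_int T_int by simp
    also have "- (\<integral>z. ?S z \<partial>lborel) = 8 / c * (\<integral>x. - ((f (u (R x)) - f (u x)) * v x) \<partial>lborel)"
      using integral_sym_density_test[OF v_cont _ S fin] v_zero \<psi>(4) by simp
    then have "\<sigma> * (\<integral>z. ?T z \<partial>lborel) - (\<integral>z. ?S z \<partial>lborel)
        = \<sigma> * (\<integral>z. ?T z \<partial>lborel) + 8 / c * (\<integral>x. - ((f (u (R x)) - f (u x)) * v x) \<partial>lborel)" by linarith
    also have "(\<integral>x. - ((f (u (R x)) - f (u x)) * v x) \<partial>lborel) \<le> (\<integral>x. \<sigma> * (L * \<psi> x) \<partial>lborel)"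
    proof (rule integral_mono)
      show "integrable lborel (\<lambda>x. - ((f (u (R x)) - f (u x)) * v x))"
      proof (rule lborel_integrable_continuous_compact_support[OF _ _ S(1)])
        show "continuous_on UNIV (\<lambda>x. - ((f (u (R x)) - f (u x)) * v x))"
          by (intro continuous_intros v_cont continuous_f_u continuous_on_compose2[OF continuous_f_u continuous_R]) auto
        show "- ((f (u (R x)) - f (u x)) * v x) = 0" if "x \<notin> S" for x
          using v_zero[OF \<psi>(4)[OF that]] by simp
      qed
      fix x
      have "\<bar>f (u (R x)) - f (u x)\<bar> \<le> L * \<bar>w x\<bar>"
        using L(2)[of "u (R x)" "u x"] u_nonneg u_le by (simp add: w_def)
      then have "\<bar>f (u (R x)) - f (u x)\<bar> * v x \<le> L * \<bar>w x\<bar> * v x" by (rule mult_right_mono) (rule v_bounds)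
      also have "\<dots> \<le> L * (\<sigma> * \<psi> x)"
      proof -
        have "\<bar>w x\<bar> * v x \<le> \<sigma> * \<psi> x"
        proof (cases "v x > 0")
          case True
          then have "\<bar>w x\<bar> \<le> \<sigma> * \<psi> x" using \<sigma> by (auto simp: v_def field_simps max_def split: if_splits)
          moreover have "v x \<le> 1" using v_bounds(2)[of x] \<psi>(2)[of x] by simp
          ultimately show ?thesis using mult_mono[of "\<bar>w x\<bar>" "\<sigma> * \<psi> x" "v x" 1] v_bounds(1)[of x] \<sigma> \<psi>(1)[of x] by simp
        next
          case False
          then have "v x = 0" using v_bounds(1)[of x] by linarith
          then show ?thesis using \<sigma> \<psi>(1)[of x] by simp
        qed
        from mult_left_mono[OF this L(1)] show ?thesis by (simp add: mult.assoc)
      qed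
      finally have "\<bar>f (u (R x)) - f (u x)\<bar> * v x \<le> \<sigma> * (L * \<psi> x)" by (simp add: mult_ac)
      moreover have "- ((f (u (R x)) - f (u x)) * v x) \<le> \<bar>(f (u (R x)) - f (u x)) * v x\<bar>"
        by (rule abs_ge_minus_self)
      moreover have "\<bar>(f (u (R x)) - f (u x)) * v x\<bar> = \<bar>f (u (R x)) - f (u x)\<bar> * v x"
        using v_bounds(1)[of x] by (simp add: abs_mult)
      ultimately show "- ((f (u (R x)) - f (u x)) * v x) \<le> \<sigma> * (L * \<psi> x)" by linarith
    qed (use \<psi>_int in auto)
    then have "\<sigma> * (\<integral>z. ?T z \<partial>lborel) + 8 / c * (\<integral>x. - ((f (u (R x)) - f (u x)) * v x) \<partial>lborel)
        \<le> \<sigma> * (\<integral>z. ?T z \<partial>lborel) + 8 / c * (\<integral>x. \<sigma> * (L * \<psi> x) \<partial>lborel)"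
      using c by (intro add_left_mono mult_left_mono) auto
    also have "\<dots> = \<sigma> * A" by (simp add: A_def algebra_simps)
    finally show ?thesis by (simp add: ennreal_leI)
  qed
  have "(\<integral>\<^sup>+z. ennreal (?Q z) \<partial>lborel) \<le> ennreal (m / 2 * 0 * A)"
  proof (rule LIMSEQ_le_const)
    have "(\<lambda>n. m / 2 / real (Suc n)) \<longlonglongrightarrow> m / 2 * 0"
      using tendsto_mult[OF tendsto_const[of "m / 2"] LIMSEQ_inverse_real_of_nat] by (simp add: field_simps)
    then show "(\<lambda>n. ennreal (m / 2 / real (Suc n) * A)) \<longlonglongrightarrow> ennreal (m / 2 * 0 * A)"
      by (intro tendsto_ennrealI tendsto_mult tendsto_const)
    have "m / 2 / real (Suc n) \<le> m / 2" for n using D(3) by (simp add: field_simps)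
    then show "\<exists>N. \<forall>n\<ge>N. (\<integral>\<^sup>+z. ennreal (?Q z) \<partial>lborel) \<le> ennreal (m / 2 / real (Suc n) * A)"
      using D(3) by (intro exI allI impI Q_le) auto
  qed
  then have "(\<integral>\<^sup>+z. ennreal (?Q z) \<partial>lborel) = 0" by simp
  then have "(\<integral>\<^sup>+x. \<integral>\<^sup>+y. ennreal (?Q (x, y)) \<partial>lborel \<partial>lborel) = 0"
    by (subst (asm) nn_integral_lborel_pair) auto
  then have "AE x in lborel. (\<integral>\<^sup>+y. ennreal (?Q (x, y)) \<partial>lborel) = 0"
    by (subst (asm) nn_integral_0_iff_AE) auto
  then show ?thesis
  proof eventually_elim
    case (elim x)
    show ?case
    proof (intro impI notI)
      assume x: "x \<in> C" "w x = 0"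
      then have "x \<in> \<Omega>" "x \<in> H" "\<psi> x = 1" using C(2) \<psi>(3) by (auto simp: \<Omega>_def)
      have "AE y in lborel. ennreal (?Q (x, y)) = 0"
        using elim by (subst (asm) nn_integral_0_iff_AE) auto
      then have "AE y in lborel. y \<notin> D"
      proof eventually_elim
        case (elim y)
        show ?case
        proof
          assume y: "y \<in> D"
          have "?K x y > 0"
            using frac_kernel_R_less[OF s(1) \<open>x \<in> H\<close>, of y] D(4)[OF y] \<open>x \<in> \<Omega>\<close> by auto
          then have "m / 2 * 1 * ?K x y > 0" using D(3) by simp
          then show False using elim y x(2) \<open>x \<in> H\<close> \<open>\<psi> x = 1\<close> by (simp add: ennreal_eq_0_iff)
        qed
      qed
      then have "y \<notin> D" for y by (rule AE_lborel_imp_everywhere) (simp add: D(1))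
      then show False using D(2) by auto
    qed
  qed
qed

lemma strong_maximum_principle:
  assumes "\<And>x. x \<in> H \<Longrightarrow> w x \<ge> 0"
  shows "AE x in lborel. x \<in> \<Omega> \<longrightarrow> w x > 0"
proof -
  obtain C where C: "\<And>n::nat. compact (C n)" "\<And>n. C n \<subseteq> \<Omega>" "\<Union>(range C) = \<Omega>"
    using open_Union_compact_subsets[OF open_\<Omega>] by metis
  have "AE x in lborel. \<forall>n. x \<in> C n \<longrightarrow> w x \<noteq> 0"
    unfolding AE_all_countable using strong_maximum_compact[OF assms C(1,2)] by simp
  then show ?thesis
  proof eventually_elim
    case (elim x)
    show ?case
    proof
      assume "x \<in> \<Omega>"
      then obtain n where "x \<in> C n" using C(3) by blast
      then show "w x > 0" using elim assms[of x] \<open>x \<in> \<Omega>\<close> by (force simp: \<Omega>_def)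
    qed
  qed
qed

end

section \<open>Moving the planes\<close>

context exterior_solution
begin

text \<open>
  The reflection as a function of the position \<open>l\<close> of the plane, for comparing different planes.
\<close>

definition plane_reflection :: "'a \<Rightarrow> real \<Rightarrow> 'a \<Rightarrow> 'a" where
  "plane_reflection e l x = x + (2 * (l - (x - x0) \<bullet> e)) *\<^sub>R e"

definition ordered_across :: "'a \<Rightarrow> real \<Rightarrow> bool" where
  "ordered_across e l \<longleftrightarrow> (\<forall>x. (x - x0) \<bullet> e > l \<longrightarrow> u x \<le> u (plane_reflection e l x))"

lemma moving_planeI: "norm e = 1 \<Longrightarrow> 0 < l \<Longrightarrow> moving_plane s c a \<rho> t0 L f u x0 e l"
  by unfold_locales

lemma tendsto_plane_reflection:
  "(k \<longlongrightarrow> l) F \<Longrightarrow> ((\<lambda>n. u (plane_reflection e (k n) x)) \<longlongrightarrow> u (plane_reflection e l x)) F"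
  unfolding plane_reflection_def
  by (intro continuous_on_tendsto_compose[OF u_cont] tendsto_intros) auto

lemma ordered_across_small_measure:
  assumes e: "norm e = 1" and l: "0 < l"
    and r: "absorbing_radius r"
    and r0: "\<And>x. u x \<ge> t0 \<Longrightarrow> norm (x - x0) \<le> r0"
    and small: "emeasure lborel {y. (y - x0) \<bullet> e > l \<and> u (plane_reflection e l y) < u y \<and> norm (y - x0) \<le> r0 + 1}
      \<le> ennreal (half_volume r)"
  shows "ordered_across e l"
proof -
  interpret moving_plane s c a \<rho> t0 L f u x0 e l by (rule moving_planeI[OF e l])
  have R: "R = plane_reflection e l" by (simp add: fun_eq_iff R_def plane_reflection_def)
  have "negative_set r0
      = {y. (y - x0) \<bullet> e > l \<and> u (plane_reflection e l y) < u y \<and> norm (y - x0) \<le> r0 + 1}"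
    by (auto simp: negative_set_def w_def H_def R)
  then have "w x \<ge> 0" if "x \<in> H" for x
    using weak_maximum_small_measure[OF r r0 _ that] small by simp
  then show ?thesis by (auto simp: ordered_across_def w_def H_def R)
qed

lemma ordered_across_far:
  assumes e: "norm e = 1"
  obtains l where "0 < l" "ordered_across e l"
proof -
  obtain r where r: "absorbing_radius r" by (rule absorbing_radius_exists)
  obtain r0 where r0: "r0 > 0" "\<And>x. u x \<ge> t0 \<Longrightarrow> norm (x - x0) \<le> r0" using u_small[OF t0] by blast
  have "\<not> ((y - x0) \<bullet> e > r0 + 1 \<and> norm (y - x0) \<le> r0 + 1)" for y
    using norm_cauchy_schwarz[of "y - x0" e] e by simp
  then have empty: "{y. (y - x0) \<bullet> e > r0 + 1 \<and> u (plane_reflection e (r0 + 1) y) < u y \<and> norm (y - x0) \<le> r0 + 1} = {}"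
    by blast
  have "ordered_across e (r0 + 1)"
    by (rule ordered_across_small_measure[OF e _ r r0(2)]) (use r0(1) in \<open>simp_all add: empty\<close>)
  then show ?thesis using that[of "r0 + 1"] r0(1) by simp
qed

lemma ordered_across_limit:
  assumes "\<And>n::nat. ordered_across e (k n)" "k \<longlonglongrightarrow> l"
  shows "ordered_across e l"
  unfolding ordered_across_def
proof (intro allI impI)
  fix x assume "(x - x0) \<bullet> e > l"
  then have "\<forall>\<^sub>F n in sequentially. k n < (x - x0) \<bullet> e" using assms(2) by (rule order_tendstoD(2)[rotated])
  then have "\<forall>\<^sub>F n in sequentially. u x \<le> u (plane_reflection e (k n) x)"
    by eventually_elim (use assms(1) in \<open>auto simp: ordered_across_def\<close>)
  then show "u x \<le> u (plane_reflection e l x)"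
    by (rule tendsto_lowerbound[OF tendsto_plane_reflection[OF assms(2)]]) simp
qed

lemma AE_not_on_plane:
  assumes "norm e = 1" shows "AE y in lborel. (y - x0) \<bullet> e \<noteq> l"
proof -
  have "{y. (y - x0) \<bullet> e = l} = {y. e \<bullet> y = l + x0 \<bullet> e}"
    by (auto simp: inner_diff_left inner_commute algebra_simps)
  moreover have "negligible {y. e \<bullet> y = l + x0 \<bullet> e}" using assms by (intro negligible_hyperplane) auto
  moreover have "{y. e \<bullet> y = l + x0 \<bullet> e} \<in> sets lborel"
    by (simp add: borel_closed closed_hyperplane)
  ultimately have "{y. (y - x0) \<bullet> e = l} \<in> null_sets lborel"
    by (simp add: negligible_iff_null_sets null_sets_completion_iff)
  then show ?thesis by (intro AE_I'[where N="{y. (y - x0) \<bullet> e = l}"]) auto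
qed

text \<open>
  Almost every point leaves \<open>{w < 0}\<close> as the plane approaches the good position \<open>l\<close>: points strictly on
  the near side leave the half-space, points of the ball never belong to the set, and at almost all
  others \<open>w > 0\<close> at the limit, by the strong principle in \<open>\<Omega>\<close>. By dominated convergence the
  measure of the set in the fixed ball tends to \<open>0\<close>, and the weak principle applies.
\<close>

lemma ordered_across_eventually:
  assumes e: "norm e = 1" and l: "0 < l" and ord: "ordered_across e l" and k: "k \<longlonglongrightarrow> l"
  shows "\<forall>\<^sub>F n::nat in sequentially. 0 < k n \<and> ordered_across e (k n)"
proof -
  obtain r where r: "absorbing_radius r" by (rule absorbing_radius_exists)
  obtain r0 where r0: "r0 > 0" "\<And>x. u x \<ge> t0 \<Longrightarrow> norm (x - x0) \<le> r0" using u_small[OF t0] by blast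
  define N where "N n = {y. (y - x0) \<bullet> e > k n \<and> u (plane_reflection e (k n) y) < u y \<and> norm (y - x0) \<le> r0 + 1}" for n
  have N_meas [measurable]: "N n \<in> sets borel" for n
  proof -
    have "continuous_on UNIV (\<lambda>y. u (plane_reflection e (k n) y))"
      unfolding plane_reflection_def
      by (intro continuous_on_compose2[OF u_cont] continuous_intros) auto
    then have "(\<lambda>y. u (plane_reflection e (k n) y)) \<in> borel_measurable borel"
      by (rule borel_measurable_continuous_onI)
    moreover have "N n = {y \<in> space borel. (y - x0) \<bullet> e > k n \<and> u (plane_reflection e (k n) y) < u y \<and> norm (y - x0) \<le> r0 + 1}"
      by (simp add: N_def)
    ultimately show ?thesis by simp
  qed
  have k_pos: "\<forall>\<^sub>F n in sequentially. 0 < k n" using order_tendstoD(1)[OF k l] .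
  interpret moving_plane s c a \<rho> t0 L f u x0 e l by (rule moving_planeI[OF e l])
  have R: "R = plane_reflection e l" by (simp add: fun_eq_iff R_def plane_reflection_def)
  have "w x \<ge> 0" if "x \<in> H" for x using ord that by (simp add: ordered_across_def w_def H_def R)
  then have strong: "AE y in lborel. y \<in> \<Omega> \<longrightarrow> w y > 0" by (rule strong_maximum_principle)
  have "AE y in lborel. (\<lambda>n. indicator (N n) y :: ennreal) \<longlonglongrightarrow> 0"
    using strong AE_not_on_plane[OF e, of l]
  proof eventually_elim
    case (elim y)
    have "\<forall>\<^sub>F n in sequentially. y \<notin> N n"
    proof (cases "(y - x0) \<bullet> e < l")
      case True
      from order_tendstoD(1)[OF k this] show ?thesis by eventually_elim (simp add: N_def)
    next
      case False
      then have "y \<in> H" using elim(2) by (simp add: H_def)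
      show ?thesis
      proof (cases "y \<in> cball x0 \<rho>")
        case True
        show ?thesis
          using k_pos
        proof eventually_elim
          case (elim n)
          interpret n: moving_plane s c a \<rho> t0 L f u x0 e "k n" by (rule moving_planeI[OF e elim])
          have "n.R = plane_reflection e (k n)" by (simp add: fun_eq_iff n.R_def plane_reflection_def)
          then show ?case
            using n.w_neg_imp_\<Omega>[of y] True by (auto simp: N_def n.w_def n.\<Omega>_def)
        qed
      next
        case outside: False
        have "u y < u (plane_reflection e l y)"
        proof (cases "R y \<in> cball x0 \<rho>")
          case True
          then show ?thesis using u_ball u_less[OF outside] by (simp add: R)
        next
          case False
          then have "w y > 0" using elim(1) \<open>y \<in> H\<close> outside by (simp add: \<Omega>_def)
          then show ?thesis by (simp add: w_def R)
        qed
        from order_tendstoD(1)[OF tendsto_plane_reflection[OF k] this]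
        show ?thesis by eventually_elim (simp add: N_def)
      qed
    qed
    then have "\<forall>\<^sub>F n in sequentially. (indicator (N n) y :: ennreal) = 0" by eventually_elim simp
    then show ?case by (rule tendsto_eventually)
  qed
  then have "(\<lambda>n. \<integral>\<^sup>+y. indicator (N n) y \<partial>lborel) \<longlonglongrightarrow> (\<integral>\<^sup>+y. 0 \<partial>(lborel :: 'a measure))"
  proof (rule nn_integral_dominated_convergence[where w="indicator (cball x0 (r0 + 1))", rotated 5])
    have "emeasure lborel (cball x0 (r0 + 1)) < \<infinity>" by (rule emeasure_lborel_cball_finite)
    then show "(\<integral>\<^sup>+y. indicator (cball x0 (r0 + 1)) y \<partial>lborel) < \<infinity>" by simp
    show "AE y in lborel. indicator (N n) y \<le> (indicator (cball x0 (r0 + 1)) y :: ennreal)" for n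
      by (rule AE_I2) (auto simp: N_def indicator_def dist_norm norm_minus_commute)
  qed (auto intro!: borel_measurable_indicator)
  then have lim: "(\<lambda>n. emeasure lborel (N n)) \<longlonglongrightarrow> 0" by simp
  have "0 < half_volume r" using r by (simp add: absorbing_radius_def half_volume_eq)
  then have "\<forall>\<^sub>F n in sequentially. emeasure lborel (N n) < ennreal (half_volume r)"
    by (intro order_tendstoD(2)[OF lim]) simp
  then show ?thesis
    using k_pos
  proof eventually_elim
    case (elim n)
    have "ordered_across e (k n)"
      by (rule ordered_across_small_measure[OF e elim(2) r r0(2)])
        (use elim(1) in \<open>auto simp: N_def intro: less_imp_le\<close>)
    then show ?case using elim(2) by simp
  qed
qed

lemma ordered_across_all:
  assumes e: "norm e = 1" and l: "0 < l"
  shows "ordered_across e l"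
proof -
  define S where "S = {l. 0 < l \<and> ordered_across e l}"
  have "closedin (top_of_set {0<..}) S"
  proof (rule closedin_closed[THEN iffD2], intro exI conjI)
    show "S = {0<..} \<inter> closure S"
    proof
      show "S \<subseteq> {0<..} \<inter> closure S" using closure_subset[of S] unfolding S_def by blast
      show "{0<..} \<inter> closure S \<subseteq> S"
      proof
        fix l assume l: "l \<in> {0<..} \<inter> closure S"
        then have "l \<in> closure S" by simp
        then obtain k where "\<And>n. k n \<in> S" "k \<longlonglongrightarrow> l" unfolding closure_sequential by blast
        have "ordered_across e l"
          by (rule ordered_across_limit[OF _ \<open>k \<longlonglongrightarrow> l\<close>]) (use \<open>\<And>n. k n \<in> S\<close> in \<open>simp add: S_def\<close>)
        then show "l \<in> S" using l by (simp add: S_def)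
      qed
    qed
  qed simp
  moreover have "open S"
    unfolding open_dist
  proof (rule ballI, rule ccontr)
    fix l assume l: "l \<in> S" and "\<not> (\<exists>d>0. \<forall>y. dist y l < d \<longrightarrow> y \<in> S)"
    then have not_open: "\<exists>y. dist y l < d \<and> y \<notin> S" if "d > 0" for d using that by blast
    have "\<exists>y. dist y l < inverse (real (Suc n)) \<and> y \<notin> S" for n by (rule not_open) simp
    then obtain k where k: "\<And>n. dist (k n) l < inverse (real (Suc n))" "\<And>n. k n \<notin> S" by metis
    have "\<forall>\<^sub>F n in sequentially. norm (dist (k n) l) \<le> inverse (real (Suc n))"
      using k(1) by (intro always_eventually allI) (simp add: less_imp_le)
    then have "(\<lambda>n. dist (k n) l) \<longlonglongrightarrow> 0"
      by (rule Lim_null_comparison) (rule LIMSEQ_inverse_real_of_nat)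
    then have "k \<longlonglongrightarrow> l" by (rule tendsto_dist_iff[THEN iffD2])
    have "\<forall>\<^sub>F n in sequentially. 0 < k n \<and> ordered_across e (k n)"
      by (rule ordered_across_eventually[OF e _ _ \<open>k \<longlonglongrightarrow> l\<close>]) (use l in \<open>simp_all add: S_def\<close>)
    then have "\<forall>\<^sub>F n in sequentially. False"
      by eventually_elim (use k(2) in \<open>auto simp: S_def\<close>)
    then show False by simp
  qed
  then have "openin (top_of_set {0<..}) S" by (intro open_subset) (auto simp: S_def)
  moreover have "connected {0::real<..}" by (simp add: convex_connected)
  ultimately have "S = {} \<or> S = {0<..}" unfolding connected_clopen by (elim allE[of _ S] impE) simp_all
  moreover obtain l1 where "0 < l1" "ordered_across e l1" by (rule ordered_across_far[OF e])
  then have "l1 \<in> S" by (simp add: S_def)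
  ultimately have "l \<in> S" using l by auto
  then show ?thesis by (simp add: S_def)
qed

section \<open>Radial symmetry and monotonicity\<close>

lemma u_reflection_center:
  assumes e: "norm e = 1" and x: "(x - x0) \<bullet> e > 0"
  shows "u x \<le> u (plane_reflection e 0 x)"
proof -
  have lim: "((\<lambda>l. u (plane_reflection e l x)) \<longlongrightarrow> u (plane_reflection e 0 x)) (at_right 0)"
    by (rule tendsto_plane_reflection) (rule tendsto_ident_at)
  have "\<forall>\<^sub>F l in at_right 0. u x \<le> u (plane_reflection e l x)"
    using ordered_across_all[OF e] x
    by (intro eventually_at_rightI[of 0 "(x - x0) \<bullet> e"]) (auto simp: ordered_across_def)
  then show ?thesis by (rule tendsto_lowerbound[OF lim]) simp
qed

text \<open>
  The perpendicular bisector of two points at equal distance from \<open>x0\<close> passes through \<open>x0\<close>.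
\<close>

lemma u_radial_le:
  assumes "norm (x - x0) = norm (y - x0)" shows "u x \<le> u y"
proof (cases "x = y")
  case False
  define n where "n = norm (x - y)"
  have n: "n > 0" using False by (simp add: n_def)
  define e where "e = (x - y) /\<^sub>R n"
  have e: "norm e = 1" using n by (simp add: e_def n_def)
  have "(x - x0) \<bullet> (x - x0) = (y - x0) \<bullet> (y - x0)"
    using assms by (simp add: norm_eq_sqrt_inner)
  then have "2 * ((x - x0) \<bullet> (x - y)) = (x - y) \<bullet> (x - y)"
    by (simp add: inner_diff_left inner_diff_right inner_commute)
  then have ip: "(x - x0) \<bullet> (x - y) = n\<^sup>2 / 2" by (simp add: n_def power2_norm_eq_inner)
  have "(x - x0) \<bullet> e = ((x - x0) \<bullet> (x - y)) / n" by (simp add: e_def divide_inverse mult.commute)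
  also have "\<dots> = n / 2" unfolding ip using n by (simp add: power2_eq_square)
  finally have "(x - x0) \<bullet> e = n / 2" .
  moreover from this have "plane_reflection e 0 x = x - n *\<^sub>R e" by (simp add: plane_reflection_def)
  then have "plane_reflection e 0 x = y" using n by (simp add: e_def)
  ultimately show ?thesis using u_reflection_center[OF e, of x] n by simp
qed simp

lemma u_radial: "norm (x - x0) = norm (y - x0) \<Longrightarrow> u x = u y"
  by (intro antisym u_radial_le) auto

lemma radially_symmetric_decreasing_u: "radially_symmetric_decreasing x0 \<rho> u"
proof -
  obtain e :: 'a where "e \<in> Basis" using nonempty_Basis by blast
  then have e: "norm e = 1" by simp
  define h where "h r = u (x0 + r *\<^sub>R e)" for r
  have u_h: "u x = h (dist x x0)" for x
    unfolding h_def by (rule u_radial) (simp add: dist_norm e)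
  have h_mono: "h r2 \<le> h r1" if "0 \<le> r1" "r1 \<le> r2" for r1 r2
  proof (cases "r1 = r2")
    case False
    have height: "(x0 + r2 *\<^sub>R e - x0) \<bullet> e = r2" using e by (simp add: dot_square_norm)
    moreover have "2 * ((r1 + r2) / 2 - r2) = r1 - r2" by (simp add: field_simps)
    ultimately have "plane_reflection e ((r1 + r2) / 2) (x0 + r2 *\<^sub>R e) = x0 + r1 *\<^sub>R e"
      by (simp only: plane_reflection_def scaleR_left_diff_distrib) simp
    moreover have "ordered_across e ((r1 + r2) / 2)" by (rule ordered_across_all[OF e]) (use that False in simp)
    moreover have "(r1 + r2) / 2 < (x0 + r2 *\<^sub>R e - x0) \<bullet> e" unfolding height using that False by simp
    ultimately show ?thesis unfolding h_def ordered_across_def by metis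
  qed simp
  have "h r2 < h r1" if r: "\<rho> < r1" "r1 < r2" for r1 r2
  proof (rule ccontr)
    assume "\<not> h r2 < h r1"
    then have const: "h r = h r1" if "r1 \<le> r" "r \<le> r2" for r
      using h_mono[of r1 r] h_mono[of r r2] that r \<rho> by linarith
    define l where "l = (r1 + r2) / 2"
    have between: "0 < l" "r1 < l" "l < r2" using r \<rho> by (auto simp: l_def)
    interpret moving_plane s c a \<rho> t0 L f u x0 e l by (rule moving_planeI[OF e between(1)])
    have R: "R = plane_reflection e l" by (simp add: fun_eq_iff R_def plane_reflection_def)
    have "w x \<ge> 0" if "x \<in> H" for x
      using ordered_across_all[OF e between(1)] that by (simp add: ordered_across_def w_def H_def R)
    then have strong: "AE y in lborel. y \<in> \<Omega> \<longrightarrow> w y > 0" by (rule strong_maximum_principle)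
    \<comment> \<open>on \<open>G\<close> both \<open>x\<close> and its mirror image have distance strictly between \<open>r1\<close> and \<open>r2\<close> from \<open>x0\<close>\<close>
    define G where "G = H \<inter> {x. norm (x - x0) < r2} \<inter> {x. norm (R x - x0) > r1}"
    have "open G"
      unfolding G_def by (intro open_Int open_H open_Collect_less continuous_intros continuous_R)
    have G: "x \<in> \<Omega> \<and> w x = 0" if "x \<in> G" for x
    proof -
      have "x \<in> H" "norm (x - x0) < r2" "norm (R x - x0) > r1" using that by (auto simp: G_def)
      have "0 \<le> 4 * l * ((x - x0) \<bullet> e - l)" using l \<open>x \<in> H\<close> by (simp add: H_def)
      then have "(norm (R x - x0))\<^sup>2 \<le> (norm (x - x0))\<^sup>2" unfolding norm_R_center_sq by simp
      then have "norm (R x - x0) \<le> norm (x - x0)" by (rule power2_le_imp_le) simp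
      then have "h (dist x x0) = h r1" "h (dist (R x) x0) = h r1"
        using \<open>norm (x - x0) < r2\<close> \<open>norm (R x - x0) > r1\<close> by (auto simp: dist_norm intro!: const)
      then have "w x = 0" by (simp add: w_def u_h)
      moreover have "x \<in> \<Omega>"
        using \<open>x \<in> H\<close> \<open>norm (R x - x0) \<le> norm (x - x0)\<close> \<open>norm (R x - x0) > r1\<close> r
        by (simp add: \<Omega>_def dist_norm norm_minus_commute)
      ultimately show ?thesis by simp
    qed
    from strong have "AE y in lborel. y \<notin> G" by eventually_elim (use G in force)
    then have "y \<notin> G" for y by (rule AE_lborel_imp_everywhere) (simp add: \<open>open G\<close>)
    moreover have "x0 + ((l + r2) / 2) *\<^sub>R e \<in> G"
    proof -
      define q where "q = (l + r2) / 2"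
      have q: "l < q" "q < r2" using between(3) by (simp_all add: q_def)
      moreover have "2 * l = r1 + r2" by (simp add: l_def)
      ultimately have q': "r1 < 2 * l - q" "0 < q" using between by linarith+
      have height: "(x0 + q *\<^sub>R e - x0) \<bullet> e = q" by simp
      have "R (x0 + q *\<^sub>R e) - x0 = q *\<^sub>R e + (2 * (l - q)) *\<^sub>R e"
        unfolding R_def height by simp
      also have "\<dots> = (2 * l - q) *\<^sub>R e" by (simp flip: scaleR_left_distrib)
      finally have "norm (R (x0 + q *\<^sub>R e) - x0) > r1" using q' e \<rho> r by simp
      moreover have "norm (x0 + q *\<^sub>R e - x0) < r2" using q q' e by simp
      moreover have "x0 + q *\<^sub>R e \<in> H" unfolding H_def mem_Collect_eq height by (rule q(1))
      ultimately have "x0 + q *\<^sub>R e \<in> G" by (simp add: G_def)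
      then show ?thesis by (simp add: q_def)
    qed
    ultimately show False by blast
  qed
  then have "strict_antimono_on {\<rho><..} h" by (intro monotone_onI) auto
  then show ?thesis unfolding radially_symmetric_decreasing_def using u_h by blast
qed

end

section \<open>Regularity of the data and conclusion\<close>

lemma locally_lipschitz_compact:
  assumes "locally_lipschitz f"
  obtains L where "0 \<le> L" "\<And>t t'. t \<in> {a..b} \<Longrightarrow> t' \<in> {a..b} \<Longrightarrow> \<bar>f t - f t'\<bar> \<le> L * \<bar>t - t'\<bar>"
proof -
  have "local_lipschitz {0::real} {a..b} (\<lambda>_. f)"
  proof (rule local_lipschitzI)
    fix t x :: real
    obtain r L where "r > 0" "L-lipschitz_on (cball x r) f"
      using assms unfolding locally_lipschitz_def by blast
    then have "L-lipschitz_on (cball x r \<inter> {a..b}) f" using lipschitz_on_subset by blast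
    then show "\<exists>u>0. \<exists>L. \<forall>t\<in>cball t u \<inter> {0}. L-lipschitz_on (cball x u \<inter> {a..b}) f"
      using \<open>r > 0\<close> by blast
  qed
  then obtain L where L: "\<And>t. t \<in> {0::real} \<Longrightarrow> L-lipschitz_on {a..b} f"
    by (rule local_lipschitz_compact_implies_lipschitz) auto
  then have "L-lipschitz_on {a..b} f" by simp
  then show ?thesis using that[of L] by (auto simp: lipschitz_on_def dist_real_def)
qed

lemma locally_lipschitz_continuous:
  assumes "locally_lipschitz f" shows "continuous_on UNIV f"
proof (rule continuous_at_imp_continuous_on, rule ballI)
  fix t :: real
  obtain r L where r: "r > 0" "L-lipschitz_on (cball t r) f"
    using assms unfolding locally_lipschitz_def by blast
  then have "continuous_on (cball t r) f" using lipschitz_on_continuous_on by blast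
  then show "isCont f t" using r(1) by (intro continuous_on_interior[of "cball t r"]) auto
qed

lemma holder_continuous_imp_continuous:
  assumes "0 < s" "holder_continuous s u" shows "continuous_on UNIV u"
proof -
  obtain C where C: "\<And>x y. \<bar>u x - u y\<bar> \<le> C * dist x y powr s"
    using assms(2) unfolding holder_continuous_def by blast
  have "(u \<longlongrightarrow> u x) (at x)" for x
  proof (rule Lim_transform_bound[where g="\<lambda>y. C * dist y x powr s", THEN LIM_zero_cancel])
    show "\<forall>\<^sub>F y in at x. norm (u y - u x) \<le> norm (C * dist y x powr s)"
      using C abs_ge_self order_trans by (intro always_eventually) (fastforce)
    have "((\<lambda>y. C * dist y x powr s) \<longlongrightarrow> C * 0 powr s) (at x)"
    proof (intro tendsto_intros tendsto_powr')
      show "((\<lambda>y. dist y x) \<longlongrightarrow> 0) (at x)"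
        using tendsto_dist[OF tendsto_ident_at[of x UNIV] tendsto_const[of x]] by simp
    qed (use assms(1) in auto)
    then show "((\<lambda>y. C * dist y x powr s) \<longlongrightarrow> 0) (at x)" by simp
  qed
  then show ?thesis by (simp add: continuous_on_def)
qed

theorem theorem1p10:
  fixes s a c \<rho> :: real and x0 :: "'a::euclidean_space"
    and f :: "real \<Rightarrow> real" and u :: "'a \<Rightarrow> real"
  assumes "0 < s" and "s < 1" and "0 < c" and "0 < a" and "0 < \<rho>"
    and "locally_lipschitz f"
    and "\<exists>t0>0. antimono_on {0..t0} f"
    and "holder_continuous s u"
    and "weak_solution c s (- cball x0 \<rho>) (\<lambda>x. f (u x)) u"
    and "\<forall>x\<in>cball x0 \<rho>. u x = a"
    and "\<forall>y\<in>sphere x0 \<rho>. \<exists>l<0. has_fractional_derivative s u y (outer_normal x0 \<rho> y) l"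
    and "\<forall>x\<in>- cball x0 \<rho>. 0 \<le> u x \<and> u x < a"
    and "(u \<longlongrightarrow> 0) at_infinity"
  shows "radially_symmetric_decreasing x0 \<rho> u"
proof -
  obtain t0 where t0: "t0 > 0" "antimono_on {0..t0} f" using assms(7) by blast
  obtain L where L: "0 \<le> L" "\<And>t t'. t \<in> {0..a} \<Longrightarrow> t' \<in> {0..a} \<Longrightarrow> \<bar>f t - f t'\<bar> \<le> L * \<bar>t - t'\<bar>"
    using locally_lipschitz_compact[OF assms(6), of 0 a] by blast
  interpret exterior_solution s c a \<rho> t0 L f u x0
  proof
    show "0 \<le> u x" for x using assms(4,10,12) by (cases "x \<in> cball x0 \<rho>") auto
    show "u x < a" if "x \<notin> cball x0 \<rho>" for x using assms(12) that by auto
    show "f t' \<le> f t" if "0 \<le> t" "t \<le> t'" "t' \<le> t0" for t t'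
      using monotone_onD[OF t0(2), of t t'] that by simp
  qed (use assms t0(1) L locally_lipschitz_continuous holder_continuous_imp_continuous in blast)+
  show ?thesis by (rule radially_symmetric_decreasing_u)
qed

end
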